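(* Let $\Omega\subset\mathbb{R}^2$ be one of the domains $\Omega_{l,s}$ described in the context (for $l$ large and $s$ near $0$). Then there exists a continuous, compactly supported stationary weak solution $(v,p)$ of the incompressible Euler equations on $\mathbb{R}^2$ such that $\operatorname{supp} v=\overline{\Omega}$. Furthermore, $(v,p)$ is analytic in $\Omega$.
   Context: Polar coordinates $(r,\theta)\in\mathbb{R}^+\times\mathbb{T}$, $\mathbb{T}=\mathbb{R}/2\pi\mathbb{Z}$. For every sufficiently large integer $l$ and all $s$ in a small neighborhood of $0$ there are $a_l\in(0,1)$ and analytic functions $b_{l,s},B_{l,s}$ on $\mathbb{T}$ of the form $b_{l,s}(\theta)=\alpha_l\cos l\theta+o(1)$, $B_{l,s}(\theta)=\beta_l\cos l\theta+o(1)$ ($\alpha_l,\beta_l\neq0$, $o(1)\to0$ as $s\to0$) such that the doubly connected bounded domain $\Omega_{l,s}=\{a_l+s b_{l,s}(\theta)<r<1+sB_{l,s}(\theta)\}$ carries a non-radial function $u$ with $\Delta u+\mu u=0$ in $\Omega_{l,s}$ for some $\mu\in\mathbb{R}$ and $\nabla u\equiv0$ on $\partial\Omega_{l,s}$. A pair $(v,p)\in L^2_{\mathrm{loc}}(\mathbb{R}^2,\mathbb{R}^2)\times L^1_{\mathrm{loc}}(\mathbb{R}^2)$ is a stationary weak solution of the incompressible Euler equations on $\mathbb{R}^2$ if $\int_{\mathbb{R}^2} v\cdot \nabla\phi\, dx=0$ and $\int_{\mathbb{R}^2} (v_i\,v_j\, \partial_i w_j+ p\,\mathrm{div}\, w)\,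 dx=0$ (summation over repeated indices) for all $\phi\in C^\infty_c(\mathbb{R}^2)$ and all $w\in C^\infty_c(\mathbb{R}^2,\mathbb{R}^2)$. *)

theory Defs
  imports "HOL-Analysis.Analysis"
begin

definition polar :: "real \<Rightarrow> real \<Rightarrow> real^2" where
  "polar r \<theta> = vector [r * cos \<theta>, r * sin \<theta>]"

definition polar_annulus :: "(real \<Rightarrow> real) \<Rightarrow> (real \<Rightarrow> real) \<Rightarrow> (real^2) set" where
  "polar_annulus f1 f2 = {x. \<exists>r \<theta>. r > 0 \<and> x = polar r \<theta> \<and> f1 \<theta> < r \<and> r < f2 \<theta>}"

definition analytic_on_torus :: "(real \<Rightarrow> real) \<Rightarrow> bool" where
  "analytic_on_torus f \<longleftrightarrow> (\<forall>\<theta>. f (\<theta> + 2 * pi) = f \<theta>) \<and>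
     (\<forall>x. \<exists>r>0. \<exists>c :: nat \<Rightarrow> real. \<forall>y. \<bar>y - x\<bar> < r \<longrightarrow> (\<lambda>n. c n * (y - x) ^ n) sums f y)"

definition real_analytic_on :: "(real^2 \<Rightarrow> real) \<Rightarrow> (real^2) set \<Rightarrow> bool" where
  "real_analytic_on f U \<longleftrightarrow> (\<forall>x\<in>U. \<exists>r>0. \<exists>c :: nat \<Rightarrow> nat \<Rightarrow> real. \<forall>y\<in>ball x r.
     ((\<lambda>(i, j). c i j * (y$1 - x$1) ^ i * (y$2 - x$2) ^ j) has_sum f y) UNIV)"

coinductive smooth_fun :: "(real^2 \<Rightarrow> real) \<Rightarrow> bool" where
  "(\<forall>x. f differentiable (at x)) \<Longrightarrow>
   (\<forall>i. smooth_fun (\<lambda>x. frechet_derivative f (at x) (axis i 1))) \<Longrightarrow> smooth_fun f"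

definition test_fun :: "(real^2 \<Rightarrow> real) \<Rightarrow> bool" where
  "test_fun \<phi> \<longleftrightarrow> smooth_fun \<phi> \<and> compact (closure {x. \<phi> x \<noteq> 0})"

definition test_field :: "(real^2 \<Rightarrow> real^2) \<Rightarrow> bool" where
  "test_field w \<longleftrightarrow> (\<forall>i. test_fun (\<lambda>x. w x $ i))"

definition pd :: "2 \<Rightarrow> (real^2 \<Rightarrow> real) \<Rightarrow> real^2 \<Rightarrow> real" where
  "pd i f x = frechet_derivative f (at x) (axis i 1)"

definition grad :: "(real^2 \<Rightarrow> real) \<Rightarrow> real^2 \<Rightarrow> real^2" where
  "grad f x = (\<chi> i. pd i f x)"

definition L2_loc :: "(real^2 \<Rightarrow> real^2) \<Rightarrow> bool" where
  "L2_loc v \<longleftrightarrow> v \<in> borel_measurable lborel \<and>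
     (\<forall>K. compact K \<longrightarrow> set_integrable lborel K (\<lambda>x. norm (v x) ^ 2))"

definition L1_loc :: "(real^2 \<Rightarrow> real) \<Rightarrow> bool" where
  "L1_loc p \<longleftrightarrow> p \<in> borel_measurable lborel \<and> (\<forall>K. compact K \<longrightarrow> set_integrable lborel K p)"

definition stationary_weak_euler :: "(real^2 \<Rightarrow> real^2) \<Rightarrow> (real^2 \<Rightarrow> real) \<Rightarrow> bool" where
  "stationary_weak_euler v p \<longleftrightarrow> L2_loc v \<and> L1_loc p \<and>
     (\<forall>\<phi>. test_fun \<phi> \<longrightarrow> (\<integral>x. v x \<bullet> grad \<phi> x \<partial>lborel) = 0) \<and>
     (\<forall>w. test_field w \<longrightarrow>
        (\<integral>x. (\<Sum>i\<in>UNIV. \<Sum>j\<in>UNIV. v x $ i * v x $ j * pd i (\<lambda>y. w y $ j) x)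
             + p x * (\<Sum>i\<in>UNIV. pd i (\<lambda>y. w y $ i) x) \<partial>lborel) = 0)"

end

theory Submission
  imports "HOL-Complex_Analysis.Conformal_Mappings" Defs
begin

text \<open>Take \<open>v = \<nabla>\<^sup>\<bottom> u\<close> in \<open>\<Omega>\<close>, extended by \<open>0\<close>. Since \<open>\<Delta> u = - \<mu> u\<close>,
  \<open>v\<close> solves the Euler equations in \<open>\<Omega>\<close> with pressure \<open>- (\<bar>\<nabla> u\<bar>\<^sup>2 + \<mu> u\<^sup>2) / 2 + const\<close>.
  As \<open>\<nabla> u\<close> vanishes on the boundary, \<open>u\<close> is constant on each of the two boundary curves, so this pressure
  extends by constants to a continuous function of compact support.

  A continuous field that is differentiable and divergence free off a rectifiable curve is weakly divergence
  free: in a grid of mesh \<open>\<tau>\<close> only \<open>O(1 / \<tau>)\<close> squares meet the curve, and the flux through the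
  boundary of each of them is \<open>o(\<tau>)\<close>, whereas all other fluxes vanish by Goursat's argument. Applied to \<open>v\<close>
  and to the rows of \<open>v \<otimes> v + p I\<close>, this gives the weak equations without any regularity of \<open>D\<^sup>2 u\<close>
  up to the boundary.

  Analyticity of \<open>u\<close>: the Fourier coefficients of \<open>u\<close> on the circles around a point are multiples of Bessel
  functions of the radius, which leads to an explicit absolutely convergent double power series. The support of
  \<open>v\<close> is then all of the closure by unique continuation, as a constant \<open>u\<close> would be radial.\<close>

section \<open>The divergence theorem on rectangles\<close>

text \<open>The hypotheses control \<open>u\<close> only to first order up to the boundary, and
  inside \<open>\<Omega>\<close> the field \<open>Du\<close> is merely differentiable: nothing is
  known about continuity of \<open>D2u\<close>. One divergence theorem that asks for
  differentiability alone therefore has to serve twice: in the plane for the weak equations, and in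
  the \<open>(r, t)\<close> plane of polar coordinates, where the flux of
  \<open>u \<nabla>w - w \<nabla>u\<close> for a separated solution \<open>w\<close> determines how
  each Fourier coefficient depends on the radius.

  Analyticity also supplies the symmetry of \<open>D2u\<close>: both mixed entries are the same
  Taylor coefficient. Without symmetry the rotated gradient would not be divergence free.

  The estimate o(\<tau>) for a square on the curve comes from uniform continuity of the field, the
  count O(1/\<tau>) from a Lipschitz parametrization of the boundary; their product tends to 0.

  The additive constant of the pressure is chosen so that the pressure vanishes on the outer curve.
  A constant, possibly nonzero, remains in the hole; this keeps the support compact because the hole
  is bounded.\<close>

definition pt :: "real \<Rightarrow> real \<Rightarrow> real^2" where
  "pt x y = vector [x, y]"

lemma pt_nth [simp]: "pt x y $ 1 = x" "pt x y $ 2 = y"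
  by (simp_all add: pt_def)

lemma pt_collapse [simp]: "pt (z $ 1) (z $ 2) = z"
  by (simp add: vec_eq_iff forall_2)

lemma pt_axis: "pt x y = x *\<^sub>R axis 1 1 + y *\<^sub>R axis 2 1"
  by (simp add: vec_eq_iff forall_2 axis_def)

lemma pt_arith: "pt a b + pt c d = pt (a + c) (b + d)" "pt a b - pt c d = pt (a - c) (b - d)"
  "k *\<^sub>R pt a b = pt (k * a) (k * b)" "pt 0 0 = 0"
  by (simp_all add: vec_eq_iff forall_2)

lemma inner_2: "(x::real^2) \<bullet> y = x $ 1 * y $ 1 + x $ 2 * y $ 2"
  by (simp add: inner_vec_def sum_2)

lemma norm_2: "norm (x::real^2) = sqrt ((x $ 1)\<^sup>2 + (x $ 2)\<^sup>2)"
  by (simp add: norm_eq_sqrt_inner inner_2 power2_eq_square)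

lemma norm_le_2: "norm (x::real^2) \<le> \<bar>x $ 1\<bar> + \<bar>x $ 2\<bar>"
  unfolding norm_2 by (rule sqrt_sum_squares_le_sum_abs)

lemma has_derivative_pt [derivative_intros]:
  "(f has_derivative f') F \<Longrightarrow> (g has_derivative g') F \<Longrightarrow>
   ((\<lambda>x. pt (f x) (g x)) has_derivative (\<lambda>h. pt (f' h) (g' h))) F"
  unfolding pt_axis by (intro has_derivative_add has_derivative_scaleR_left)

lemma continuous_on_pt [continuous_intros]:
  "continuous_on S f \<Longrightarrow> continuous_on S g \<Longrightarrow> continuous_on S (\<lambda>x. pt (f x) (g x))"
  unfolding pt_axis by (intro continuous_intros)

lemma cbox_2: "cbox (pt a c) (pt b d) = {z. a \<le> z $ 1 \<and> z $ 1 \<le> b \<and> c \<le> z $ 2 \<and> z $ 2 \<le> d}"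
  by (auto simp: mem_box_cart forall_2)

lemma linear_2:
  assumes "linear (L :: real^2 \<Rightarrow> 'a::real_vector)"
  shows "L h = h $ 1 *\<^sub>R L (axis 1 1) + h $ 2 *\<^sub>R L (axis 2 1)"
proof -
  have "h = h $ 1 *\<^sub>R axis 1 1 + h $ 2 *\<^sub>R axis 2 1"
    by (simp add: vec_eq_iff forall_2 axis_def)
  then have "L h = L (h $ 1 *\<^sub>R axis 1 1 + h $ 2 *\<^sub>R axis 2 1)"
    by (rule arg_cong)
  then show ?thesis
    by (simp only: linear_add[OF assms] linear_scale[OF assms])
qed

lemma content_cbox_2: "a \<le> b \<Longrightarrow> c \<le> d \<Longrightarrow> measure lborel (cbox (pt a c) (pt b d)) = (b - a) * (d - c)"
proof -
  assume "a \<le> b" "c \<le> d"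
  then have "pt a c \<in> cbox (pt a c) (pt b d)"
    by (simp add: cbox_2)
  then have "cbox (pt a c) (pt b d) \<noteq> {}"
    by blast
  then show ?thesis
    by (simp add: content_cbox_cart UNIV_2)
qed

text \<open>The outward flux of the field \<open>(A, B)\<close> through the boundary of the rectangle
  \<open>[a, b] \<times> [c, d]\<close>, minus the integral of \<open>D\<close>, the would-be divergence, over it.\<close>

definition defect ::
  "(real^2 \<Rightarrow> real) \<Rightarrow> (real^2 \<Rightarrow> real) \<Rightarrow> (real^2 \<Rightarrow> real) \<Rightarrow> real \<Rightarrow> real \<Rightarrow> real \<Rightarrow> real \<Rightarrow> real" where
  "defect A B D a b c d = integral {c..d} (\<lambda>y. A (pt b y) - A (pt a y))
     + integral {a..b} (\<lambda>x. B (pt x d) - B (pt x c)) - integral (cbox (pt a c) (pt b d)) D"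

lemma continuous_on_slices:
  assumes "continuous_on (cbox (pt a c) (pt b d)) A"
  shows "a \<le> x \<Longrightarrow> x \<le> b \<Longrightarrow> continuous_on {c..d} (\<lambda>y. A (pt x y))"
    and "c \<le> y \<Longrightarrow> y \<le> d \<Longrightarrow> continuous_on {a..b} (\<lambda>x. A (pt x y))"
proof -
  show "a \<le> x \<Longrightarrow> x \<le> b \<Longrightarrow> continuous_on {c..d} (\<lambda>y. A (pt x y))"
    by (rule continuous_on_compose2[OF assms]) (auto intro!: continuous_intros simp: cbox_2)
  show "c \<le> y \<Longrightarrow> y \<le> d \<Longrightarrow> continuous_on {a..b} (\<lambda>x. A (pt x y))"
    by (rule continuous_on_compose2[OF assms]) (auto intro!: continuous_intros simp: cbox_2)
qed

text \<open>The flux through the common side enters the two halves with opposite signs, so the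
  defect is additive. Bisection and grids both rest on this.\<close>

lemma defect_split_1:
  assumes A: "continuous_on (cbox (pt a c) (pt b d)) A"
    and B: "continuous_on (cbox (pt a c) (pt b d)) B"
    and D: "continuous_on (cbox (pt a c) (pt b d)) D"
    and m: "a \<le> m" "m \<le> b" and cd: "c \<le> d"
  shows "defect A B D a b c d = defect A B D a m c d + defect A B D m b c d"
proof -
  have i: "(\<lambda>y. A (pt x y)) integrable_on {c..d}" if "a \<le> x" "x \<le> b" for x
    using continuous_on_slices(1)[OF A that] by (rule integrable_continuous_real)
  have j: "(\<lambda>x. B (pt x y)) integrable_on {a..b}" if "c \<le> y" "y \<le> d" for y
    using continuous_on_slices(2)[OF B that] by (rule integrable_continuous_real)
  have j': "(\<lambda>x. B (pt x d) - B (pt x c)) integrable_on {a..b}"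
    using j cd by (intro integrable_diff) auto
  have "integral (cbox (pt a c) (pt b d)) D =
     integral (cbox (pt a c) (pt b d) \<inter> {x. x \<bullet> axis 1 1 \<le> m}) D +
     integral (cbox (pt a c) (pt b d) \<inter> {x. x \<bullet> axis 1 1 \<ge> m}) D"
    by (rule integral_split) (auto intro: integrable_continuous D)
  also have "cbox (pt a c) (pt b d) \<inter> {x. x \<bullet> axis 1 1 \<le> m} = cbox (pt a c) (pt m d)"
    using m by (auto simp: cbox_2 inner_axis)
  also have "cbox (pt a c) (pt b d) \<inter> {x. x \<bullet> axis 1 1 \<ge> m} = cbox (pt m c) (pt b d)"
    using m by (auto simp: cbox_2 inner_axis)
  finally have 1: "integral (cbox (pt a c) (pt b d)) D =
    integral (cbox (pt a c) (pt m d)) D + integral (cbox (pt m c) (pt b d)) D" .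
  have "integral {c..d} (\<lambda>y. A (pt x y) - A (pt x' y)) =
      integral {c..d} (\<lambda>y. A (pt x y)) - integral {c..d} (\<lambda>y. A (pt x' y))"
    if "x \<in> {a..b}" "x' \<in> {a..b}" for x x'
    using that by (intro integral_diff i) auto
  with 1 Henstock_Kurzweil_Integration.integral_combine[OF m j'] m show ?thesis
    unfolding defect_def by simp
qed

lemma defect_split_2:
  assumes A: "continuous_on (cbox (pt a c) (pt b d)) A"
    and B: "continuous_on (cbox (pt a c) (pt b d)) B"
    and D: "continuous_on (cbox (pt a c) (pt b d)) D"
    and m: "c \<le> m" "m \<le> d" and ab: "a \<le> b"
  shows "defect A B D a b c d = defect A B D a b c m + defect A B D a b m d"
proof -
  have i: "(\<lambda>y. A (pt x y)) integrable_on {c..d}" if "a \<le> x" "x \<le> b" for x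
    using continuous_on_slices(1)[OF A that] by (rule integrable_continuous_real)
  have j: "(\<lambda>x. B (pt x y)) integrable_on {a..b}" if "c \<le> y" "y \<le> d" for y
    using continuous_on_slices(2)[OF B that] by (rule integrable_continuous_real)
  have i': "(\<lambda>y. A (pt b y) - A (pt a y)) integrable_on {c..d}"
    using i ab by (intro integrable_diff) auto
  have "integral (cbox (pt a c) (pt b d)) D =
     integral (cbox (pt a c) (pt b d) \<inter> {x. x \<bullet> axis 2 1 \<le> m}) D +
     integral (cbox (pt a c) (pt b d) \<inter> {x. x \<bullet> axis 2 1 \<ge> m}) D"
    by (rule integral_split) (auto intro: integrable_continuous D)
  also have "cbox (pt a c) (pt b d) \<inter> {x. x \<bullet> axis 2 1 \<le> m} = cbox (pt a c) (pt b m)"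
    using m by (auto simp: cbox_2 inner_axis)
  also have "cbox (pt a c) (pt b d) \<inter> {x. x \<bullet> axis 2 1 \<ge> m} = cbox (pt a m) (pt b d)"
    using m by (auto simp: cbox_2 inner_axis)
  finally have 1: "integral (cbox (pt a c) (pt b d)) D =
    integral (cbox (pt a c) (pt b m)) D + integral (cbox (pt a m) (pt b d)) D" .
  have "integral {a..b} (\<lambda>x. B (pt x y) - B (pt x y')) =
      integral {a..b} (\<lambda>x. B (pt x y)) - integral {a..b} (\<lambda>x. B (pt x y'))"
    if "y \<in> {c..d}" "y' \<in> {c..d}" for y y'
    using that by (intro integral_diff j) auto
  with 1 Henstock_Kurzweil_Integration.integral_combine[OF m i'] m show ?thesis
    unfolding defect_def by simp
qed

lemma integral_abs_bound:
  fixes f :: "real^2 \<Rightarrow> real"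
  assumes "continuous_on (cbox (pt a c) (pt b d)) f" "a \<le> b" "c \<le> d" "0 \<le> M"
    and "\<And>z. z \<in> cbox (pt a c) (pt b d) \<Longrightarrow> \<bar>f z\<bar> \<le> M"
  shows "\<bar>integral (cbox (pt a c) (pt b d)) f\<bar> \<le> M * ((b - a) * (d - c))"
proof -
  have "f integrable_on cbox (pt a c) (pt b d)"
    using assms(1) by (rule integrable_continuous)
  from has_integral_bound[OF \<open>0 \<le> M\<close> this[THEN integrable_integral]]
  show ?thesis using assms by (simp add: content_cbox_2)
qed

lemma integral_abs_bound_1:
  fixes f :: "real \<Rightarrow> real"
  assumes "continuous_on {a..b} f" "a \<le> b" "0 \<le> M" "\<And>x. a \<le> x \<Longrightarrow> x \<le> b \<Longrightarrow> \<bar>f x\<bar> \<le> M"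
  shows "\<bar>integral {a..b} f\<bar> \<le> M * (b - a)"
  using integral_bound[of a b f M] assms by auto

text \<open>Only differences of \<open>A\<close> and \<open>B\<close> across opposite sides are
  bounded: on a small grid square these are oscillations and hence small, whereas the fields
  themselves are not.\<close>

lemma defect_bound:
  assumes A: "continuous_on (cbox (pt a c) (pt b d)) A"
    and B: "continuous_on (cbox (pt a c) (pt b d)) B"
    and D: "continuous_on (cbox (pt a c) (pt b d)) D"
    and ab: "a \<le> b" "c \<le> d" and M: "0 \<le> M" "0 \<le> N"
    and bd: "\<And>y. c \<le> y \<Longrightarrow> y \<le> d \<Longrightarrow> \<bar>A (pt b y) - A (pt a y)\<bar> \<le> M"
      "\<And>x. a \<le> x \<Longrightarrow> x \<le> b \<Longrightarrow> \<bar>B (pt x d) - B (pt x c)\<bar> \<le> M"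
      "\<And>z. z \<in> cbox (pt a c) (pt b d) \<Longrightarrow> \<bar>D z\<bar> \<le> N"
  shows "\<bar>defect A B D a b c d\<bar> \<le> M * (d - c) + M * (b - a) + N * ((b - a) * (d - c))"
proof -
  have "\<bar>integral {c..d} (\<lambda>y. A (pt b y) - A (pt a y))\<bar> \<le> M * (d - c)"
    using ab M bd
    by (intro integral_abs_bound_1 continuous_on_diff continuous_on_slices(1)[OF A]) auto
  moreover have "\<bar>integral {a..b} (\<lambda>x. B (pt x d) - B (pt x c))\<bar> \<le> M * (b - a)"
    using ab M bd
    by (intro integral_abs_bound_1 continuous_on_diff continuous_on_slices(2)[OF B]) auto
  moreover have "\<bar>integral (cbox (pt a c) (pt b d)) D\<bar> \<le> N * ((b - a) * (d - c))"
    using ab M bd by (intro integral_abs_bound D) auto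
  ultimately show ?thesis
    unfolding defect_def by linarith
qed

text \<open>An affine field has constant divergence \<open>p + s\<close> and defect 0, so a first
  order Taylor polynomial may be subtracted without changing the defect.\<close>

lemma defect_diff_affine:
  assumes A: "continuous_on (cbox (pt a c) (pt b d)) A"
    and B: "continuous_on (cbox (pt a c) (pt b d)) B"
    and D: "continuous_on (cbox (pt a c) (pt b d)) D"
    and ab: "a \<le> b" "c \<le> d"
  shows "defect A B D a b c d =
    defect (\<lambda>z. A z - (k1 + p * z $ 1 + q * z $ 2)) (\<lambda>z. B z - (k2 + r * z $ 1 + s * z $ 2))
      (\<lambda>z. D z - (p + s)) a b c d"
proof -
  have cA: "(\<lambda>y. A (pt b y) - A (pt a y)) integrable_on {c..d}"
    using ab by (intro integrable_continuous_real continuous_on_diff continuous_on_slices(1)[OF A]) auto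
  have cB: "(\<lambda>x. B (pt x d) - B (pt x c)) integrable_on {a..b}"
    using ab by (intro integrable_continuous_real continuous_on_diff continuous_on_slices(2)[OF B]) auto
  have cD: "D integrable_on cbox (pt a c) (pt b d)"
    using D by (rule integrable_continuous)
  have 1: "(\<lambda>y. A (pt b y) - (k1 + p * b + q * y) - (A (pt a y) - (k1 + p * a + q * y)))
     = (\<lambda>y. (A (pt b y) - A (pt a y)) - p * (b - a))"
    by (auto simp: algebra_simps)
  have 2: "(\<lambda>x. B (pt x d) - (k2 + r * x + s * d) - (B (pt x c) - (k2 + r * x + s * c)))
     = (\<lambda>x. (B (pt x d) - B (pt x c)) - s * (d - c))"
    by (auto simp: algebra_simps)
  have 3: "integral {c..d} (\<lambda>y. (A (pt b y) - A (pt a y)) - p * (b - a))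
     = integral {c..d} (\<lambda>y. A (pt b y) - A (pt a y)) - (d - c) * (p * (b - a))"
    using ab by (subst integral_diff[OF cA]) auto
  have 4: "integral {a..b} (\<lambda>x. (B (pt x d) - B (pt x c)) - s * (d - c))
     = integral {a..b} (\<lambda>x. B (pt x d) - B (pt x c)) - (b - a) * (s * (d - c))"
    using ab by (subst integral_diff[OF cB]) auto
  have 5: "integral (cbox (pt a c) (pt b d)) (\<lambda>z. D z - (p + s))
     = integral (cbox (pt a c) (pt b d)) D - (b - a) * (d - c) * (p + s)"
    using ab by (subst integral_diff[OF cD]) (auto simp: content_cbox_2)
  show ?thesis
    unfolding defect_def pt_nth 1 2 3 4 5 by (simp add: algebra_simps)
qed

text \<open>The defect is the sum of those of the four quarters, so one quarter carries at least a
  fourth of it in absolute value.\<close>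

lemma defect_quarter:
  assumes A: "continuous_on (cbox (pt a c) (pt b d)) A"
    and B: "continuous_on (cbox (pt a c) (pt b d)) B"
    and D: "continuous_on (cbox (pt a c) (pt b d)) D"
    and ab: "a \<le> b" "c \<le> d"
  obtains a' b' c' d' where "a \<le> a'" "b' \<le> b" "c \<le> c'" "d' \<le> d" "b' - a' = (b - a) / 2"
    "d' - c' = (d - c) / 2" "\<bar>defect A B D a b c d\<bar> \<le> 4 * \<bar>defect A B D a' b' c' d'\<bar>"
proof -
  define m where "m = (a + b) / 2"
  define n where "n = (c + d) / 2"
  have m: "a \<le> m" "m \<le> b" "m - a = (b - a) / 2" "b - m = (b - a) / 2"
    and n: "c \<le> n" "n \<le> d" "n - c = (d - c) / 2" "d - n = (d - c) / 2"
    using ab by (auto simp: m_def n_def field_simps)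
  have sub: "continuous_on (cbox (pt a' c) (pt b' d)) f"
    if "continuous_on (cbox (pt a c) (pt b d)) f" "a \<le> a'" "b' \<le> b" for f :: "real^2 \<Rightarrow> real" and a' b'
    using that by (elim continuous_on_subset) (auto simp: cbox_2)
  have eq: "defect A B D a b c d = defect A B D a m c n + defect A B D a m n d +
      (defect A B D m b c n + defect A B D m b n d)"
    using defect_split_1[OF A B D m(1,2) ab(2)]
      defect_split_2[OF A[THEN sub] B[THEN sub] D[THEN sub] n(1,2), of a m]
      defect_split_2[OF A[THEN sub] B[THEN sub] D[THEN sub] n(1,2), of m b] m by simp
  have "\<bar>w + x + (y + z)\<bar> \<le> 4 * \<bar>w\<bar> \<or> \<bar>w + x + (y + z)\<bar> \<le> 4 * \<bar>x\<bar> \<or>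
      \<bar>w + x + (y + z)\<bar> \<le> 4 * \<bar>y\<bar> \<or> \<bar>w + x + (y + z)\<bar> \<le> 4 * \<bar>z\<bar>" for w x y z :: real
    by linarith
  from this[of "defect A B D a m c n" "defect A B D a m n d" "defect A B D m b c n" "defect A B D m b n d",
      folded eq]
  consider "\<bar>defect A B D a b c d\<bar> \<le> 4 * \<bar>defect A B D a m c n\<bar>"
    | "\<bar>defect A B D a b c d\<bar> \<le> 4 * \<bar>defect A B D a m n d\<bar>"
    | "\<bar>defect A B D a b c d\<bar> \<le> 4 * \<bar>defect A B D m b c n\<bar>"
    | "\<bar>defect A B D a b c d\<bar> \<le> 4 * \<bar>defect A B D m b n d\<bar>"
    by blast
  then show thesis
  proof cases
    case 1 then show thesis using that[of a m c n] m n by simp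
  next
    case 2 then show thesis using that[of a m n d] m n by simp
  next
    case 3 then show thesis using that[of m b c n] m n by simp
  next
    case 4 then show thesis using that[of m b n d] m n by simp
  qed
qed

text \<open>Goursat's bisection argument; the field need not be continuously differentiable.\<close>

theorem divergence_rectangle:
  assumes A: "\<And>z. z \<in> cbox (pt a c) (pt b d) \<Longrightarrow> (A has_derivative A' z) (at z within cbox (pt a c) (pt b d))"
    and B: "\<And>z. z \<in> cbox (pt a c) (pt b d) \<Longrightarrow> (B has_derivative B' z) (at z within cbox (pt a c) (pt b d))"
    and D: "continuous_on (cbox (pt a c) (pt b d)) D"
    and div: "\<And>z. z \<in> cbox (pt a c) (pt b d) \<Longrightarrow> A' z (axis 1 1) + B' z (axis 2 1) = D z"
    and ab: "a \<le> b" "c \<le> d"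
  shows "defect A B D a b c d = 0"
proof -
  let ?Q = "cbox (pt a c) (pt b d)"
  have cA: "continuous_on ?Q A" and cB: "continuous_on ?Q B"
    using A B has_derivative_continuous_on by blast+
  define R where "R = (\<lambda>(p::real,q::real,r::real,s::real). cbox (pt p r) (pt q s))"
  \<comment> \<open>The invariant of the bisection: after \<open>n\<close> steps both sides are
    divided by \<open>2 ^ n\<close>, while at least the fraction \<open>4 ^ (- n)\<close> of the
    original defect survives.\<close>
  define P where "P = (\<lambda>n (p,q,r,s). a \<le> p \<and> q \<le> b \<and> c \<le> r \<and> s \<le> d \<and>
     q - p = (b - a) / 2 ^ n \<and> s - r = (d - c) / 2 ^ n \<and>
     \<bar>defect A B D a b c d\<bar> \<le> 4 ^ n * \<bar>defect A B D p q r s\<bar>)"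
  have "\<exists>f. \<forall>n. P n (f n) \<and> R (f (Suc n)) \<subseteq> R (f n)"
  proof (rule dependent_nat_choice)
    show "\<exists>x. P 0 x"
      by (rule exI[of _ "(a, b, c, d)"]) (auto simp: P_def)
  next
    fix x n assume "P n x"
    obtain p q r s where x: "x = (p, q, r, s)" by (cases x)
    have P: "a \<le> p" "q \<le> b" "c \<le> r" "s \<le> d" "q - p = (b - a) / 2 ^ n" "s - r = (d - c) / 2 ^ n"
      "\<bar>defect A B D a b c d\<bar> \<le> 4 ^ n * \<bar>defect A B D p q r s\<bar>"
      using \<open>P n x\<close> by (auto simp: P_def x)
    have pq: "p \<le> q" "r \<le> s"
    proof -
      have "(b - a) / 2 ^ n \<ge> 0" "(d - c) / 2 ^ n \<ge> 0" using ab by auto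
      with P(5,6) show "p \<le> q" "r \<le> s" by linarith+
    qed
    have sub: "cbox (pt p r) (pt q s) \<subseteq> ?Q"
      using P by (auto simp: cbox_2)
    obtain p' q' r' s' where q: "p \<le> p'" "q' \<le> q" "r \<le> r'" "s' \<le> s" "q' - p' = (q - p) / 2"
      "s' - r' = (s - r) / 2" "\<bar>defect A B D p q r s\<bar> \<le> 4 * \<bar>defect A B D p' q' r' s'\<bar>"
      using defect_quarter[OF continuous_on_subset[OF cA sub] continuous_on_subset[OF cB sub]
          continuous_on_subset[OF D sub] pq] by metis
    have "\<bar>defect A B D a b c d\<bar> \<le> 4 ^ n * (4 * \<bar>defect A B D p' q' r' s'\<bar>)"
      by (rule order_trans[OF P(7)]) (use q(7) in \<open>simp add: mult_left_mono\<close>)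
    then have "P (Suc n) (p', q', r', s')"
      using P q by (auto simp: P_def)
    moreover have "R (p', q', r', s') \<subseteq> R x"
      using q by (auto simp: R_def x cbox_2)
    ultimately show "\<exists>y. P (Suc n) y \<and> R y \<subseteq> R x" by blast
  qed
  then obtain f where f: "\<And>n. P n (f n)" "\<And>n. R (f (Suc n)) \<subseteq> R (f n)" by metis
  have facts: "\<exists>p q r s. f n = (p, q, r, s) \<and> a \<le> p \<and> p \<le> q \<and> q \<le> b \<and> c \<le> r \<and> r \<le> s \<and> s \<le> d \<and>
     q - p = (b - a) / 2 ^ n \<and> s - r = (d - c) / 2 ^ n \<and>
     \<bar>defect A B D a b c d\<bar> \<le> 4 ^ n * \<bar>defect A B D p q r s\<bar>" for n
  proof -
    obtain p q r s where x: "f n = (p, q, r, s)" by (cases "f n")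
    have "(b - a) / 2 ^ n \<ge> 0" "(d - c) / 2 ^ n \<ge> 0" using ab by auto
    with f(1)[of n] show ?thesis by (auto simp: P_def x)
  qed
  have "(\<Inter>n. R (f n)) \<noteq> {}"
  proof (rule compact_nest)
    fix n
    obtain p q r s where "f n = (p, q, r, s)" "p \<le> q" "r \<le> s" using facts[of n] by auto
    then have "R (f n) = cbox (pt p r) (pt q s)" "pt p r \<in> R (f n)"
      by (simp_all add: R_def cbox_2)
    then have "compact (R (f n))" "pt p r \<in> R (f n)" by simp_all
    then show "compact (R (f n))" "R (f n) \<noteq> {}" by blast+
  next
    show "R (f n) \<subseteq> R (f m)" if "m \<le> n" for m n
      using that f(2) by (rule lift_Suc_antimono_le[of "\<lambda>n. R (f n)", rotated])
  qed
  then obtain z where z: "\<And>n. z \<in> R (f n)" by auto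
  have zQ: "z \<in> ?Q"
    using z[of 0] facts[of 0] by (force simp: R_def cbox_2)
  let ?h = "(b - a) + (d - c)"
  have "\<bar>defect A B D a b c d\<bar> \<le> e" if "e > 0" for e
  proof -
    \<comment> \<open>The estimate below ends with \<open>3 * \<epsilon>\<close> times the square of
      the initial \<open>?h\<close>; the 6 leaves room for this, and the summand 1 keeps the
      quotient defined for a degenerate rectangle.\<close>
    define \<epsilon> where "\<epsilon> = e / (6 * (?h\<^sup>2 + 1))"
    have h2: "?h\<^sup>2 + 1 > 0" by (rule add_nonneg_pos) auto
    then have \<epsilon>: "\<epsilon> > 0" unfolding \<epsilon>_def using that by (intro divide_pos_pos mult_pos_pos) auto
    from A[OF zQ] \<epsilon> obtain d1 where d1: "d1 > 0"
      "\<And>y. y \<in> ?Q \<Longrightarrow> norm (y - z) < d1 \<Longrightarrow> norm (A y - A z - A' z (y - z)) \<le> \<epsilon> * norm (y - z)"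
      unfolding has_derivative_within_alt by meson
    from B[OF zQ] \<epsilon> obtain d2 where d2: "d2 > 0"
      "\<And>y. y \<in> ?Q \<Longrightarrow> norm (y - z) < d2 \<Longrightarrow> norm (B y - B z - B' z (y - z)) \<le> \<epsilon> * norm (y - z)"
      unfolding has_derivative_within_alt by meson
    from D zQ \<epsilon> obtain d3 where d3: "d3 > 0"
      "\<And>y. y \<in> ?Q \<Longrightarrow> dist y z < d3 \<Longrightarrow> dist (D y) (D z) < \<epsilon>"
      unfolding continuous_on_iff by metis
    define \<delta> where "\<delta> = min d1 (min d2 d3)"
    have "\<delta> > 0" using d1 d2 d3 by (auto simp: \<delta>_def)
    have "(\<lambda>n. ?h * (1/2) ^ n) \<longlonglongrightarrow> ?h * 0"
      by (intro tendsto_mult tendsto_const LIMSEQ_realpow_zero) auto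
    then have "eventually (\<lambda>n. ?h * (1/2) ^ n < \<delta>) sequentially"
      using \<open>\<delta> > 0\<close> by (intro order_tendstoD(2)[of _ 0]) auto
    then obtain n where n: "?h * (1/2) ^ n < \<delta>"
      by (auto simp: eventually_sequentially)
    obtain p q r s where x: "f n = (p, q, r, s)" "a \<le> p" "p \<le> q" "q \<le> b" "c \<le> r" "r \<le> s" "s \<le> d"
      "q - p = (b - a) / 2 ^ n" "s - r = (d - c) / 2 ^ n"
      "\<bar>defect A B D a b c d\<bar> \<le> 4 ^ n * \<bar>defect A B D p q r s\<bar>"
      using facts[of n] by blast
    define t where "t = (q - p) + (s - r)"
    have t: "t = ?h * (1/2) ^ n" "0 \<le> t"
      using x by (auto simp: t_def field_simps)
    let ?q = "cbox (pt p r) (pt q s)"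
    have zq: "z \<in> ?q" using z[of n] by (simp add: R_def x)
    have sub: "?q \<subseteq> ?Q" using x by (auto simp: cbox_2)
    have near: "norm (y - z) \<le> t" if "y \<in> ?q" for y
      using norm_le_2[of "y - z"] that zq unfolding t_def cbox_2 by auto
    \<comment> \<open>The entries of the two derivatives at the limit point \<open>z\<close>.
      Subtracting the resulting affine field leaves remainders of size \<open>\<epsilon> * t\<close>
      for the field and \<open>\<epsilon>\<close> for the divergence.\<close>
    define a1 where "a1 = A' z (axis 1 1)"
    define a2 where "a2 = A' z (axis 2 1)"
    define b1 where "b1 = B' z (axis 1 1)"
    define b2 where "b2 = B' z (axis 2 1)"
    have lA: "A' z h = a1 * h $ 1 + a2 * h $ 2" and lB: "B' z h = b1 * h $ 1 + b2 * h $ 2" for h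
      using linear_2[OF has_derivative_linear[OF A[OF zQ]], of h]
        linear_2[OF has_derivative_linear[OF B[OF zQ]], of h]
      by (auto simp: a1_def a2_def b1_def b2_def)
    define k1 where "k1 = A z - a1 * z $ 1 - a2 * z $ 2"
    define k2 where "k2 = B z - b1 * z $ 1 - b2 * z $ 2"
    define Ar where "Ar = (\<lambda>y. A y - (k1 + a1 * y $ 1 + a2 * y $ 2))"
    define Br where "Br = (\<lambda>y. B y - (k2 + b1 * y $ 1 + b2 * y $ 2))"
    define Dr where "Dr = (\<lambda>y. D y - (a1 + b2))"
    have cAs: "continuous_on ?q A" "continuous_on ?q B" "continuous_on ?q D"
      using cA cB D sub continuous_on_subset by blast+
    have cs: "continuous_on ?q Ar" "continuous_on ?q Br" "continuous_on ?q Dr"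
      unfolding Ar_def Br_def Dr_def by (intro continuous_intros cAs)+
    have bA: "\<bar>Ar y\<bar> \<le> \<epsilon> * t" and bB: "\<bar>Br y\<bar> \<le> \<epsilon> * t" and bD: "\<bar>Dr y\<bar> \<le> \<epsilon>" if "y \<in> ?q" for y
    proof -
      have y: "y \<in> ?Q" "norm (y - z) < \<delta>" "norm (y - z) \<le> t"
        using that sub near[OF that] n t by auto
      have "\<epsilon> * norm (y - z) \<le> \<epsilon> * t" using y(3) \<epsilon> by (intro mult_left_mono) auto
      moreover have "Ar y = A y - A z - A' z (y - z)" "Br y = B y - B z - B' z (y - z)"
        by (auto simp: Ar_def Br_def lA lB k1_def k2_def algebra_simps)
      moreover have "norm (A y - A z - A' z (y - z)) \<le> \<epsilon> * norm (y - z)"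
        "norm (B y - B z - B' z (y - z)) \<le> \<epsilon> * norm (y - z)"
        using y d1(2)[of y] d2(2)[of y] by (auto simp: \<delta>_def)
      ultimately show "\<bar>Ar y\<bar> \<le> \<epsilon> * t" "\<bar>Br y\<bar> \<le> \<epsilon> * t"
        by auto
      have "dist (D y) (D z) < \<epsilon>" using y d3(2)[of y] by (auto simp: \<delta>_def dist_norm)
      moreover have "D z = a1 + b2" using div[OF zQ] by (simp add: a1_def b2_def)
      ultimately show "\<bar>Dr y\<bar> \<le> \<epsilon>" by (simp add: Dr_def dist_real_def)
    qed
    have "defect A B D p q r s = defect Ar Br Dr p q r s"
      unfolding Ar_def Br_def Dr_def using x by (intro defect_diff_affine cAs) auto
    also have "\<bar>\<dots>\<bar> \<le> (2 * \<epsilon> * t) * (s - r) + (2 * \<epsilon> * t) * (q - p) + \<epsilon> * ((q - p) * (s - r))"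
    proof (rule defect_bound[OF cs])
      show "\<bar>Ar (pt q y) - Ar (pt p y)\<bar> \<le> 2 * \<epsilon> * t" if "r \<le> y" "y \<le> s" for y
        using bA[of "pt q y"] bA[of "pt p y"] that x by (auto simp: cbox_2)
      show "\<bar>Br (pt y s) - Br (pt y r)\<bar> \<le> 2 * \<epsilon> * t" if "p \<le> y" "y \<le> q" for y
        using bB[of "pt y s"] bB[of "pt y r"] that x by (auto simp: cbox_2)
    qed (use bD x \<epsilon> t in auto)
    also have "\<dots> \<le> 3 * \<epsilon> * t\<^sup>2"
    proof -
      have "(q - p) * (s - r) \<le> t * t" using x by (intro mult_mono) (auto simp: t_def)
      then have "\<epsilon> * ((q - p) * (s - r)) \<le> \<epsilon> * (t * t)" using \<epsilon> by (intro mult_left_mono) auto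
      then show ?thesis by (simp add: t_def power2_eq_square algebra_simps)
    qed
    finally have "\<bar>defect A B D p q r s\<bar> \<le> 3 * \<epsilon> * t\<^sup>2" .
    then have "4 ^ n * \<bar>defect A B D p q r s\<bar> \<le> 4 ^ n * (3 * \<epsilon> * t\<^sup>2)"
      by (intro mult_left_mono) auto
    \<comment> \<open>The area scale \<open>t\<^sup>2\<close> shrinks exactly like
      \<open>4 ^ (- n)\<close>, which cancels the factor gained in the bisection.\<close>
    also have "\<dots> = 3 * \<epsilon> * ?h\<^sup>2"
    proof -
      have "(4::real) ^ n * ((1/2) ^ n)\<^sup>2 = (4 * (1/4)) ^ n"
        by (simp only: power_mult_distrib) (simp add: power2_eq_square flip: power_mult_distrib)
      then show ?thesis by (simp add: t power_mult_distrib)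
    qed
    also have "\<dots> \<le> e"
    proof -
      have "?h\<^sup>2 / (?h\<^sup>2 + 1) \<le> 1" using h2 by (intro divide_le_eq_1_pos[THEN iffD2]) auto
      then have "e * (?h\<^sup>2 / (?h\<^sup>2 + 1)) \<le> e * 1" using that by (intro mult_left_mono) auto
      moreover have "3 * \<epsilon> * ?h\<^sup>2 = e * (?h\<^sup>2 / (?h\<^sup>2 + 1)) / 2"
      proof -
        have "3 * (e / (6 * (H + 1))) * H = e * (H / (H + 1)) / 2" if "H + 1 > 0" for H
          using that by (simp add: field_simps)
        from this[OF h2] show ?thesis unfolding \<epsilon>_def .
      qed
      moreover have "X / 2 \<le> e" if "X \<le> e * 1" for X using that \<open>e > 0\<close> by linarith
      ultimately show ?thesis by metis
    qed
    finally show ?thesis by (rule order_trans[OF x(10)])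
  qed
  then have "\<bar>defect A B D a b c d\<bar> \<le> 0" by (rule field_le_epsilon) simp
  then show ?thesis by simp
qed

section \<open>Sets of finite one-dimensional upper Minkowski content, and the divergence theorem
  across them\<close>

definition thin :: "(real^2) set \<Rightarrow> bool" where
  "thin \<Gamma> \<longleftrightarrow> (\<exists>C\<ge>0. \<forall>\<tau>. 0 < \<tau> \<and> \<tau> \<le> 1 \<longrightarrow>
     (\<exists>P. finite P \<and> real (card P) \<le> C / \<tau> \<and> \<Gamma> \<subseteq> (\<Union>p\<in>P. cball p \<tau>)))"

lemma thin_Un:
  assumes "thin A" "thin B"
  shows "thin (A \<union> B)"
proof -
  obtain C where C: "C \<ge> 0" "\<And>\<tau>. 0 < \<tau> \<Longrightarrow> \<tau> \<le> 1 \<Longrightarrow>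
     (\<exists>P. finite P \<and> real (card P) \<le> C / \<tau> \<and> A \<subseteq> (\<Union>p\<in>P. cball p \<tau>))"
    using assms(1) unfolding thin_def by auto
  obtain D where D: "D \<ge> 0" "\<And>\<tau>. 0 < \<tau> \<Longrightarrow> \<tau> \<le> 1 \<Longrightarrow>
     (\<exists>P. finite P \<and> real (card P) \<le> D / \<tau> \<and> B \<subseteq> (\<Union>p\<in>P. cball p \<tau>))"
    using assms(2) unfolding thin_def by auto
  have "\<exists>P. finite P \<and> real (card P) \<le> (C + D) / \<tau> \<and> A \<union> B \<subseteq> (\<Union>p\<in>P. cball p \<tau>)"
    if \<tau>: "0 < \<tau>" "\<tau> \<le> 1" for \<tau>
  proof -
    obtain P where P: "finite P" "real (card P) \<le> C / \<tau>" "A \<subseteq> (\<Union>p\<in>P. cball p \<tau>)"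
      using C(2)[OF \<tau>] by auto
    obtain R where R: "finite R" "real (card R) \<le> D / \<tau>" "B \<subseteq> (\<Union>p\<in>R. cball p \<tau>)"
      using D(2)[OF \<tau>] by auto
    have "real (card (P \<union> R)) \<le> real (card P) + real (card R)"
      using card_Un_le[of P R] by linarith
    also have "\<dots> \<le> (C + D) / \<tau>"
      using P(2) R(2) by (simp add: add_divide_distrib)
    finally have "real (card (P \<union> R)) \<le> (C + D) / \<tau>" .
    moreover have "A \<union> B \<subseteq> (\<Union>p\<in>P \<union> R. cball p \<tau>)"
      using P(3) R(3) by blast
    ultimately show ?thesis
      using P(1) R(1) by (intro exI[of _ "P \<union> R"]) auto
  qed
  with C(1) D(1) show ?thesis
    unfolding thin_def by (intro exI[of _ "C + D"]) auto
qed

text \<open>Sample the curve at parameter steps \<open>\<tau> / L\<close>. Every parameter lies less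
  than one step after a sample, and over one step the curve moves by at most \<tau>.\<close>

lemma thin_lipschitz_curve:
  fixes \<gamma> :: "real \<Rightarrow> real^2"
  assumes L: "\<And>s t. s \<in> {0..T} \<Longrightarrow> t \<in> {0..T} \<Longrightarrow> dist (\<gamma> s) (\<gamma> t) \<le> L * \<bar>s - t\<bar>"
    and "L > 0" "T > 0"
  shows "thin (\<gamma> ` {0..T})"
proof -
  have "\<exists>P. finite P \<and> real (card P) \<le> (L * T + 2) / \<tau> \<and> \<gamma> ` {0..T} \<subseteq> (\<Union>p\<in>P. cball p \<tau>)"
    if \<tau>: "0 < \<tau>" "\<tau> \<le> 1" for \<tau>
  proof -
    define h where "h = \<tau> / L"
    have h: "h > 0" using \<tau> \<open>L > 0\<close> by (simp add: h_def)
    define n where "n = nat \<lfloor>T / h\<rfloor>"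
    define P where "P = (\<lambda>k. \<gamma> (real k * h)) ` {..n}"
    have n: "real n \<le> T / h" "T / h < real n + 1"
      using h \<open>T > 0\<close> by (simp_all add: n_def)
    have "card P \<le> Suc n"
      unfolding P_def using card_image_le[of "{..n}" "\<lambda>k. \<gamma> (real k * h)"] by simp
    then have "real (card P) \<le> real n + 1" by linarith
    also have "\<dots> \<le> L * T / \<tau> + 2 / \<tau>"
    proof -
      \<comment> \<open>This is where \<open>\<tau> \<le> 1\<close> absorbs the additive constant of
        the count into a multiple of 1/\<tau>.\<close>
      have "1 \<le> 2 / \<tau>" using \<tau> by (simp add: field_simps)
      moreover have "T / h = L * T / \<tau>" using \<tau> \<open>L > 0\<close> by (simp add: h_def field_simps)
      ultimately show ?thesis using n(1) by linarith
    qed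
    finally have card: "real (card P) \<le> (L * T + 2) / \<tau>" by (simp add: add_divide_distrib)
    have "\<gamma> t \<in> (\<Union>p\<in>P. cball p \<tau>)" if t: "t \<in> {0..T}" for t
    proof -
      define k where "k = nat \<lfloor>t / h\<rfloor>"
      have k: "real k \<le> t / h" "t / h < real k + 1"
        using h t by (simp_all add: k_def)
      have "t / h \<le> T / h" using t h by (simp add: divide_right_mono)
      then have "\<lfloor>t / h\<rfloor> \<le> \<lfloor>T / h\<rfloor>" by (rule floor_mono)
      then have "k \<le> n" unfolding k_def n_def by (rule nat_mono)
      have kh: "real k * h \<le> t" "t < real k * h + h" using k h by (simp_all add: field_simps)
      moreover have "0 \<le> real k * h" using h by simp
      ultimately have in_T: "real k * h \<in> {0..T}" using t by auto
      have "dist (\<gamma> (real k * h)) (\<gamma> t) \<le> L * \<bar>real k * h - t\<bar>" using L in_T t by blast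
      also have "\<dots> \<le> L * h" using kh \<open>L > 0\<close> by (intro mult_left_mono) auto
      also have "\<dots> = \<tau>" using \<open>L > 0\<close> by (simp add: h_def)
      finally have "\<gamma> t \<in> cball (\<gamma> (real k * h)) \<tau>" by simp
      then show ?thesis unfolding P_def using \<open>k \<le> n\<close> by blast
    qed
    with card show ?thesis
      by (intro exI[of _ P]) (auto simp: P_def)
  qed
  moreover have "L * T + 2 \<ge> 0" using \<open>L > 0\<close> \<open>T > 0\<close> by (simp add: add_nonneg_nonneg)
  ultimately show ?thesis unfolding thin_def by blast
qed

text \<open>An interval of length 4\<tau> contains at most five points of a progression with step
  \<tau>. In two coordinates this gives at most 25 grid squares near each covering ball.\<close>

lemma card_near_le_5:
  fixes a \<tau> q :: real
  assumes "\<tau> > 0"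
  shows "finite {i::nat. \<bar>a + real i * \<tau> - q\<bar> \<le> 2 * \<tau>}" "card {i::nat. \<bar>a + real i * \<tau> - q\<bar> \<le> 2 * \<tau>} \<le> 5"
proof -
  let ?S = "{i::nat. \<bar>a + real i * \<tau> - q\<bar> \<le> 2 * \<tau>}"
  have "finite ?S \<and> card ?S \<le> 5"
  proof (cases "?S = {}")
    case False
    define m where "m = (LEAST i. i \<in> ?S)"
    have m: "m \<in> ?S" using False LeastI[of "\<lambda>i. i \<in> ?S"] unfolding m_def by blast
    have "?S \<subseteq> {m..m+4}"
    proof
      fix i assume i: "i \<in> ?S"
      then have "m \<le> i" unfolding m_def by (rule Least_le)
      have "(real i - real m) * \<tau> \<le> 4 * \<tau>"
        using i m unfolding mem_Collect_eq abs_le_iff left_diff_distrib by linarith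
      with assms have "real i - real m \<le> 4" by simp
      with \<open>m \<le> i\<close> show "i \<in> {m..m+4}" by simp
    qed
    then show ?thesis
      using finite_subset[of ?S "{m..m+4}"] card_mono[of "{m..m+4}" ?S] by simp
  qed simp
  then show "finite ?S" "card ?S \<le> 5" by auto
qed

lemma defect_strips_1:
  assumes "continuous_on (cbox (pt a c) (pt (a + real n * \<tau>) d)) A"
    "continuous_on (cbox (pt a c) (pt (a + real n * \<tau>) d)) B"
    "continuous_on (cbox (pt a c) (pt (a + real n * \<tau>) d)) D" "\<tau> \<ge> 0" "c \<le> d"
  shows "defect A B D a (a + real n * \<tau>) c d =
    (\<Sum>i<n. defect A B D (a + real i * \<tau>) (a + real (Suc i) * \<tau>) c d)"
  using assms
proof (induction n)
  case 0
  then show ?case using defect_split_1[of a c a d A B D a] by simp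
next
  case (Suc n)
  have sub: "cbox (pt a c) (pt (a + real n * \<tau>) d) \<subseteq> cbox (pt a c) (pt (a + real (Suc n) * \<tau>) d)"
    using Suc.prems by (auto simp: cbox_2 algebra_simps)
  have "defect A B D a (a + real (Suc n) * \<tau>) c d =
     defect A B D a (a + real n * \<tau>) c d + defect A B D (a + real n * \<tau>) (a + real (Suc n) * \<tau>) c d"
    using Suc.prems by (intro defect_split_1) (auto simp: mult_right_mono)
  with Suc.IH[OF Suc.prems(1-3)[THEN continuous_on_subset[OF _ sub]] Suc.prems(4,5)]
  show ?case by simp
qed

lemma defect_strips_2:
  assumes "continuous_on (cbox (pt a c) (pt b (c + real n * \<tau>))) A"
    "continuous_on (cbox (pt a c) (pt b (c + real n * \<tau>))) B"
    "continuous_on (cbox (pt a c) (pt b (c + real n * \<tau>))) D" "\<tau> \<ge> 0" "a \<le> b"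
  shows "defect A B D a b c (c + real n * \<tau>) =
    (\<Sum>i<n. defect A B D a b (c + real i * \<tau>) (c + real (Suc i) * \<tau>))"
  using assms
proof (induction n)
  case 0
  then show ?case using defect_split_2[of a c b c A B D c] by simp
next
  case (Suc n)
  have sub: "cbox (pt a c) (pt b (c + real n * \<tau>)) \<subseteq> cbox (pt a c) (pt b (c + real (Suc n) * \<tau>))"
    using Suc.prems by (auto simp: cbox_2 algebra_simps)
  have "defect A B D a b c (c + real (Suc n) * \<tau>) =
     defect A B D a b c (c + real n * \<tau>) + defect A B D a b (c + real n * \<tau>) (c + real (Suc n) * \<tau>)"
    using Suc.prems by (intro defect_split_2) (auto simp: mult_right_mono)
  with Suc.IH[OF Suc.prems(1-3)[THEN continuous_on_subset[OF _ sub]] Suc.prems(4,5)]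
  show ?case by simp
qed

text \<open>Cut the square into \<open>n\<^sup>2\<close> squares of side \<open>\<tau>\<close>: only \<open>O(1 / \<tau>)\<close> of them meet the curve,
  and by uniform continuity each of these has defect \<open>o(\<tau>)\<close>.\<close>

theorem divergence_square_off_thin:
  assumes A: "continuous_on (cbox (pt a c) (pt (a + L) (c + L))) A"
    and B: "continuous_on (cbox (pt a c) (pt (a + L) (c + L))) B"
    and D: "continuous_on (cbox (pt a c) (pt (a + L) (c + L))) D"
    and "L > 0" and \<Gamma>: "thin \<Gamma>"
    and good: "\<And>p q r s. p \<le> q \<Longrightarrow> r \<le> s \<Longrightarrow>
      cbox (pt p r) (pt q s) \<subseteq> cbox (pt a c) (pt (a + L) (c + L)) \<Longrightarrow>
      cbox (pt p r) (pt q s) \<inter> \<Gamma> = {} \<Longrightarrow> defect A B D p q r s = 0"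
  shows "defect A B D a (a + L) c (c + L) = 0"
proof -
  let ?Q = "cbox (pt a c) (pt (a + L) (c + L))"
  obtain C where C: "C \<ge> 0" "\<And>\<tau>. 0 < \<tau> \<Longrightarrow> \<tau> \<le> 1 \<Longrightarrow>
     (\<exists>P. finite P \<and> real (card P) \<le> C / \<tau> \<and> \<Gamma> \<subseteq> (\<Union>p\<in>P. cball p \<tau>))"
    using \<Gamma> unfolding thin_def by auto
  have "bounded (D ` ?Q)"
    by (intro compact_imp_bounded compact_continuous_image D compact_cbox)
  then obtain N where N: "N > 0" "\<And>z. z \<in> ?Q \<Longrightarrow> \<bar>D z\<bar> \<le> N"
    unfolding bounded_pos by auto
  have "\<bar>defect A B D a (a + L) c (c + L)\<bar> \<le> e" if "e > 0" for e
  proof -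
    \<comment> \<open>The 75 is 25 squares per ball times the defect bound
      \<open>3 * \<eta> * \<tau>\<close> per square; the summand 1 covers
      \<open>C = 0\<close>.\<close>
    define \<eta> where "\<eta> = e / (75 * C + 1)"
    have \<eta>: "\<eta> > 0" "75 * C * \<eta> \<le> e"
    proof -
      have "75 * C + 1 > 0" using C(1) by linarith
      then show "\<eta> > 0" using that by (simp add: \<eta>_def)
      then have "75 * C * \<eta> \<le> (75 * C + 1) * \<eta>" by (intro mult_right_mono) auto
      also have "\<dots> = e" using \<open>75 * C + 1 > 0\<close> by (simp add: \<eta>_def)
      finally show "75 * C * \<eta> \<le> e" .
    qed
    obtain d1 where d1: "d1 > 0" "\<And>y z. y \<in> ?Q \<Longrightarrow> z \<in> ?Q \<Longrightarrow> dist z y < d1 \<Longrightarrow> dist (A z) (A y) < \<eta>"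
      using compact_uniformly_continuous[OF A compact_cbox] \<eta>(1) unfolding uniformly_continuous_on_def by metis
    obtain d2 where d2: "d2 > 0" "\<And>y z. y \<in> ?Q \<Longrightarrow> z \<in> ?Q \<Longrightarrow> dist z y < d2 \<Longrightarrow> dist (B z) (B y) < \<eta>"
      using compact_uniformly_continuous[OF B compact_cbox] \<eta>(1) unfolding uniformly_continuous_on_def by metis
    \<comment> \<open>The mesh must be below the two moduli of continuity, at most 1 for the
      covering, and at most \<open>\<eta> / N\<close> so that the integral of \<open>D\<close> over
      a square is at most \<open>\<eta> * \<tau>\<close>, as \<open>\<tau> \<le> 1\<close>.\<close>
    define m where "m = min (min d1 d2) (min 1 (\<eta> / N))"
    have "m > 0" using d1(1) d2(1) \<eta>(1) N(1) by (simp add: m_def)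
    obtain n :: nat where n: "L / m < real n" using reals_Archimedean2 by blast
    then have "real n > 0" using \<open>L > 0\<close> \<open>m > 0\<close> by (smt (verit) divide_pos_pos)
    define \<tau> where "\<tau> = L / real n"
    have \<tau>: "\<tau> > 0" "\<tau> < m" "real n * \<tau> = L"
      using \<open>L > 0\<close> \<open>real n > 0\<close> n \<open>m > 0\<close> by (auto simp: \<tau>_def field_simps)
    have \<tau>': "\<tau> < d1" "\<tau> < d2" "\<tau> \<le> 1" "N * \<tau> \<le> \<eta>"
      using \<tau>(2) N(1) by (auto simp: m_def field_simps)
    obtain P where P: "finite P" "real (card P) \<le> C / \<tau>" "\<Gamma> \<subseteq> (\<Union>p\<in>P. cball p \<tau>)"
      using C(2) \<tau>(1) \<tau>'(3) by blast
    define x where "x = (\<lambda>i::nat. a + real i * \<tau>)"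
    define y where "y = (\<lambda>i::nat. c + real i * \<tau>)"
    define S where "S = (\<lambda>(i, j). cbox (pt (x i) (y j)) (pt (x (Suc i)) (y (Suc j))))"
    define E where "E = (\<lambda>(i, j). defect A B D (x i) (x (Suc i)) (y j) (y (Suc j)))"
    have step: "x (Suc i) = x i + \<tau>" "y (Suc i) = y i + \<tau>" for i
      by (auto simp: x_def y_def algebra_simps)
    have rng: "a \<le> x i" "x (Suc i) \<le> a + L" "c \<le> y i" "y (Suc i) \<le> c + L" if "i < n" for i
    proof -
      have "real (Suc i) * \<tau> \<le> real n * \<tau>" using that \<tau> by (intro mult_right_mono) auto
      then show "a \<le> x i" "x (Suc i) \<le> a + L" "c \<le> y i" "y (Suc i) \<le> c + L"
        using \<tau> by (auto simp: x_def y_def)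
    qed
    have sub: "S (i, j) \<subseteq> ?Q" if "i < n" "j < n" for i j
      using rng[OF that(1)] rng[OF that(2)] by (auto simp: S_def cbox_2)
    have "defect A B D a (a + L) c (c + L) = (\<Sum>i<n. defect A B D (x i) (x (Suc i)) c (c + L))"
      using defect_strips_1[of a c n \<tau> "c + L" A B D] A B D \<tau> \<open>L > 0\<close> by (simp add: x_def)
    also have "\<dots> = (\<Sum>i<n. \<Sum>j<n. E (i, j))"
    proof (intro sum.cong refl)
      fix i assume i: "i \<in> {..<n}"
      have sub: "cbox (pt (x i) c) (pt (x (Suc i)) (c + real n * \<tau>)) \<subseteq> ?Q"
        using rng[of i] i \<tau> by (auto simp: cbox_2)
      show "defect A B D (x i) (x (Suc i)) c (c + L) = (\<Sum>j<n. E (i, j))"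
        using defect_strips_2[OF A[THEN continuous_on_subset[OF _ sub]] B[THEN continuous_on_subset[OF _ sub]]
          D[THEN continuous_on_subset[OF _ sub]]] \<tau> step
        by (simp add: E_def y_def)
    qed
    also have "\<dots> = (\<Sum>k\<in>{..<n} \<times> {..<n}. E k)"
      by (simp add: sum.cartesian_product)
    finally have total: "defect A B D a (a + L) c (c + L) = (\<Sum>k\<in>{..<n} \<times> {..<n}. E k)" .
    have E_le: "\<bar>E (i, j)\<bar> \<le> 3 * \<eta> * \<tau>" if ij: "i < n" "j < n" for i j
    proof -
      let ?q = "cbox (pt (x i) (y j)) (pt (x (Suc i)) (y (Suc j)))"
      have s: "?q \<subseteq> ?Q" using sub[OF ij] by (simp add: S_def)
      have c: "continuous_on ?q A" "continuous_on ?q B" "continuous_on ?q D"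
        using A B D s continuous_on_subset by blast+
      have "\<bar>E (i, j)\<bar> \<le> \<eta> * (y (Suc j) - y j) + \<eta> * (x (Suc i) - x i) + N * ((x (Suc i) - x i) * (y (Suc j) - y j))"
        unfolding E_def prod.case
      proof (rule defect_bound[OF c])
        fix t assume t: "y j \<le> t" "t \<le> y (Suc j)"
        have q: "pt (x (Suc i)) t \<in> ?q" "pt (x i) t \<in> ?q" using t step \<tau> by (auto simp: cbox_2)
        have "dist (pt (x (Suc i)) t) (pt (x i) t) < d1"
          using norm_le_2[of "pt (x (Suc i)) t - pt (x i) t"] step \<tau> \<tau>' by (simp add: dist_norm)
        from d1(2)[OF subsetD[OF s q(2)] subsetD[OF s q(1)] this]
        show "\<bar>A (pt (x (Suc i)) t) - A (pt (x i) t)\<bar> \<le> \<eta>"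
          by (simp add: dist_real_def)
      next
        fix t assume t: "x i \<le> t" "t \<le> x (Suc i)"
        have q: "pt t (y (Suc j)) \<in> ?q" "pt t (y j) \<in> ?q" using t step \<tau> by (auto simp: cbox_2)
        have "dist (pt t (y (Suc j))) (pt t (y j)) < d2"
          using norm_le_2[of "pt t (y (Suc j)) - pt t (y j)"] step \<tau> \<tau>' by (simp add: dist_norm)
        from d2(2)[OF subsetD[OF s q(2)] subsetD[OF s q(1)] this]
        show "\<bar>B (pt t (y (Suc j))) - B (pt t (y j))\<bar> \<le> \<eta>"
          by (simp add: dist_real_def)
      qed (use step \<tau> \<eta> N s in auto)
      also have "\<dots> = 2 * \<eta> * \<tau> + (N * \<tau>) * \<tau>" by (simp add: step)
      also have "\<dots> \<le> 3 * \<eta> * \<tau>" using mult_right_mono[OF \<tau>'(4), of \<tau>] \<tau>(1) by simp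
      finally show ?thesis .
    qed
    define Z where "Z = {k \<in> {..<n} \<times> {..<n}. S k \<inter> \<Gamma> \<noteq> {}}"
    have E0: "E (i, j) = 0" if "i < n" "j < n" "S (i, j) \<inter> \<Gamma> = {}" for i j
      unfolding E_def prod.case using that sub[OF that(1,2)] step \<tau>(1)
      by (intro good) (auto simp: S_def)
    \<comment> \<open>A common point of the square and the curve is within \<tau> of some centre
      \<open>p\<close>, and the lower left corner of the square is at most another \<tau> away in
      each coordinate.\<close>
    have "Z \<subseteq> (\<Union>p\<in>P. {i. \<bar>a + real i * \<tau> - p $ 1\<bar> \<le> 2 * \<tau>} \<times> {j. \<bar>c + real j * \<tau> - p $ 2\<bar> \<le> 2 * \<tau>})"
    proof
      fix k assume "k \<in> Z"
      then obtain i j z where k: "k = (i, j)" "z \<in> S (i, j)" "z \<in> \<Gamma>"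
        unfolding Z_def by auto
      then obtain p where p: "p \<in> P" "dist p z \<le> \<tau>" using P(3) by auto
      have "\<bar>p $ 1 - z $ 1\<bar> \<le> \<tau>" "\<bar>p $ 2 - z $ 2\<bar> \<le> \<tau>"
        using component_le_norm_cart[of "p - z"] p(2) by (auto simp: dist_norm intro: order_trans)
      with k p show "k \<in> (\<Union>p\<in>P. {i. \<bar>a + real i * \<tau> - p $ 1\<bar> \<le> 2 * \<tau>} \<times> {j. \<bar>c + real j * \<tau> - p $ 2\<bar> \<le> 2 * \<tau>})"
        by (intro UN_I[of p]) (auto simp: S_def cbox_2 x_def y_def algebra_simps abs_le_iff)
    qed
    then have "card Z \<le> card (\<Union>p\<in>P. {i. \<bar>a + real i * \<tau> - p $ 1\<bar> \<le> 2 * \<tau>} \<times> {j. \<bar>c + real j * \<tau> - p $ 2\<bar> \<le> 2 * \<tau>})"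
      using P(1) card_near_le_5(1)[OF \<tau>(1)] by (intro card_mono) auto
    also have "\<dots> \<le> (\<Sum>p\<in>P. card ({i. \<bar>a + real i * \<tau> - p $ 1\<bar> \<le> 2 * \<tau>} \<times> {j. \<bar>c + real j * \<tau> - p $ 2\<bar> \<le> 2 * \<tau>}))"
      using P(1) by (rule card_UN_le)
    also have "\<dots> \<le> (\<Sum>p\<in>P. 25)"
    proof (rule sum_mono)
      fix p assume "p \<in> P"
      have "card {i. \<bar>a + real i * \<tau> - p $ 1\<bar> \<le> 2 * \<tau>} * card {j. \<bar>c + real j * \<tau> - p $ 2\<bar> \<le> 2 * \<tau>} \<le> 5 * 5"
        using \<tau>(1) by (intro mult_le_mono card_near_le_5)
      then show "card ({i. \<bar>a + real i * \<tau> - p $ 1\<bar> \<le> 2 * \<tau>} \<times> {j. \<bar>c + real j * \<tau> - p $ 2\<bar> \<le> 2 * \<tau>}) \<le> 25"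
        by (simp add: card_cartesian_product)
    qed
    finally have "card Z \<le> 25 * card P" by (simp add: mult.commute)
    then have cZ: "real (card Z) \<le> 25 * (C / \<tau>)" using P(2) by linarith
    have "defect A B D a (a + L) c (c + L) = (\<Sum>k\<in>Z. E k)"
      unfolding total using E0 by (intro sum.mono_neutral_right) (auto simp: Z_def)
    also have "\<bar>\<dots>\<bar> \<le> (\<Sum>k\<in>Z. \<bar>E k\<bar>)" by (rule sum_abs)
    also have "\<dots> \<le> (\<Sum>k\<in>Z. 3 * \<eta> * \<tau>)"
      by (rule sum_mono) (auto simp: Z_def E_le)
    also have "\<dots> = real (card Z) * (3 * \<eta> * \<tau>)" by simp
    also have "\<dots> \<le> 25 * (C / \<tau>) * (3 * \<eta> * \<tau>)"
      using \<eta>(1) \<tau>(1) by (intro mult_right_mono cZ) auto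
    also have "\<dots> = 75 * C * \<eta>" using \<tau>(1) by simp
    also have "\<dots> \<le> e" by (rule \<eta>(2))
    finally show ?thesis .
  qed
  then have "\<bar>defect A B D a (a + L) c (c + L)\<bar> \<le> 0" by (rule field_le_epsilon) simp
  then show ?thesis by simp
qed

section \<open>Test functions and weakly divergence free fields\<close>

lemma smooth_fun_differentiable: "smooth_fun f \<Longrightarrow> f differentiable (at x)"
  by (erule smooth_fun.cases) auto

lemma smooth_fun_pd: "smooth_fun f \<Longrightarrow> smooth_fun (pd i f)"
  unfolding pd_def by (erule smooth_fun.cases) auto

lemma grad_unique:
  assumes "(f has_derivative (\<lambda>h. g \<bullet> h)) (at x)"
  shows "grad f x = g"
  by (simp add: grad_def pd_def vec_eq_iff inner_axis flip: frechet_derivative_at[OF assms])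

lemma smooth_fun_has_derivative:
  assumes "smooth_fun f"
  shows "(f has_derivative (\<lambda>h. grad f x \<bullet> h)) (at x)"
proof -
  let ?L = "frechet_derivative f (at x)"
  have L: "(f has_derivative ?L) (at x)"
    using smooth_fun_differentiable[OF assms] frechet_derivative_works by blast
  have "?L = (\<lambda>h. grad f x \<bullet> h)"
  proof
    show "?L h = grad f x \<bullet> h" for h
      unfolding linear_2[OF has_derivative_linear[OF L], of h]
      by (simp add: grad_def pd_def inner_2 mult.commute)
  qed
  with L show ?thesis by simp
qed

lemma smooth_fun_continuous: "smooth_fun f \<Longrightarrow> continuous_on S f"
  by (meson continuous_at_imp_continuous_on differentiable_imp_continuous_within smooth_fun_differentiable)

lemma smooth_fun_grad_continuous: "smooth_fun f \<Longrightarrow> continuous_on S (grad f)"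
  unfolding grad_def by (intro continuous_on_vec_lambda smooth_fun_continuous smooth_fun_pd)

lemma test_fun_support:
  assumes "test_fun \<phi>"
  obtains M where "M > 0" "\<And>x. M \<le> norm x \<Longrightarrow> \<phi> x = 0" "\<And>x. M \<le> norm x \<Longrightarrow> grad \<phi> x = 0"
proof -
  let ?K = "closure {x. \<phi> x \<noteq> 0}"
  have "bounded ?K" using assms compact_imp_bounded by (auto simp: test_fun_def)
  then obtain M where M: "M > 0" "\<And>x. x \<in> ?K \<Longrightarrow> norm x \<le> M" by (auto simp: bounded_pos)
  \<comment> \<open>The margin puts \<open>x\<close> into the open complement of the support, where
    \<phi> vanishes on a whole neighbourhood and its gradient vanishes too.\<close>
  have out: "x \<in> - ?K" if "M + 1 \<le> norm x" for x using M(2)[of x] that by auto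
  have zero: "\<phi> x = 0" if "x \<in> - ?K" for x using that closure_subset[of "{x. \<phi> x \<noteq> 0}"] by blast
  have gr: "grad \<phi> x = 0" if x: "x \<in> - ?K" for x
  proof (rule grad_unique)
    have o: "open (- ?K)" by (simp add: open_Compl)
    have "((\<lambda>_. 0) has_derivative (\<lambda>h. 0)) (at x)" by simp
    then have "(\<phi> has_derivative (\<lambda>h. 0)) (at x)"
      by (rule has_derivative_transform_within_open[OF _ o x]) (rule zero[symmetric])
    then show "(\<phi> has_derivative (\<lambda>h. 0 \<bullet> h)) (at x)" by simp
  qed
  show thesis
  proof (rule that[of "M + 1"])
    show "M + 1 > 0" using M(1) by simp
  qed (intro zero gr out; assumption)+
qed

lemma integrable_lborel_compact_support:
  fixes f :: "real^2 \<Rightarrow> real"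
  assumes f: "continuous_on UNIV f" and "\<And>x. x \<notin> cbox a b \<Longrightarrow> f x = 0"
  shows "integrable lborel f" "(\<integral>x. f x \<partial>lborel) = integral (cbox a b) f"
proof -
  have c: "continuous_on (cbox a b) f" using f continuous_on_subset by blast
  have eq: "(\<lambda>x. indicator (cbox a b) x *\<^sub>R f x) = f"
    using assms(2) by (auto simp: indicator_def fun_eq_iff)
  have i: "set_integrable lborel (cbox a b) f"
    unfolding set_integrable_def by (rule borel_integrable_compact[OF compact_cbox c])
  then show "integrable lborel f" unfolding set_integrable_def eq .
  have "(LINT x : cbox a b | lborel. f x) = integral (cbox a b) f"
    by (rule set_borel_integral_eq_integral(2)[OF i])
  then show "(\<integral>x. f x \<partial>lborel) = integral (cbox a b) f"
    unfolding set_lebesgue_integral_def eq .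
qed

text \<open>The divergence theorem is applied to \<open>\<phi> * F\<close> on a square outside of
  which \<phi> vanishes. Since \<open>F\<close> is divergence free off \<Gamma>, the divergence of
  the product there is \<open>F \<bullet> grad \<phi>\<close>, which is continuous everywhere, and
  the boundary fluxes are 0.\<close>

lemma weakly_divergence_free:
  fixes F :: "real^2 \<Rightarrow> real^2"
  assumes F: "continuous_on UNIV F" and \<Gamma>: "thin \<Gamma>" and \<phi>: "test_fun \<phi>"
    and F': "\<And>x. x \<notin> \<Gamma> \<Longrightarrow> (F has_derivative F' x) (at x)"
    and div: "\<And>x. x \<notin> \<Gamma> \<Longrightarrow> F' x (axis 1 1) $ 1 + F' x (axis 2 1) $ 2 = 0"
  shows "integrable lborel (\<lambda>x. F x \<bullet> grad \<phi> x)" "(\<integral>x. F x \<bullet> grad \<phi> x \<partial>lborel) = 0"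
proof -
  have sm: "smooth_fun \<phi>" using \<phi> by (simp add: test_fun_def)
  obtain M where M: "M > 0" "\<And>x. M \<le> norm x \<Longrightarrow> \<phi> x = 0" "\<And>x. M \<le> norm x \<Longrightarrow> grad \<phi> x = 0"
    using test_fun_support[OF \<phi>] by metis
  have big: "M \<le> norm x" if "M \<le> \<bar>x $ i\<bar>" for x :: "real^2" and i
    using component_le_norm_cart[of x i] that by linarith
  define A where "A = (\<lambda>x. \<phi> x * F x $ 1)"
  define B where "B = (\<lambda>x. \<phi> x * F x $ 2)"
  define D where "D = (\<lambda>x. F x \<bullet> grad \<phi> x)"
  have c: "continuous_on S A" "continuous_on S B" "continuous_on S D" for S
    unfolding A_def B_def D_def
    using continuous_on_subset[OF F, of S] smooth_fun_continuous[OF sm, of S] smooth_fun_grad_continuous[OF sm, of S]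
    by (auto intro!: continuous_intros)
  have "defect A B D (- M) (- M + 2 * M) (- M) (- M + 2 * M) = 0"
  proof (rule divergence_square_off_thin[OF c _ \<Gamma>])
    show "2 * M > 0" using M by simp
    fix p q r s :: real
    assume *: "p \<le> q" "r \<le> s" "cbox (pt p r) (pt q s) \<inter> \<Gamma> = {}"
    show "defect A B D p q r s = 0"
    proof (rule divergence_rectangle[OF _ _ c(3) _ *(1,2)])
      fix z assume "z \<in> cbox (pt p r) (pt q s)"
      then have z: "z \<notin> \<Gamma>" using * by blast
      have \<phi>': "(\<phi> has_derivative (\<lambda>h. grad \<phi> z \<bullet> h)) (at z within S)" for S
        using smooth_fun_has_derivative[OF sm] has_derivative_at_withinI by blast
      have Fi: "((\<lambda>x. F x $ i) has_derivative (\<lambda>h. F' z h $ i)) (at z within S)" for S i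
        by (rule bounded_linear.has_derivative[OF bounded_linear_vec_nth has_derivative_at_withinI[OF F'[OF z]]])
      show "(A has_derivative (\<lambda>h. \<phi> z * F' z h $ 1 + (grad \<phi> z \<bullet> h) * F z $ 1)) (at z within cbox (pt p r) (pt q s))"
        unfolding A_def by (rule has_derivative_mult[OF \<phi>' Fi])
      show "(B has_derivative (\<lambda>h. \<phi> z * F' z h $ 2 + (grad \<phi> z \<bullet> h) * F z $ 2)) (at z within cbox (pt p r) (pt q s))"
        unfolding B_def by (rule has_derivative_mult[OF \<phi>' Fi])
      have "\<phi> z * (F' z (axis 1 1) $ 1 + F' z (axis 2 1) $ 2) = 0" using div[OF z] by simp
      then show "\<phi> z * F' z (axis 1 1) $ 1 + grad \<phi> z \<bullet> axis 1 1 * F z $ 1 +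
          (\<phi> z * F' z (axis 2 1) $ 2 + grad \<phi> z \<bullet> axis 2 1 * F z $ 2) = D z"
        by (simp add: D_def inner_2 axis_def algebra_simps)
    qed
  qed
  moreover have "A (pt M y) = 0" "A (pt (- M) y) = 0" "B (pt y M) = 0" "B (pt y (- M)) = 0" for y
    unfolding A_def B_def using M(1) big[of "pt _ _" 1] big[of "pt _ _" 2] M(2) by auto
  ultimately have "integral (cbox (pt (- M) (- M)) (pt M M)) D = 0"
    by (simp add: defect_def)
  moreover have "D x = 0" if "x \<notin> cbox (pt (- M) (- M)) (pt M M)" for x
  proof -
    have "M \<le> \<bar>x $ 1\<bar> \<or> M \<le> \<bar>x $ 2\<bar>" using that by (auto simp: cbox_2)
    then show ?thesis using big M(3) by (auto simp: D_def)
  qed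
  ultimately show "integrable lborel (\<lambda>x. F x \<bullet> grad \<phi> x)" "(\<integral>x. F x \<bullet> grad \<phi> x \<partial>lborel) = 0"
    using integrable_lborel_compact_support[OF c(3), of "pt (- M) (- M)" "pt M M"] by (simp_all add: D_def)
qed

section \<open>Absolutely convergent power series in two variables\<close>

text \<open>In \<open>series R N c f\<close>, \<open>N\<close> bounds the norm of the coefficients \<open>c\<close> in the Banach algebra
  \<open>\<ell>\<^sup>1\<close> with weight \<open>R\<close>; this makes products and infinite sums of power series easy to control.\<close>

definition mon :: "real^2 \<Rightarrow> nat \<times> nat \<Rightarrow> real" where
  "mon h k = h $ 1 ^ fst k * h $ 2 ^ snd k"

definition series :: "real \<Rightarrow> real \<Rightarrow> (nat \<times> nat \<Rightarrow> real) \<Rightarrow> (real^2 \<Rightarrow> real) \<Rightarrow> bool" where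
  "series R N c f \<longleftrightarrow>
     (\<exists>M\<le>N. ((\<lambda>k. \<bar>c k\<bar> * R ^ (fst k + snd k)) has_sum M) UNIV) \<and>
     (\<forall>h. \<bar>h $ 1\<bar> \<le> R \<longrightarrow> \<bar>h $ 2\<bar> \<le> R \<longrightarrow> ((\<lambda>k. c k * mon h k) has_sum f h) UNIV)"

lemma abs_mon_le:
  assumes "\<bar>h $ 1\<bar> \<le> R" "\<bar>h $ 2\<bar> \<le> R"
  shows "\<bar>mon h k\<bar> \<le> R ^ (fst k + snd k)"
proof -
  have "0 \<le> R" using assms by linarith
  have "\<bar>h $ 1\<bar> ^ fst k * \<bar>h $ 2\<bar> ^ snd k \<le> R ^ fst k * R ^ snd k"
    using assms \<open>0 \<le> R\<close> by (intro mult_mono power_mono) auto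
  then show ?thesis by (simp add: mon_def abs_mult power_abs power_add)
qed

lemma mon_add: "mon h (fst k + fst l, snd k + snd l) = mon h k * mon h l"
  by (simp add: mon_def power_add mult_ac)

lemma has_sum_abs_le:
  fixes f g :: "'a \<Rightarrow> real"
  assumes "(g has_sum M) A" "\<And>x. x \<in> A \<Longrightarrow> \<bar>f x\<bar> \<le> g x"
  shows "f summable_on A" "(\<lambda>x. \<bar>f x\<bar>) summable_on A" "\<bar>infsum f A\<bar> \<le> M"
proof -
  have "g summable_on A" using assms(1) by (rule has_sum_imp_summable)
  then show s: "(\<lambda>x. \<bar>f x\<bar>) summable_on A"
    using assms(2) by (intro summable_on_comparison_test[of g A "\<lambda>x. \<bar>f x\<bar>"]) auto
  then show s': "f summable_on A"
    using abs_summable_summable[of f A] by simp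
  have "\<bar>infsum f A\<bar> \<le> infsum (\<lambda>x. \<bar>f x\<bar>) A"
    using norm_infsum_bound[of f A] s by simp
  also have "\<dots> \<le> infsum g A"
    using s \<open>g summable_on A\<close> assms(2) by (intro infsum_mono) auto
  also have "\<dots> = M" using assms(1) by (rule infsumI)
  finally show "\<bar>infsum f A\<bar> \<le> M" .
qed

text \<open>Terms of an absolutely summable family of monomials, indexed by an arbitrary set, are
  grouped by their exponent. The triangle inequality on each group shows that the weighted norm does
  not grow. Sums and products of power series are instances for suitable index sets.\<close>

lemma series_collect:
  fixes C :: "'x \<Rightarrow> real" and \<phi> :: "'x \<Rightarrow> nat \<times> nat"
  assumes R: "R > 0"
    and N: "((\<lambda>x. \<bar>C x\<bar> * R ^ (fst (\<phi> x) + snd (\<phi> x))) has_sum N) X"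
    and f: "\<And>h. \<bar>h $ 1\<bar> \<le> R \<Longrightarrow> \<bar>h $ 2\<bar> \<le> R \<Longrightarrow> ((\<lambda>x. C x * mon h (\<phi> x)) has_sum f h) X"
  shows "\<exists>c. series R N c f"
proof -
  \<comment> \<open>The fibres of the exponent map. Pairing each index with its exponent turns the
    sum over \<open>X\<close> into an iterated sum over a \<open>Sigma\<close> set.\<close>
  define Y where "Y = (\<lambda>k. {x \<in> X. \<phi> x = k})"
  have inj: "inj_on snd (Sigma UNIV Y)"
    by (auto simp: Y_def inj_on_def)
  have im: "snd ` Sigma UNIV Y = X"
  proof
    show "snd ` Sigma UNIV Y \<subseteq> X" by (auto simp: Y_def)
    show "X \<subseteq> snd ` Sigma UNIV Y"
    proof
      fix x assume "x \<in> X"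
      then have "(\<phi> x, x) \<in> Sigma UNIV Y" by (simp add: Y_def)
      then show "x \<in> snd ` Sigma UNIV Y" by (rule rev_image_eqI) simp
    qed
  qed
  have reindex: "((\<lambda>(k, x). g x) has_sum s) (Sigma UNIV Y)" if "(g has_sum s) X" for g :: "'x \<Rightarrow> real" and s
  proof -
    have "((g \<circ> snd) has_sum s) (Sigma UNIV Y)"
      using that has_sum_reindex[OF inj, of g s] unfolding im by blast
    then show ?thesis unfolding comp_def case_prod_unfold .
  qed
  let ?w = "\<lambda>k. R ^ (fst k + snd k)"
  have absC: "(\<lambda>x. \<bar>C x\<bar>) summable_on Y k" for k
  proof -
    have "(\<lambda>x. \<bar>C x\<bar> * ?w (\<phi> x)) summable_on Y k"
      by (rule summable_on_subset_banach[OF has_sum_imp_summable[OF N]]) (auto simp: Y_def)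
    then have "(\<lambda>x. \<bar>C x\<bar> * ?w k) summable_on Y k"
      by (rule summable_on_cong[THEN iffD1, rotated]) (auto simp: Y_def)
    then have "(\<lambda>x. \<bar>C x\<bar> * ?w k * inverse (?w k)) summable_on Y k"
      by (rule summable_on_cmult_left)
    moreover have "?w k * inverse (?w k) = 1" using R by simp
    ultimately show ?thesis by (simp only: mult.assoc mult_1_right)
  qed
  then have sumC: "C summable_on Y k" for k
    using abs_summable_summable[of C "Y k"] by simp
  define c where "c = (\<lambda>k. infsum C (Y k))"
  have fib: "((\<lambda>x. C x * g (\<phi> x)) has_sum c k * g k) (Y k)" for k and g :: "nat \<times> nat \<Rightarrow> real"
  proof -
    have "((\<lambda>x. C x * g k) has_sum c k * g k) (Y k)"
      unfolding c_def by (intro has_sum_cmult_left has_sum_infsum sumC)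
    then show ?thesis
      by (rule has_sum_cong[THEN iffD1, rotated]) (auto simp: Y_def)
  qed
  have fib': "((\<lambda>x. \<bar>C x\<bar> * ?w (\<phi> x)) has_sum infsum (\<lambda>x. \<bar>C x\<bar>) (Y k) * ?w k) (Y k)" for k
  proof -
    have "((\<lambda>x. \<bar>C x\<bar> * ?w k) has_sum infsum (\<lambda>x. \<bar>C x\<bar>) (Y k) * ?w k) (Y k)"
      by (intro has_sum_cmult_left has_sum_infsum absC)
    then show ?thesis
      by (rule has_sum_cong[THEN iffD1, rotated]) (auto simp: Y_def)
  qed
  have N': "((\<lambda>k. infsum (\<lambda>x. \<bar>C x\<bar>) (Y k) * ?w k) has_sum N) UNIV"
    by (rule has_sum_SigmaD[OF reindex[OF N]]) (use fib' in simp)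
  have le: "\<bar>c k\<bar> * ?w k \<le> infsum (\<lambda>x. \<bar>C x\<bar>) (Y k) * ?w k" for k
    using norm_infsum_bound[of C "Y k"] absC[of k] R unfolding c_def
    by (intro mult_right_mono) auto
  have ws: "(\<lambda>k. \<bar>c k\<bar> * ?w k) summable_on UNIV"
    and wN: "\<bar>infsum (\<lambda>k. \<bar>c k\<bar> * ?w k) UNIV\<bar> \<le> N"
    using has_sum_abs_le[OF N', of "\<lambda>k. \<bar>c k\<bar> * ?w k"] le R by (auto simp: abs_mult)
  have "((\<lambda>k. c k * mon h k) has_sum f h) UNIV" if "\<bar>h $ 1\<bar> \<le> R" "\<bar>h $ 2\<bar> \<le> R" for h
    by (rule has_sum_SigmaD[OF reindex[OF f[OF that]]]) (use fib[of "mon h"] in simp)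
  moreover have "\<exists>M\<le>N. ((\<lambda>k. \<bar>c k\<bar> * ?w k) has_sum M) UNIV"
    using has_sum_infsum[OF ws] wN by (intro exI[of _ "infsum (\<lambda>k. \<bar>c k\<bar> * ?w k) UNIV"]) auto
  ultimately show ?thesis unfolding series_def by blast
qed

lemma series_const: "R > 0 \<Longrightarrow> \<exists>c. series R \<bar>a\<bar> c (\<lambda>_. a)"
  by (rule series_collect[where X = "{0::nat}" and C = "\<lambda>_. a" and \<phi> = "\<lambda>_. (0, 0)"])
    (auto simp: mon_def intro!: has_sum_finiteI)

lemma series_nth1: "R > 0 \<Longrightarrow> \<exists>c. series R R c (\<lambda>h. h $ 1)"
  by (rule series_collect[where X = "{0::nat}" and C = "\<lambda>_. 1" and \<phi> = "\<lambda>_. (1, 0)"])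
    (auto simp: mon_def intro!: has_sum_finiteI)

lemma series_nth2: "R > 0 \<Longrightarrow> \<exists>c. series R R c (\<lambda>h. h $ 2)"
  by (rule series_collect[where X = "{0::nat}" and C = "\<lambda>_. 1" and \<phi> = "\<lambda>_. (0, 1)"])
    (auto simp: mon_def intro!: has_sum_finiteI)

lemma series_bound_mono: "series R N c f \<Longrightarrow> N \<le> N' \<Longrightarrow> series R N' c f"
  unfolding series_def by (meson order_trans)

lemma series_radius_mono:
  assumes "series R N c f" "0 < r" "r \<le> R"
  shows "series r N c f"
proof -
  obtain M where M: "M \<le> N" "((\<lambda>k. \<bar>c k\<bar> * R ^ (fst k + snd k)) has_sum M) UNIV"
    using assms unfolding series_def by blast
  have le: "\<bar>\<bar>c k\<bar> * r ^ (fst k + snd k)\<bar> \<le> \<bar>c k\<bar> * R ^ (fst k + snd k)" for k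
    using assms by (auto simp: abs_mult power_mono mult_left_mono)
  note s = has_sum_abs_le[OF M(2), of "\<lambda>k. \<bar>c k\<bar> * r ^ (fst k + snd k)", OF le]
  have "\<exists>M\<le>N. ((\<lambda>k. \<bar>c k\<bar> * r ^ (fst k + snd k)) has_sum M) UNIV"
    using has_sum_infsum[OF s(1)] s(3) M(1)
    by (intro exI[of _ "infsum (\<lambda>k. \<bar>c k\<bar> * r ^ (fst k + snd k)) UNIV"]) auto
  moreover have "\<forall>h. \<bar>h $ 1\<bar> \<le> r \<longrightarrow> \<bar>h $ 2\<bar> \<le> r \<longrightarrow> ((\<lambda>k. c k * mon h k) has_sum f h) UNIV"
    using assms unfolding series_def by auto
  ultimately show ?thesis unfolding series_def by blast
qed

text \<open>Completeness of the weighted space: summable norm bounds make the family over all pairs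
  \<open>(n, k)\<close> absolutely summable, so it may be regrouped by \<open>k\<close>.\<close>

lemma series_sums:
  assumes "R > 0" and f: "\<And>n::nat. \<exists>c. series R (N n) c (f n)" and N: "N sums S"
    and F: "\<And>h. \<bar>h $ 1\<bar> \<le> R \<Longrightarrow> \<bar>h $ 2\<bar> \<le> R \<Longrightarrow> (\<lambda>n. f n h) sums F h"
  shows "\<exists>c. series R S c F"
proof -
  obtain c where c: "\<And>n. series R (N n) (c n) (f n)" using f by metis
  \<comment> \<open>\<open>N n\<close> is only an upper bound; the sums over pairs need the exact
    norms \<open>M n\<close>.\<close>
  have "\<forall>n. \<exists>M. M \<le> N n \<and> ((\<lambda>k. \<bar>c n k\<bar> * R ^ (fst k + snd k)) has_sum M) UNIV"
    using c unfolding series_def by blast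
  then obtain M where M: "\<And>n. M n \<le> N n" "\<And>n. ((\<lambda>k. \<bar>c n k\<bar> * R ^ (fst k + snd k)) has_sum M n) UNIV"
    by metis
  have M0: "0 \<le> M n" for n using M(2) by (rule has_sum_nonneg) (use \<open>R > 0\<close> in auto)
  have sM: "summable M"
    using M(1) M0 N by (intro summable_comparison_test'[of N 0 M]) (auto simp: sums_iff)
  have hM: "(M has_sum suminf M) UNIV"
    using sM M0 by (intro norm_summable_imp_has_sum) (auto simp: summable_sums)
  have MS: "suminf M \<le> S"
    using M(1) N sM by (metis sums_iff suminf_le)
  let ?g = "\<lambda>(n, k). \<bar>c n k\<bar> * R ^ (fst k + snd k)"
  have sg: "?g summable_on (UNIV \<times> UNIV)"
    by (rule summable_on_SigmaI[OF _ has_sum_imp_summable[OF hM]]) (use M(2) \<open>R > 0\<close> in auto)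
  have g: "(?g has_sum suminf M) (UNIV \<times> UNIV)"
    by (rule has_sum_SigmaI[where g = M]) (use M(2) hM sg in auto)
  have "\<exists>c. series R (suminf M) c F"
  proof (rule series_collect[where X = "UNIV \<times> UNIV" and C = "\<lambda>(n, k). c n k" and \<phi> = snd])
    show "((\<lambda>x. \<bar>case x of (n, k) \<Rightarrow> c n k\<bar> * R ^ (fst (snd x) + snd (snd x))) has_sum suminf M) (UNIV \<times> UNIV)"
      using g by (simp add: case_prod_unfold)
    fix h :: "real^2" assume h: "\<bar>h $ 1\<bar> \<le> R" "\<bar>h $ 2\<bar> \<le> R"
    have inner: "((\<lambda>k. c n k * mon h k) has_sum f n h) UNIV" for n
      using c h unfolding series_def by blast
    have sum: "(\<lambda>(n, k). c n k * mon h k) summable_on (UNIV \<times> UNIV)"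
      by (rule has_sum_abs_le(1)[OF g])
        (use abs_mon_le[OF h] in \<open>auto simp: abs_mult intro!: mult_left_mono\<close>)
    have fM: "\<bar>f n h\<bar> \<le> M n" for n
    proof -
      have "\<bar>infsum (\<lambda>k. c n k * mon h k) UNIV\<bar> \<le> M n"
        by (rule has_sum_abs_le(3)[OF M(2)]) (use abs_mon_le[OF h] in \<open>simp add: abs_mult mult_left_mono\<close>)
      then show ?thesis unfolding infsumI[OF inner] .
    qed
    have "summable (\<lambda>n. norm (f n h))"
      by (rule summable_comparison_test'[OF sM, of 0]) (simp add: fM)
    then have "((\<lambda>n. f n h) has_sum F h) UNIV"
      using F[OF h] by (rule norm_summable_imp_has_sum)
    from has_sum_SigmaI[OF _ this sum]
    have "((\<lambda>(n, k). c n k * mon h k) has_sum F h) (UNIV \<times> UNIV)"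
      by (simp add: inner)
    then show "((\<lambda>x. (case x of (n, k) \<Rightarrow> c n k) * mon h (snd x)) has_sum F h) (UNIV \<times> UNIV)"
      by (simp add: case_prod_unfold)
  qed (rule \<open>R > 0\<close>)
  then show ?thesis using MS series_bound_mono by blast
qed

lemma has_sum_times:
  fixes f :: "'a \<Rightarrow> real" and g :: "'b \<Rightarrow> real"
  assumes f: "(f has_sum a) UNIV" and g: "(g has_sum b) UNIV"
    and s: "(\<lambda>(x, y). f x * g y) summable_on (UNIV \<times> UNIV)"
  shows "((\<lambda>(x, y). f x * g y) has_sum a * b) (UNIV \<times> UNIV)"
  by (rule has_sum_SigmaI[where g = "\<lambda>x. f x * b"]) (use assms in \<open>auto intro: has_sum_cmult_left has_sum_cmult_right\<close>)

text \<open>The Cauchy product is the family over pairs of exponents, collected along their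
  addition. The weight is multiplicative, hence so are the norm bounds.\<close>

lemma series_mult:
  assumes "R > 0" "series R N c f" "series R N' d g"
  shows "\<exists>e. series R (N * N') e (\<lambda>h. f h * g h)"
proof -
  let ?w = "\<lambda>k::nat \<times> nat. R ^ (fst k + snd k)"
  obtain M where M: "M \<le> N" "((\<lambda>k. \<bar>c k\<bar> * ?w k) has_sum M) UNIV"
    using assms unfolding series_def by blast
  obtain M' where M': "M' \<le> N'" "((\<lambda>k. \<bar>d k\<bar> * ?w k) has_sum M') UNIV"
    using assms unfolding series_def by blast
  have M0: "0 \<le> M" "0 \<le> M'"
    using M(2) M'(2) by (auto elim!: has_sum_nonneg intro: mult_nonneg_nonneg simp: \<open>R > 0\<close> less_imp_le)
  let ?g = "\<lambda>(k, l). (\<bar>c k\<bar> * ?w k) * (\<bar>d l\<bar> * ?w l)"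
  have sg: "?g summable_on (UNIV \<times> UNIV)"
  proof (rule summable_on_SigmaI[where g = "\<lambda>k. \<bar>c k\<bar> * ?w k * M'"])
    show "(\<lambda>k. \<bar>c k\<bar> * ?w k * M') summable_on UNIV"
      by (rule summable_on_cmult_left[OF has_sum_imp_summable[OF M(2)]])
  qed (use \<open>R > 0\<close> M'(2) in \<open>auto intro: has_sum_cmult_right\<close>)
  have g: "(?g has_sum M * M') (UNIV \<times> UNIV)"
    using has_sum_times[OF M(2) M'(2)] sg by simp
  have "\<exists>e. series R (M * M') e (\<lambda>h. f h * g h)"
  proof (rule series_collect[where X = "UNIV \<times> UNIV" and C = "\<lambda>(k, l). c k * d l"
        and \<phi> = "\<lambda>(k, l). (fst k + fst l, snd k + snd l)"])
    show "((\<lambda>x. \<bar>case x of (k, l) \<Rightarrow> c k * d l\<bar> *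
        R ^ (fst (case x of (k, l) \<Rightarrow> (fst k + fst l, snd k + snd l)) +
             snd (case x of (k, l) \<Rightarrow> (fst k + fst l, snd k + snd l)))) has_sum M * M') (UNIV \<times> UNIV)"
      using g by (simp add: case_prod_unfold abs_mult power_add mult_ac)
    fix h :: "real^2" assume h: "\<bar>h $ 1\<bar> \<le> R" "\<bar>h $ 2\<bar> \<le> R"
    have s: "((\<lambda>k. c k * mon h k) has_sum f h) UNIV" "((\<lambda>k. d k * mon h k) has_sum g h) UNIV"
      using assms h unfolding series_def by blast+
    have "(\<lambda>(k, l). (c k * mon h k) * (d l * mon h l)) summable_on (UNIV \<times> UNIV)"
      by (rule has_sum_abs_le(1)[OF g])
        (use abs_mon_le[OF h] \<open>R > 0\<close> in \<open>auto simp: abs_mult intro!: mult_mono mult_nonneg_nonneg\<close>)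
    from has_sum_times[OF s this]
    show "((\<lambda>x. (case x of (k, l) \<Rightarrow> c k * d l) * mon h (case x of (k, l) \<Rightarrow> (fst k + fst l, snd k + snd l)))
        has_sum f h * g h) (UNIV \<times> UNIV)"
      by (simp add: case_prod_unfold mon_add mult_ac)
  qed (rule \<open>R > 0\<close>)
  moreover have "M * M' \<le> N * N'" using M(1) M'(1) M0 by (intro mult_mono) auto
  ultimately show ?thesis using series_bound_mono by blast
qed

text \<open>A sum of two series is treated as an infinite sum with only two nonzero terms.\<close>

lemma series_add:
  assumes "R > 0" "series R N c f" "series R N' d g"
  shows "\<exists>e. series R (N + N') e (\<lambda>h. f h + g h)"
proof (rule series_sums[where N = "\<lambda>n. if n = 0 then N else if n = 1 then N' else 0" and
      f = "\<lambda>n. if n = 0 then f else if n = 1 then g else (\<lambda>_. 0)", OF \<open>R > 0\<close>])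
  show "\<exists>c. series R (if n = 0 then N else if n = 1 then N' else 0) c
      (if n = 0 then f else if n = 1 then g else (\<lambda>_. 0))" for n :: nat
    using assms series_const[OF \<open>R > 0\<close>, of 0] by auto
  show "(\<lambda>n. if n = 0 then N else if n = 1 then N' else 0) sums (N + N')"
    using sums_finite[of "{0,1}" "\<lambda>n. if n = 0 then N else if n = 1 then N' else 0"] by simp
  show "(\<lambda>n. (if n = 0 then f else if n = 1 then g else (\<lambda>_. 0)) h) sums (f h + g h)" for h
    using sums_finite[of "{0,1}" "\<lambda>n. (if n = 0 then f else if n = 1 then g else (\<lambda>_. 0)) h"] by simp
qed

lemma series_cmult:
  assumes "R > 0" "series R N c f"
  shows "\<exists>e. series R (\<bar>a\<bar> * N) e (\<lambda>h. a * f h)"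
  using series_const[OF \<open>R > 0\<close>, of a] series_mult[OF \<open>R > 0\<close> _ assms(2)] by blast

lemma series_power:
  assumes "R > 0" "series R N c f"
  shows "\<exists>e. series R (N ^ n) e (\<lambda>h. f h ^ n)"
proof (induction n)
  case 0
  then show ?case using series_const[OF \<open>R > 0\<close>, of 1] by simp
next
  case (Suc n)
  then show ?case using series_mult[OF \<open>R > 0\<close> assms(2)] by auto
qed

section \<open>Partial derivatives of double power series and the identity theorem\<close>

definition flip :: "real^2 \<Rightarrow> real^2" where
  "flip h = pt (h $ 2) (h $ 1)"

lemma flip_nth [simp]: "flip h $ 1 = h $ 2" "flip h $ 2 = h $ 1" "flip (flip h) = h" "flip (pt x y) = pt y x"
  by (simp_all add: flip_def)

lemma series_flip:
  assumes "series R N c f"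
  shows "series R N (c \<circ> prod.swap) (f \<circ> flip)"
proof -
  obtain M where M: "M \<le> N" "((\<lambda>k. \<bar>c k\<bar> * R ^ (fst k + snd k)) has_sum M) UNIV"
    and f: "\<And>h. \<bar>h $ 1\<bar> \<le> R \<Longrightarrow> \<bar>h $ 2\<bar> \<le> R \<Longrightarrow> ((\<lambda>k. c k * mon h k) has_sum f h) UNIV"
    using assms unfolding series_def by blast
  have swap: "((g \<circ> prod.swap) has_sum s) UNIV" if "(g has_sum s) UNIV" for g :: "nat \<times> nat \<Rightarrow> real" and s
    using that has_sum_reindex[of prod.swap UNIV g s] by simp
  have "((\<lambda>k. \<bar>(c \<circ> prod.swap) k\<bar> * R ^ (fst k + snd k)) has_sum M) UNIV"
    using swap[OF M(2)] by (simp add: comp_def add.commute)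
  moreover have "((\<lambda>k. (c \<circ> prod.swap) k * mon h k) has_sum (f \<circ> flip) h) UNIV"
    if "\<bar>h $ 1\<bar> \<le> R" "\<bar>h $ 2\<bar> \<le> R" for h
    using swap[OF f[of "flip h"]] that by (simp add: comp_def mon_def mult.commute)
  ultimately show ?thesis unfolding series_def using M(1) by blast
qed

text \<open>The formal derivative in the first variable. The one in the second variable is its
  conjugate under \<open>prod.swap\<close>.\<close>

definition dcoeff :: "(nat \<times> nat \<Rightarrow> real) \<Rightarrow> nat \<times> nat \<Rightarrow> real" where
  "dcoeff c k = real (Suc (fst k)) * c (Suc (fst k), snd k)"

text \<open>Freezing \<open>y\<close> and summing over the second exponent leaves an ordinary power
  series in \<open>x\<close>, to which the one-variable theorems apply.\<close>

lemma series_rows: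
  assumes "series R N c f" and "R > 0" "\<bar>x\<bar> \<le> R" "\<bar>y\<bar> \<le> R"
  shows "(\<lambda>i. (\<Sum>\<^sub>\<infinity>j. c (i, j) * y ^ j) * x ^ i) sums f (pt x y)"
proof -
  have f: "((\<lambda>k. c k * mon (pt u y) k) has_sum f (pt u y)) UNIV" if "\<bar>u\<bar> \<le> R" for u
    using assms that unfolding series_def by simp
  \<comment> \<open>The double series is evaluated at \<open>R\<close> in the first variable because
    the resulting factor \<open>R ^ i\<close> is nonzero and can be divided out, unlike
    \<open>x ^ i\<close>.\<close>
  have row: "(\<lambda>j. c (i, j) * y ^ j) summable_on UNIV" for i
  proof -
    have "(\<lambda>(i, j). c (i, j) * mon (pt R y) (i, j)) summable_on (UNIV \<times> UNIV)"
      using has_sum_imp_summable[OF f[of R]] \<open>R > 0\<close> by (simp add: case_prod_unfold)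
    then have "(\<lambda>j. c (i, j) * mon (pt R y) (i, j)) summable_on UNIV"
      by (rule summable_on_SigmaD1) simp
    then have "(\<lambda>j. c (i, j) * y ^ j * R ^ i) summable_on UNIV"
      by (simp add: mon_def mult_ac)
    then have "(\<lambda>j. c (i, j) * y ^ j * R ^ i * inverse (R ^ i)) summable_on UNIV"
      by (rule summable_on_cmult_left)
    moreover have "R ^ i * inverse (R ^ i) = 1" using \<open>R > 0\<close> by simp
    ultimately show ?thesis by (simp only: mult.assoc mult_1_right)
  qed
  have "((\<lambda>i. (\<Sum>\<^sub>\<infinity>j. c (i, j) * y ^ j) * x ^ i) has_sum f (pt x y)) UNIV"
  proof (rule has_sum_SigmaD[where B = "\<lambda>_. UNIV"])
    show "((\<lambda>k. c k * mon (pt x y) k) has_sum f (pt x y)) (UNIV \<times> UNIV)"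
      using f[OF assms(3)] by simp
    fix i :: nat
    have "((\<lambda>j. c (i, j) * y ^ j * x ^ i) has_sum (\<Sum>\<^sub>\<infinity>j. c (i, j) * y ^ j) * x ^ i) UNIV"
      by (intro has_sum_cmult_left has_sum_infsum row)
    then show "((\<lambda>j. c (i, j) * mon (pt x y) (i, j)) has_sum (\<Sum>\<^sub>\<infinity>j. c (i, j) * y ^ j) * x ^ i) UNIV"
      by (simp add: mon_def mult_ac)
  qed
  then show ?thesis by (rule has_sum_imp_sums)
qed

text \<open>Shrinking the radius pays for the factor produced by differentiation, since
  \<open>n * (r / R) ^ n\<close> is bounded. So the formal derivative converges absolutely, and
  termwise differentiation along each line in the first variable identifies its sum.\<close>

lemma series_has_derivative_1:
  assumes f: "series R N c f" and r: "0 < r" "r < R"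
  obtains N' g where "series r N' (dcoeff c) g"
    "\<And>x y. \<bar>x\<bar> < r \<Longrightarrow> \<bar>y\<bar> < r \<Longrightarrow> ((\<lambda>x. f (pt x y)) has_real_derivative g (pt x y)) (at x)"
proof -
  let ?w = "\<lambda>k::nat \<times> nat. R ^ (fst k + snd k)"
  obtain M where M: "M \<le> N" "((\<lambda>k. \<bar>c k\<bar> * ?w k) has_sum M) UNIV"
    using f unfolding series_def by blast
  have "R > 0" using r by linarith
  have "norm (r / R) < 1" using r by simp
  then have "Bseq (\<lambda>n. of_nat n * (r / R) ^ n)"
    by (intro convergent_imp_Bseq convergentI[OF powser_times_n_limit_0])
  then obtain K where K: "K > 0" "\<And>n. \<bar>real n * (r / R) ^ n\<bar> \<le> K" unfolding Bseq_def by auto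
  have le: "real (Suc i) * r ^ i \<le> K / r * R ^ Suc i" for i
  proof -
    have "real (Suc i) * (r / R) ^ Suc i \<le> K" using K(2)[of "Suc i"] by linarith
    then have "real (Suc i) * r ^ Suc i \<le> K * R ^ Suc i"
      using \<open>R > 0\<close> by (simp only: power_divide times_divide_eq_right pos_divide_le_eq zero_less_power)
    then show ?thesis using r(1) by (simp add: field_simps)
  qed
  have "inj (\<lambda>k::nat \<times> nat. (Suc (fst k), snd k))" by (auto simp: inj_on_def)
  moreover have "(\<lambda>k. \<bar>c k\<bar> * ?w k) summable_on range (\<lambda>k::nat \<times> nat. (Suc (fst k), snd k))"
    by (rule summable_on_subset_banach[OF has_sum_imp_summable[OF M(2)]]) simp
  ultimately have "(\<lambda>k. \<bar>c (Suc (fst k), snd k)\<bar> * R ^ (Suc (fst k) + snd k)) summable_on UNIV"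
    by (subst (asm) summable_on_reindex) (auto simp: comp_def)
  then have s: "(\<lambda>k. K / r * (\<bar>c (Suc (fst k), snd k)\<bar> * R ^ (Suc (fst k) + snd k))) summable_on UNIV"
    by (rule summable_on_cmult_right)
  have b: "\<bar>\<bar>dcoeff c k\<bar> * r ^ (fst k + snd k)\<bar> \<le> K / r * (\<bar>c (Suc (fst k), snd k)\<bar> * R ^ (Suc (fst k) + snd k))" for k
  proof -
    have "(real (Suc (fst k)) * r ^ fst k) * r ^ snd k \<le> (K / r * R ^ Suc (fst k)) * R ^ snd k"
      using r K(1) by (intro mult_mono le power_mono) auto
    then have "\<bar>c (Suc (fst k), snd k)\<bar> * ((real (Suc (fst k)) * r ^ fst k) * r ^ snd k)
        \<le> \<bar>c (Suc (fst k), snd k)\<bar> * ((K / r * R ^ Suc (fst k)) * R ^ snd k)"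
      by (intro mult_left_mono) auto
    then show ?thesis using r(1) by (simp add: dcoeff_def abs_mult power_add mult_ac del: of_nat_Suc)
  qed
  note d = has_sum_abs_le[OF has_sum_infsum[OF s], of "\<lambda>k. \<bar>dcoeff c k\<bar> * r ^ (fst k + snd k)", OF b]
  define g where "g = (\<lambda>h. \<Sum>\<^sub>\<infinity>k. dcoeff c k * mon h k)"
  have "((\<lambda>k. dcoeff c k * mon h k) has_sum g h) UNIV" if "\<bar>h $ 1\<bar> \<le> r" "\<bar>h $ 2\<bar> \<le> r" for h
    unfolding g_def
  proof (rule has_sum_infsum, rule has_sum_abs_le(1)[OF has_sum_infsum[OF d(1)]])
    show "\<bar>dcoeff c k * mon h k\<bar> \<le> \<bar>dcoeff c k\<bar> * r ^ (fst k + snd k)" for k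
      using abs_mon_le[OF that] by (simp add: abs_mult mult_left_mono)
  qed
  with has_sum_infsum[OF d(1)] have g: "series r (infsum (\<lambda>k. \<bar>dcoeff c k\<bar> * r ^ (fst k + snd k)) UNIV) (dcoeff c) g"
    unfolding series_def by blast
  have "((\<lambda>x. f (pt x y)) has_real_derivative g (pt x y)) (at x)" if xy: "\<bar>x\<bar> < r" "\<bar>y\<bar> < r" for x y
  proof -
    let ?d = "\<lambda>i. \<Sum>\<^sub>\<infinity>j. c (i, j) * y ^ j"
    have F: "(\<lambda>i. ?d i * u ^ i) sums f (pt u y)" if "\<bar>u\<bar> \<le> R" for u
      using series_rows[OF f \<open>R > 0\<close> that, of y] xy r by simp
    have "DERIV (\<lambda>x. \<Sum>n. ?d n * x ^ n) x :> (\<Sum>n. diffs ?d n * x ^ n)"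
      using F[of R] xy r by (intro termdiffs_strong[where K = R]) (auto simp: sums_iff)
    moreover have "(\<Sum>n. diffs ?d n * x ^ n) = g (pt x y)"
    proof -
      have "(\<Sum>\<^sub>\<infinity>j. dcoeff c (i, j) * y ^ j) = diffs ?d i" for i
        unfolding dcoeff_def diffs_def
        by (simp add: infsum_cmult_right' mult.assoc del: of_nat_Suc)
      then show ?thesis
        using series_rows[OF g r(1), of x y] xy by (simp add: sums_iff)
    qed
    ultimately have D: "DERIV (\<lambda>x. \<Sum>n. ?d n * x ^ n) x :> g (pt x y)" by simp
    have "eventually (\<lambda>u. u \<in> {-r<..<r}) (nhds x)"
      using xy by (intro eventually_nhds_in_open) auto
    then have "eventually (\<lambda>u. (\<Sum>n. ?d n * u ^ n) = f (pt u y)) (nhds x)"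
      by eventually_elim (use F r in \<open>auto simp: sums_iff abs_le_iff\<close>)
    then show ?thesis using D by (rule DERIV_cong_ev[THEN iffD1, OF refl _ refl])
  qed
  with g show thesis by (rule that)
qed

lemma series_at_0:
  assumes "series R N c f" "R > 0"
  shows "f 0 = c (0, 0)"
proof -
  have "((\<lambda>k. c k * mon 0 k) has_sum f 0) UNIV"
    using assms unfolding series_def by simp
  moreover have "((\<lambda>k. c k * mon 0 k) has_sum c (0, 0)) UNIV"
  proof -
    have "((\<lambda>k. c k * mon 0 k) has_sum c (0, 0)) {(0, 0)}"
      by (intro has_sum_finiteI) (auto simp: mon_def)
    then show ?thesis
      by (rule has_sum_cong_neutral[THEN iffD1, rotated -1]) (auto simp: mon_def)
  qed
  ultimately show ?thesis using has_sum_unique by blast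
qed

text \<open>The real series also converges on the complex disc of radius \<open>R\<close>. There it
  is holomorphic with zeros accumulating at \<open>p\<close>, and analytic continuation
  applies.\<close>

lemma powser_identity:
  fixes d :: "nat \<Rightarrow> real"
  assumes F: "\<And>x. \<bar>x\<bar> < R \<Longrightarrow> (\<lambda>i. d i * x ^ i) sums F x"
    and p: "\<bar>p\<bar> < R" "\<epsilon> > 0" "\<And>x. \<bar>x\<bar> < R \<Longrightarrow> \<bar>x - p\<bar> < \<epsilon> \<Longrightarrow> F x = 0" and x: "\<bar>x\<bar> < R"
  shows "F x = 0"
proof -
  define G where "G = (\<lambda>z::complex. \<Sum>i. of_real (d i) * z ^ i)"
  have sumG: "(\<lambda>i. of_real (d i) * z ^ i) sums G z" if z: "norm z < R" for z
  proof -
    \<comment> \<open>Convergence at a real point strictly between \<open>norm z\<close> and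
      \<open>R\<close> gives convergence at the complex point \<open>z\<close>.\<close>
    define K where "K = (norm z + R) / 2"
    have K: "norm z < K" "K < R" using z by (auto simp: K_def)
    have "K > 0" using K(1) norm_ge_zero[of z] by linarith
    have "summable (\<lambda>i. d i * K ^ i)" using F[of K] K \<open>K > 0\<close> by (auto simp: sums_iff)
    then have "summable (\<lambda>i. of_real (d i * K ^ i) :: complex)"
      by (simp only: summable_complex_of_real)
    then have "summable (\<lambda>i. of_real (d i) * (of_real K :: complex) ^ i)" by simp
    then have "summable (\<lambda>i. of_real (d i) * z ^ i)"
      by (rule powser_inside) (use K \<open>K > 0\<close> in simp)
    then show ?thesis by (simp add: G_def summable_sums)
  qed
  have GF: "G (of_real u) = of_real (F u)" if "\<bar>u\<bar> < R" for u
  proof -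
    have "(\<lambda>i. complex_of_real (d i * u ^ i)) sums of_real (F u)"
      using F[OF that] by (rule sums_of_real)
    moreover have "(\<lambda>i. of_real (d i) * of_real u ^ i) sums G (of_real u)"
      using that by (intro sumG) simp
    ultimately show ?thesis by (simp add: sums_iff)
  qed
  have "R > 0" using x by linarith
  have hol: "G holomorphic_on ball 0 R"
    by (rule power_series_holomorphic[where a = "\<lambda>i. of_real (d i)"]) (simp add: sumG)
  have lim: "(of_real p :: complex) islimpt {of_real u | u. \<bar>u\<bar> < R \<and> \<bar>u - p\<bar> < \<epsilon>}"
    unfolding islimpt_approachable
  proof (intro allI impI)
    fix e :: real assume "e > 0"
    define t where "t = min e (min \<epsilon> (R - \<bar>p\<bar>)) / 2"
    have t: "t > 0" "t < e" "t < \<epsilon>" "t < R - \<bar>p\<bar>" using \<open>e > 0\<close> p(1,2) by (auto simp: t_def)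
    have "(of_real (p + t) :: complex) \<in> {of_real u | u. \<bar>u\<bar> < R \<and> \<bar>u - p\<bar> < \<epsilon>}"
      using t by (intro CollectI exI[of _ "p + t"]) auto
    moreover have "dist (of_real (p + t)) (of_real p :: complex) < e"
      using t by (simp add: dist_norm)
    ultimately show "\<exists>x'\<in>{of_real u | u. \<bar>u\<bar> < R \<and> \<bar>u - p\<bar> < \<epsilon>}. x' \<noteq> (of_real p :: complex) \<and> dist x' (of_real p) < e"
      using t(1) by (intro bexI[of _ "of_real (p + t)"]) auto
  qed
  have "G (of_real x) = 0"
  proof (rule analytic_continuation[OF hol open_ball connected_ball _ _ lim])
    show "G z = 0" if "z \<in> {of_real u | u. \<bar>u\<bar> < R \<and> \<bar>u - p\<bar> < \<epsilon>}" for z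
      using that GF p(3) by auto
  qed (use p x in auto)
  then show ?thesis using GF[OF x] by simp
qed

text \<open>The one-variable identity theorem is used twice: along horizontal lines it extends the
  zeros from a small box to a strip, and along vertical lines from the strip to the full
  box.\<close>

lemma series_identity:
  assumes f: "series R N c f" and p: "\<bar>p $ 1\<bar> < R" "\<bar>p $ 2\<bar> < R" "\<epsilon> > 0"
    and z: "\<And>h. \<bar>h $ 1\<bar> < R \<Longrightarrow> \<bar>h $ 2\<bar> < R \<Longrightarrow> \<bar>h $ 1 - p $ 1\<bar> < \<epsilon> \<Longrightarrow> \<bar>h $ 2 - p $ 2\<bar> < \<epsilon> \<Longrightarrow> f h = 0"
    and h: "\<bar>h $ 1\<bar> < R" "\<bar>h $ 2\<bar> < R"
  shows "f h = 0"
proof -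
  have strip: "f (pt x y) = 0" if y: "\<bar>y\<bar> < R" "\<bar>y - p $ 2\<bar> < \<epsilon>" and x: "\<bar>x\<bar> < R" for x y
  proof (rule powser_identity[where F = "\<lambda>x. f (pt x y)" and d = "\<lambda>i. \<Sum>\<^sub>\<infinity>j. c (i, j) * y ^ j"])
    show "(\<lambda>i. (\<Sum>\<^sub>\<infinity>j. c (i, j) * y ^ j) * x ^ i) sums f (pt x y)" if "\<bar>x\<bar> < R" for x
      using that y p by (intro series_rows[OF f]) auto
    show "f (pt x y) = 0" if "\<bar>x\<bar> < R" "\<bar>x - p $ 1\<bar> < \<epsilon>" for x
      using that y by (intro z) auto
  qed (use p x in auto)
  have "(f \<circ> flip) (pt (h $ 2) (h $ 1)) = 0"
  proof (rule powser_identity[where F = "\<lambda>y. (f \<circ> flip) (pt y (h $ 1))"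
        and d = "\<lambda>i. \<Sum>\<^sub>\<infinity>j. (c \<circ> prod.swap) (i, j) * (h $ 1) ^ j"])
    show "(\<lambda>i. (\<Sum>\<^sub>\<infinity>j. (c \<circ> prod.swap) (i, j) * (h $ 1) ^ j) * y ^ i) sums (f \<circ> flip) (pt y (h $ 1))"
      if "\<bar>y\<bar> < R" for y
      using that h p by (intro series_rows[OF series_flip[OF f]]) auto
    show "(f \<circ> flip) (pt y (h $ 1)) = 0" if "\<bar>y\<bar> < R" "\<bar>y - p $ 2\<bar> < \<epsilon>" for y
      using strip[OF that h(1)] by simp
  qed (use p h in auto)
  then show ?thesis by simp
qed

section \<open>Fourier series on the circle\<close>

text \<open>Trigonometric polynomials. Integer rather than natural frequencies keep the product
  formulas, which involve \<open>j - k\<close>, free of case distinctions.\<close>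

inductive trig :: "(real \<Rightarrow> real) \<Rightarrow> bool" where
  trig_cos: "trig (\<lambda>\<theta>. c * cos (of_int k * \<theta>))"
| trig_sin: "trig (\<lambda>\<theta>. c * sin (of_int k * \<theta>))"
| trig_add: "trig f \<Longrightarrow> trig g \<Longrightarrow> trig (\<lambda>\<theta>. f \<theta> + g \<theta>)"

lemma trig_mult_cos: "trig f \<Longrightarrow> trig (\<lambda>\<theta>. f \<theta> * (c * cos (of_int k * \<theta>)))"
proof (induction rule: trig.induct)
  case (trig_cos d j)
  have "trig (\<lambda>\<theta>. (d * c / 2) * cos (of_int (j - k) * \<theta>) + (d * c / 2) * cos (of_int (j + k) * \<theta>))"
    by (intro trig.intros)
  then show ?case
    by (simp add: cos_times_cos[of "of_int j * _" "of_int k * _"] left_diff_distrib distrib_right algebra_simps cos_add cos_diff)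
next
  case (trig_sin d j)
  have "trig (\<lambda>\<theta>. (d * c / 2) * sin (of_int (j - k) * \<theta>) + (d * c / 2) * sin (of_int (j + k) * \<theta>))"
    by (intro trig.intros)
  then show ?case
    by (simp add: algebra_simps sin_add sin_diff)
next
  case (trig_add f g)
  then show ?case using trig.trig_add by (simp add: distrib_right)
qed

lemma trig_mult_sin: "trig f \<Longrightarrow> trig (\<lambda>\<theta>. f \<theta> * (c * sin (of_int k * \<theta>)))"
proof (induction rule: trig.induct)
  case (trig_cos d j)
  have "trig (\<lambda>\<theta>. (d * c / 2) * sin (of_int (j + k) * \<theta>) + (- (d * c / 2)) * sin (of_int (j - k) * \<theta>))"
    by (intro trig.intros)
  then show ?case
    by (simp add: algebra_simps sin_add sin_diff)
next
  case (trig_sin d j)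
  have "trig (\<lambda>\<theta>. (d * c / 2) * cos (of_int (j - k) * \<theta>) + (- (d * c / 2)) * cos (of_int (j + k) * \<theta>))"
    by (intro trig.intros)
  then show ?case
    by (simp add: algebra_simps cos_add cos_diff)
next
  case (trig_add f g)
  then show ?case using trig.trig_add by (simp add: distrib_right)
qed

lemma trig_mult: "trig g \<Longrightarrow> trig f \<Longrightarrow> trig (\<lambda>\<theta>. f \<theta> * g \<theta>)"
proof (induction rule: trig.induct)
  case (trig_add g1 g2)
  then show ?case using trig.trig_add by (simp add: distrib_left)
qed (auto intro: trig_mult_cos trig_mult_sin)

lemma trig_const: "trig (\<lambda>_. c)"
  using trig_cos[of c 0] by simp

text \<open>Connects Stone-Weierstrass, whose approximants are polynomials on the plane, with
  orthogonality relations, which concern trigonometric polynomials.\<close>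

lemma trig_polynomial:
  assumes "real_polynomial_function p"
  shows "trig (\<lambda>\<theta>. p (cis \<theta>))"
  using assms
proof induction
  case (linear f)
  have eq: "f (cis \<theta>) = f 1 * cos (of_int 1 * \<theta>) + f \<i> * sin (of_int 1 * \<theta>)" for \<theta>
  proof -
    have lin: "linear f"
      using linear by (rule bounded_linear.linear)
    have "cis \<theta> = cos \<theta> *\<^sub>R 1 + sin \<theta> *\<^sub>R \<i>" by (simp add: complex_eq_iff)
    then show ?thesis
      by (simp only: linear_add[OF lin] linear_scale[OF lin]) simp
  qed
  show ?case unfolding eq by (intro trig.intros)
next
  case (const c)
  show ?case by (rule trig_const)
next
  case (add f g)
  then show ?case by (intro trig.trig_add)
next
  case (mult f g)
  then show ?case by (intro trig_mult)
qed

lemma cis_Arg2pi: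
  assumes "norm z = 1"
  shows "cis (Arg2pi z) = z" "0 \<le> Arg2pi z" "Arg2pi z \<le> 2 * pi"
  using assms complex_norm_eq_1_exp[of z] Arg2pi[of z] by (auto simp: cis_conv_exp)

lemma trig_continuous: "trig f \<Longrightarrow> continuous_on S f"
  by (induction rule: trig.induct) (auto intro!: continuous_intros)

lemma circle_continuous:
  assumes "continuous_on (sphere 0 1) F"
  shows "continuous_on S (\<lambda>\<theta>. F (cis \<theta>))"
  by (rule continuous_on_compose2[OF assms]) (auto intro!: continuous_intros simp: cis_conv_exp)

text \<open>\<open>F\<close> is orthogonal to all trigonometric polynomials, in particular to those
  approximating \<open>F\<close> itself uniformly. So the integral of its square is arbitrarily
  small, hence 0, and continuity gives \<open>F = 0\<close>.\<close>

theorem fourier_complete: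
  fixes F :: "complex \<Rightarrow> real"
  assumes F: "continuous_on (sphere 0 1) F"
    and c: "\<And>n::nat. integral {0..2*pi} (\<lambda>\<theta>. F (cis \<theta>) * cos (real n * \<theta>)) = 0"
    and s: "\<And>n::nat. integral {0..2*pi} (\<lambda>\<theta>. F (cis \<theta>) * sin (real n * \<theta>)) = 0"
    and z: "norm z = 1"
  shows "F z = 0"
proof -
  define D where "D = (\<lambda>\<theta>. F (cis \<theta>))"
  have cD: "continuous_on {0..2*pi} D" unfolding D_def by (rule circle_continuous[OF F])
  have c': "integral {0..2*pi} (\<lambda>\<theta>. D \<theta> * cos (of_int k * \<theta>)) = 0" for k :: int
    using c[of "nat \<bar>k\<bar>"] by (cases "k \<ge> 0") (auto simp: D_def)
  have s': "integral {0..2*pi} (\<lambda>\<theta>. D \<theta> * sin (of_int k * \<theta>)) = 0" for k :: int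
    using s[of "nat \<bar>k\<bar>"] by (cases "k \<ge> 0") (auto simp: D_def)
  have int0: "integral {0..2*pi} (\<lambda>\<theta>. D \<theta> * g \<theta>) = 0" if "trig g" for g
    using that
  proof induction
    case (trig_cos d k)
    have "(\<lambda>\<theta>. D \<theta> * (d * cos (of_int k * \<theta>))) = (\<lambda>\<theta>. d * (D \<theta> * cos (of_int k * \<theta>)))"
      by (simp add: mult_ac)
    then show ?case using c'[of k] by simp
  next
    case (trig_sin d k)
    have "(\<lambda>\<theta>. D \<theta> * (d * sin (of_int k * \<theta>))) = (\<lambda>\<theta>. d * (D \<theta> * sin (of_int k * \<theta>)))"
      by (simp add: mult_ac)
    then show ?case using s'[of k] by simp
  next
    case (trig_add f g)
    have i: "(\<lambda>\<theta>. D \<theta> * f \<theta>) integrable_on {0..2*pi}" "(\<lambda>\<theta>. D \<theta> * g \<theta>) integrable_on {0..2*pi}"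
      by (rule integrable_continuous_real[OF continuous_on_mult[OF cD trig_continuous]], fact)+
    have "integral {0..2*pi} (\<lambda>\<theta>. D \<theta> * f \<theta> + D \<theta> * g \<theta>) = 0"
      using integral_add[OF i] trig_add.IH by simp
    then show ?case by (simp add: distrib_left)
  qed
  have "bounded (D ` {0..2*pi})"
    by (intro compact_imp_bounded compact_continuous_image cD) auto
  then obtain M where M: "M > 0" "\<And>\<theta>. \<theta> \<in> {0..2*pi} \<Longrightarrow> \<bar>D \<theta>\<bar> \<le> M"
    unfolding bounded_pos by auto
  have "integral {0..2*pi} (\<lambda>\<theta>. D \<theta> * D \<theta>) \<le> e" if "e > 0" for e
  proof -
    \<comment> \<open>The integrand below is at most \<open>M * \<epsilon>\<close> on an interval of
      length \<open>2 * pi\<close>.\<close>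
    define \<epsilon> where "\<epsilon> = e / (M * (2 * pi))"
    have "\<epsilon> > 0" using that M(1) by (simp add: \<epsilon>_def)
    obtain p where p: "real_polynomial_function p" "\<And>x. x \<in> sphere 0 1 \<Longrightarrow> \<bar>F x - p x\<bar> < \<epsilon>"
      using Stone_Weierstrass_real_polynomial_function[OF compact_sphere F \<open>\<epsilon> > 0\<close>] by metis
    define g where "g = (\<lambda>\<theta>. p (cis \<theta>))"
    have g: "trig g" unfolding g_def by (rule trig_polynomial[OF p(1)])
    note cg = trig_continuous[OF g]
    have i: "(\<lambda>\<theta>. D \<theta> * D \<theta>) integrable_on {0..2*pi}" "(\<lambda>\<theta>. D \<theta> * g \<theta>) integrable_on {0..2*pi}"
      by (auto intro!: integrable_continuous_real continuous_on_mult cD cg)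
    have "integral {0..2*pi} (\<lambda>\<theta>. D \<theta> * D \<theta>) = integral {0..2*pi} (\<lambda>\<theta>. D \<theta> * D \<theta> - D \<theta> * g \<theta>)"
      using integral_diff[OF i] int0[OF g] by simp
    also have "\<dots> \<le> (M * \<epsilon>) * (2 * pi - 0)"
    proof -
      have "\<bar>D \<theta> * D \<theta> - D \<theta> * g \<theta>\<bar> \<le> M * \<epsilon>" if "\<theta> \<in> {0..2*pi}" for \<theta>
      proof -
        have "\<bar>D \<theta> - g \<theta>\<bar> \<le> \<epsilon>" using p(2)[of "cis \<theta>"] by (simp add: D_def g_def)
        then have "\<bar>D \<theta>\<bar> * \<bar>D \<theta> - g \<theta>\<bar> \<le> M * \<epsilon>" using M that by (intro mult_mono) auto
        then show ?thesis by (simp add: right_diff_distrib flip: abs_mult)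
      qed
      then have "\<bar>integral {0..2*pi} (\<lambda>\<theta>. D \<theta> * D \<theta> - D \<theta> * g \<theta>)\<bar> \<le> (M * \<epsilon>) * (2 * pi - 0)"
        using M(1) \<open>\<epsilon> > 0\<close> by (intro integral_abs_bound_1) (auto intro!: continuous_intros cD cg)
      then show ?thesis by linarith
    qed
    also have "\<dots> = e" using M(1) by (simp add: \<epsilon>_def)
    finally show ?thesis .
  qed
  then have "integral {0..2*pi} (\<lambda>\<theta>. D \<theta> * D \<theta>) \<le> 0"
    by (rule field_le_epsilon) simp
  moreover have "integral {0..2*pi} (\<lambda>\<theta>. D \<theta> * D \<theta>) \<ge> 0"
    by (intro integral_nonneg integrable_continuous_real continuous_on_mult cD) auto
  ultimately have "integral {0..2*pi} (\<lambda>\<theta>. D \<theta> * D \<theta>) = 0" by linarith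
  then have "\<forall>\<theta>\<in>{0..2*pi}. D \<theta> * D \<theta> = 0"
    by (subst (asm) integral_eq_0_iff) (auto intro!: continuous_on_mult cD)
  then have "D (Arg2pi z) = 0"
    using cis_Arg2pi[OF z] by simp
  then show ?thesis using cis_Arg2pi[OF z] by (simp add: D_def)
qed

lemma integral_cos_int: "integral {0..2*pi} (\<lambda>\<theta>. cos (of_int k * \<theta>)) = (if k = 0 then 2 * pi else 0)"
proof (cases "k = 0")
  case False
  have "((\<lambda>\<theta>. cos (of_int k * \<theta>)) has_integral (sin (of_int k * (2*pi)) / of_int k - sin (of_int k * 0) / of_int k)) {0..2*pi}"
    by (rule fundamental_theorem_of_calculus)
      (use False in \<open>auto intro!: derivative_eq_intros simp flip: has_real_derivative_iff_has_vector_derivative\<close>)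
  moreover have "sin (of_int k * (2*pi)) = 0"
    using sin_int_2pin[of k] by (simp add: mult_ac)
  ultimately show ?thesis using False by (simp add: integral_unique)
qed simp

lemma integral_sin_int: "integral {0..2*pi} (\<lambda>\<theta>. sin (of_int k * \<theta>)) = 0"
proof (cases "k = 0")
  case False
  have "((\<lambda>\<theta>. sin (of_int k * \<theta>)) has_integral (- cos (of_int k * (2*pi)) / of_int k - (- cos (of_int k * 0) / of_int k))) {0..2*pi}"
    by (rule fundamental_theorem_of_calculus)
      (use False in \<open>auto intro!: derivative_eq_intros simp flip: has_real_derivative_iff_has_vector_derivative\<close>)
  moreover have "cos (of_int k * (2*pi)) = 1"
    using cos_int_2pin[of k] by (simp add: mult_ac)
  ultimately show ?thesis using False by (simp add: integral_unique)
qed simp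

lemma trig_orthogonal:
  fixes n m :: nat
  shows "integral {0..2*pi} (\<lambda>\<theta>. cos (real n * \<theta>) * cos (real m * \<theta>)) =
      (if n = m then if n = 0 then 2 * pi else pi else 0)"
    and "integral {0..2*pi} (\<lambda>\<theta>. sin (real n * \<theta>) * sin (real m * \<theta>)) =
      (if n = m then if n = 0 then 0 else pi else 0)"
    and "integral {0..2*pi} (\<lambda>\<theta>. sin (real n * \<theta>) * cos (real m * \<theta>)) = 0"
proof -
  define p where "p = int n + int m"
  define q where "q = int n - int m"
  have ic: "(\<lambda>\<theta>. cos (of_int k * \<theta>) / 2) integrable_on {0..2*pi}" for k :: int
    by (intro integrable_continuous_real continuous_intros) auto
  have is': "(\<lambda>\<theta>. sin (of_int k * \<theta>) / 2) integrable_on {0..2*pi}" for k :: int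
    by (intro integrable_continuous_real continuous_intros) auto
  have c: "integral {0..2*pi} (\<lambda>\<theta>. cos (of_int k * \<theta>) / 2) = (if k = 0 then pi else 0)" for k :: int
    using integral_cos_int[of k] by simp
  have s: "integral {0..2*pi} (\<lambda>\<theta>. sin (of_int k * \<theta>) / 2) = 0" for k :: int
    using integral_sin_int[of k] by simp
  have eq0: "cos (real n * \<theta>) * cos (real m * \<theta>) = cos (of_int q * \<theta>) / 2 + cos (of_int p * \<theta>) / 2" for \<theta>
    by (simp add: p_def q_def cos_add cos_diff distrib_right left_diff_distrib add_divide_distrib diff_divide_distrib)
  show "integral {0..2*pi} (\<lambda>\<theta>. cos (real n * \<theta>) * cos (real m * \<theta>)) =
      (if n = m then if n = 0 then 2 * pi else pi else 0)"
    unfolding eq0 integral_add[OF ic[of q] ic[of p]] c by (auto simp: p_def q_def)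
  have eq1: "sin (real n * \<theta>) * sin (real m * \<theta>) = cos (of_int q * \<theta>) / 2 - cos (of_int p * \<theta>) / 2" for \<theta>
    by (simp add: p_def q_def cos_add cos_diff distrib_right left_diff_distrib add_divide_distrib diff_divide_distrib)
  show "integral {0..2*pi} (\<lambda>\<theta>. sin (real n * \<theta>) * sin (real m * \<theta>)) =
      (if n = m then if n = 0 then 0 else pi else 0)"
    unfolding eq1 integral_diff[OF ic[of q] ic[of p]] c by (auto simp: p_def q_def)
  have eq2: "sin (real n * \<theta>) * cos (real m * \<theta>) = sin (of_int p * \<theta>) / 2 + sin (of_int q * \<theta>) / 2" for \<theta>
    by (simp add: p_def q_def sin_add sin_diff distrib_right left_diff_distrib add_divide_distrib diff_divide_distrib)
  show "integral {0..2*pi} (\<lambda>\<theta>. sin (real n * \<theta>) * cos (real m * \<theta>)) = 0"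
    unfolding eq2 integral_add[OF is'[of p] is'[of q]] s by (auto simp: p_def q_def)
qed

text \<open>The reciprocal of the squared norm of \<open>cos (real n * \<theta>)\<close> over one
  period. For \<open>n > 0\<close> the sine has the same norm; for \<open>n = 0\<close> the sine
  term is 0.\<close>

definition fweight :: "nat \<Rightarrow> real" where
  "fweight n = (if n = 0 then 1 / (2 * pi) else 1 / pi)"

text \<open>Absolutely summable coefficients give a uniformly convergent series, whose sum is
  continuous and has the same coefficients as \<open>F\<close>. Completeness then forces equality.
  Powers of \<open>z\<close> make each term continuous on the circle without a choice of
  angle.\<close>

theorem fourier_series:
  fixes F :: "complex \<Rightarrow> real"
  assumes F: "continuous_on (sphere 0 1) F"
    and a: "\<And>n::nat. integral {0..2*pi} (\<lambda>\<theta>. F (cis \<theta>) * cos (real n * \<theta>)) = a n"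
    and b: "\<And>n::nat. integral {0..2*pi} (\<lambda>\<theta>. F (cis \<theta>) * sin (real n * \<theta>)) = b n"
    and sa: "summable (\<lambda>n. \<bar>a n\<bar>)" and sb: "summable (\<lambda>n. \<bar>b n\<bar>)" and z: "norm z = 1"
  shows "(\<lambda>n. fweight n * (a n * Re (z ^ n) + b n * Im (z ^ n))) sums F z"
proof -
  define f where "f = (\<lambda>n z. fweight n * (a n * Re (z ^ n) + b n * Im (z ^ n)))"
  define S where "S = (\<lambda>z. \<Sum>n. f n z)"
  have w: "0 < fweight n" "fweight n \<le> 1" for n
    using pi_gt3 by (auto simp: fweight_def)
  have bd: "norm (f n z) \<le> \<bar>a n\<bar> + \<bar>b n\<bar>" if "norm z = 1" for n z
  proof -
    have "\<bar>Re (z ^ n)\<bar> \<le> 1" "\<bar>Im (z ^ n)\<bar> \<le> 1"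
      using abs_Re_le_cmod[of "z ^ n"] abs_Im_le_cmod[of "z ^ n"] that by (auto simp: norm_power)
    then have "\<bar>a n\<bar> * \<bar>Re (z ^ n)\<bar> \<le> \<bar>a n\<bar> * 1" "\<bar>b n\<bar> * \<bar>Im (z ^ n)\<bar> \<le> \<bar>b n\<bar> * 1"
      by (intro mult_left_mono; simp)+
    then have "\<bar>a n * Re (z ^ n) + b n * Im (z ^ n)\<bar> \<le> \<bar>a n\<bar> + \<bar>b n\<bar>"
      using abs_triangle_ineq[of "a n * Re (z ^ n)" "b n * Im (z ^ n)"] by (simp add: abs_mult)
    then have "fweight n * \<bar>a n * Re (z ^ n) + b n * Im (z ^ n)\<bar> \<le> 1 * (\<bar>a n\<bar> + \<bar>b n\<bar>)"
      using w[of n] by (intro mult_mono) auto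
    then show ?thesis using w[of n] by (simp add: f_def abs_mult)
  qed
  have sM: "summable (\<lambda>n. \<bar>a n\<bar> + \<bar>b n\<bar>)" using sa sb by (rule summable_add)
  have ul: "uniform_limit (sphere 0 1) (\<lambda>N z. \<Sum>n<N. f n z) S sequentially"
    unfolding S_def by (rule Weierstrass_m_test[OF bd sM]) simp
  have cf: "continuous_on A (f n)" for n A
    unfolding f_def by (intro continuous_intros)
  have cS: "continuous_on (sphere 0 1) S"
    by (rule uniform_limit_theorem[OF _ ul]) (auto intro!: always_eventually continuous_intros cf)
  have fcis: "f n (cis \<theta>) = fweight n * (a n * cos (real n * \<theta>) + b n * sin (real n * \<theta>))" for n \<theta>
    by (simp add: f_def Complex.DeMoivre)
  have ccis: "continuous_on A (\<lambda>\<theta>. \<Sum>n<N. f n (cis \<theta>))" for A N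
    unfolding fcis by (intro continuous_intros)
  have ul': "uniform_limit {0..2*pi} (\<lambda>N \<theta>. (\<Sum>n<N. f n (cis \<theta>)) * t \<theta>) (\<lambda>\<theta>. S (cis \<theta>) * t \<theta>) sequentially"
    if t: "\<And>\<theta>. \<bar>t \<theta>\<bar> \<le> 1" for t :: "real \<Rightarrow> real"
  proof (rule uniform_limitI)
    fix e :: real assume "e > 0"
    from uniform_limitD[OF ul this]
    show "\<forall>\<^sub>F N in sequentially. \<forall>\<theta>\<in>{0..2*pi}. dist ((\<Sum>n<N. f n (cis \<theta>)) * t \<theta>) (S (cis \<theta>) * t \<theta>) < e"
    proof (rule eventually_mono, intro ballI)
      fix N \<theta> assume *: "\<forall>z\<in>sphere 0 1. dist (\<Sum>n<N. f n z) (S z) < e"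
      have "dist ((\<Sum>n<N. f n (cis \<theta>)) * t \<theta>) (S (cis \<theta>) * t \<theta>) = dist (\<Sum>n<N. f n (cis \<theta>)) (S (cis \<theta>)) * \<bar>t \<theta>\<bar>"
        by (simp add: dist_real_def left_diff_distrib[symmetric] abs_mult)
      also have "\<dots> \<le> dist (\<Sum>n<N. f n (cis \<theta>)) (S (cis \<theta>)) * 1"
        using t by (intro mult_left_mono) auto
      also have "\<dots> < e" using * by simp
      finally show "dist ((\<Sum>n<N. f n (cis \<theta>)) * t \<theta>) (S (cis \<theta>) * t \<theta>) < e" .
    qed
  qed
  \<comment> \<open>By orthogonality the coefficient of index \<open>m\<close> is the same for all
    partial sums with more than \<open>m\<close> terms, so it passes to the uniform limit.\<close>
  have lim: "integral {0..2*pi} (\<lambda>\<theta>. S (cis \<theta>) * t \<theta>) = L"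
    if t: "\<And>\<theta>. \<bar>t \<theta>\<bar> \<le> 1" "continuous_on {0..2*pi} t"
      and L: "\<And>N. N > m \<Longrightarrow> integral {0..2*pi} (\<lambda>\<theta>. (\<Sum>n<N. f n (cis \<theta>)) * t \<theta>) = L" for t L and m :: nat
  proof -
    have cc: "continuous_on {0..2*pi} (\<lambda>\<theta>. (\<Sum>n<N. f n (cis \<theta>)) * t \<theta>)" for N
      by (rule continuous_on_mult[OF ccis t(2)])
    obtain I J where IJ: "\<And>N. ((\<lambda>\<theta>. (\<Sum>n<N. f n (cis \<theta>)) * t \<theta>) has_integral I N) {0..2*pi}"
      "((\<lambda>\<theta>. S (cis \<theta>) * t \<theta>) has_integral J) {0..2*pi}" "(I \<longlongrightarrow> J) sequentially"
      by (rule uniform_limit_integral[OF ul'[OF t(1)] cc trivial_limit_sequentially]) blast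
    have "I N = L" if "N > m" for N
      using L[OF that] IJ(1)[of N] by (simp add: integral_unique)
    then have "eventually (\<lambda>N. I N = L) sequentially"
      by (intro eventually_mono[OF eventually_gt_at_top[of m]])
    then have "I \<longlonglongrightarrow> L" by (rule tendsto_eventually)
    then have "J = L" using IJ(3) LIMSEQ_unique by blast
    with IJ(2) show ?thesis by (simp add: integral_unique)
  qed
  have sum_int: "integral {0..2*pi} (\<lambda>\<theta>. (\<Sum>n<N. f n (cis \<theta>)) * t \<theta>) =
      (\<Sum>n<N. fweight n * (a n * integral {0..2*pi} (\<lambda>\<theta>. cos (real n * \<theta>) * t \<theta>) +
         b n * integral {0..2*pi} (\<lambda>\<theta>. sin (real n * \<theta>) * t \<theta>)))"
    if t: "continuous_on {0..2*pi} t" for t N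
  proof -
    have i: "(\<lambda>\<theta>. cos (real n * \<theta>) * t \<theta>) integrable_on {0..2*pi}"
      "(\<lambda>\<theta>. sin (real n * \<theta>) * t \<theta>) integrable_on {0..2*pi}" for n
      by (intro integrable_continuous_real continuous_intros t)+
    have "((\<lambda>\<theta>. \<Sum>n<N. fweight n * (a n * (cos (real n * \<theta>) * t \<theta>) + b n * (sin (real n * \<theta>) * t \<theta>))) has_integral
      (\<Sum>n<N. fweight n * (a n * integral {0..2*pi} (\<lambda>\<theta>. cos (real n * \<theta>) * t \<theta>) +
         b n * integral {0..2*pi} (\<lambda>\<theta>. sin (real n * \<theta>) * t \<theta>)))) {0..2*pi}"
      by (intro has_integral_sum has_integral_mult_right has_integral_add integrable_integral i) auto
    then show ?thesis
      unfolding fcis sum_distrib_right by (simp add: integral_unique algebra_simps)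
  qed
  have Sa: "integral {0..2*pi} (\<lambda>\<theta>. S (cis \<theta>) * cos (real m * \<theta>)) = a m" for m :: nat
  proof (rule lim[of _ m])
    fix N assume "N > m"
    have ct: "continuous_on {0..2*pi} (\<lambda>\<theta>. cos (real m * \<theta>))" by (intro continuous_intros)
    have "(\<Sum>n<N. fweight n * (a n * (if n = m then if n = 0 then 2 * pi else pi else 0) + b n * 0))
        = (\<Sum>n<N. if n = m then a m else 0)"
      by (intro sum.cong) (auto simp: fweight_def)
    then show "integral {0..2*pi} (\<lambda>\<theta>. (\<Sum>n<N. f n (cis \<theta>)) * cos (real m * \<theta>)) = a m"
      using \<open>N > m\<close> by (simp only: sum_int[OF ct] trig_orthogonal) simp
  qed (auto intro!: continuous_intros)
  have b0: "b 0 = 0" using b[of 0] by simp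
  have Sb: "integral {0..2*pi} (\<lambda>\<theta>. S (cis \<theta>) * sin (real m * \<theta>)) = b m" for m :: nat
  proof (rule lim[of _ m])
    fix N assume "N > m"
    have ct: "continuous_on {0..2*pi} (\<lambda>\<theta>. sin (real m * \<theta>))" by (intro continuous_intros)
    have o: "integral {0..2*pi} (\<lambda>\<theta>. cos (real n * \<theta>) * sin (real m * \<theta>)) = 0" for n
      using trig_orthogonal(3)[of m n] by (simp add: mult.commute)
    have "(\<Sum>n<N. fweight n * (a n * 0 + b n * (if n = m then if n = 0 then 0 else pi else 0)))
        = (\<Sum>n<N. if n = m then b m else 0)"
      using b0 by (intro sum.cong) (auto simp: fweight_def)
    then show "integral {0..2*pi} (\<lambda>\<theta>. (\<Sum>n<N. f n (cis \<theta>)) * sin (real m * \<theta>)) = b m"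
      using \<open>N > m\<close> by (simp only: sum_int[OF ct] trig_orthogonal o) simp
  qed (auto intro!: continuous_intros)
  have diff: "integral {0..2*pi} (\<lambda>\<theta>. (F (cis \<theta>) - S (cis \<theta>)) * t \<theta>) = 0"
    if "continuous_on {0..2*pi} t" and eq: "integral {0..2*pi} (\<lambda>\<theta>. F (cis \<theta>) * t \<theta>) = L"
      "integral {0..2*pi} (\<lambda>\<theta>. S (cis \<theta>) * t \<theta>) = L" for t L
  proof -
    have "(\<lambda>\<theta>. F (cis \<theta>) * t \<theta>) integrable_on {0..2*pi}" "(\<lambda>\<theta>. S (cis \<theta>) * t \<theta>) integrable_on {0..2*pi}"
      by (intro integrable_continuous_real continuous_on_mult that circle_continuous F cS)+
    from integral_diff[OF this] show ?thesis by (simp add: left_diff_distrib eq)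
  qed
  have "F z - S z = 0"
  proof (rule fourier_complete[OF _ _ _ z])
    show "continuous_on (sphere 0 1) (\<lambda>z. F z - S z)" by (intro continuous_intros F cS)
    show "integral {0..2*pi} (\<lambda>\<theta>. (F (cis \<theta>) - S (cis \<theta>)) * cos (real n * \<theta>)) = 0" for n
      by (rule diff[OF _ a Sa]) (intro continuous_intros)
    show "integral {0..2*pi} (\<lambda>\<theta>. (F (cis \<theta>) - S (cis \<theta>)) * sin (real n * \<theta>)) = 0" for n
      by (rule diff[OF _ b Sb]) (intro continuous_intros)
  qed
  moreover have "summable (\<lambda>n. f n z)"
    by (rule summable_comparison_test'[OF sM, of 0]) (rule bd[OF z])
  ultimately show ?thesis
    unfolding S_def f_def by (simp add: sums_iff)
qed

section \<open>Solutions of the Helmholtz equation are analytic\<close>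

lemma polar_pt: "polar r t = pt (r * cos t) (r * sin t)"
  by (simp add: polar_def pt_def)

lemma norm_polar [simp]: "norm (polar r t) = \<bar>r\<bar>"
proof -
  have "(r * cos t)\<^sup>2 + (r * sin t)\<^sup>2 = r\<^sup>2"
    by (simp add: power_mult_distrib flip: distrib_left)
  then show ?thesis by (simp add: norm_2 polar_pt)
qed

text \<open>The trace is the same in every orthonormal basis; the Laplacian can thus be read in the
  radial and tangential directions.\<close>

lemma trace_rotated:
  fixes L :: "real^2 \<Rightarrow> real^2"
  assumes "linear L"
  shows "L (pt (cos t) (sin t)) \<bullet> pt (cos t) (sin t) + L (pt (- sin t) (cos t)) \<bullet> pt (- sin t) (cos t)
    = L (axis 1 1) $ 1 + L (axis 2 1) $ 2"
proof -
  have *: "L (pt a b) = a *\<^sub>R L (axis 1 1) + b *\<^sub>R L (axis 2 1)" for a b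
    using linear_2[OF assms, of "pt a b"] by simp
  have "c * (c * p + s * q) + s * (c * r + s * w) + (s * (s * p - c * q) + c * (c * w - s * r)) =
      (c * c + s * s) * (p + w)" for c s p q r w :: real
    by algebra
  from this[of "cos t" "L (axis 1 1) $ 1" "sin t" "L (axis 2 1) $ 1" "L (axis 1 1) $ 2" "L (axis 2 1) $ 2"]
  show ?thesis
    unfolding * inner_2
    by (simp add: power2_eq_square[symmetric] del: power2_eq_square) (simp add: algebra_simps)
qed

text \<open>Green's second identity in polar coordinates. With \<open>G = r * g'\<close>, the
  conditions on \<open>e\<close>, \<open>g\<close>, \<open>G\<close> say that
  \<open>w = g(r) * e(t)\<close> solves the same Helmholtz equation by separation of variables. The
  two fields are \<open>r * (u w_r - w u_r)\<close> and \<open>(u w_t - w u_t) / r\<close>; their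
  divergence in the \<open>(r, t)\<close> plane is \<open>r * (u \<Delta>w - w \<Delta>u)\<close>,
  which is 0.\<close>

lemma radial_divergence_free:
  fixes u :: "real^2 \<Rightarrow> real" and Du :: "real^2 \<Rightarrow> real^2" and e e' g G :: "real \<Rightarrow> real"
    and x0 z :: "real^2" and D2u :: "real^2 \<Rightarrow> real^2"
  defines "P \<equiv> \<lambda>z::real^2. x0 + polar (z $ 1) (z $ 2)"
    and "\<nu> \<equiv> \<lambda>z::real^2. pt (cos (z $ 2)) (sin (z $ 2))"
    and "\<tau> \<equiv> \<lambda>z::real^2. pt (- sin (z $ 2)) (cos (z $ 2))"
  assumes u1: "(u has_derivative (\<lambda>h. Du (P z) \<bullet> h)) (at (P z))"
    and u2: "(Du has_derivative D2u) (at (P z))"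
    and hz: "D2u (axis 1 1) $ 1 + D2u (axis 2 1) $ 2 + \<mu> * u (P z) = 0"
    and e: "(e has_real_derivative e' (z $ 2)) (at (z $ 2))"
      "(e' has_real_derivative - (k * e (z $ 2))) (at (z $ 2))"
    and g: "(g has_real_derivative G (z $ 1) / (z $ 1)) (at (z $ 1))"
      "(G has_real_derivative (k / z $ 1 - \<mu> * z $ 1) * g (z $ 1)) (at (z $ 1))"
    and r: "z $ 1 > 0"
  obtains LA LB where
    "((\<lambda>z. (G (z $ 1) * u (P z) - z $ 1 * (g (z $ 1) * (Du (P z) \<bullet> \<nu> z))) * e (z $ 2)) has_derivative LA) (at z)"
    "((\<lambda>z. g (z $ 1) * (u (P z) * e' (z $ 2) / z $ 1 - (Du (P z) \<bullet> \<tau> z) * e (z $ 2))) has_derivative LB) (at z)"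
    "LA (axis 1 1) + LB (axis 2 1) = 0"
proof -
  have n1: "((\<lambda>z::real^2. z $ i) has_derivative (\<lambda>h. h $ i)) (at z)" for i
    by (rule bounded_linear.has_derivative[OF bounded_linear_vec_nth has_derivative_ident])
  have c2: "((\<lambda>z::real^2. cos (z $ 2)) has_derivative (\<lambda>h. - sin (z $ 2) * h $ 2)) (at z)"
    by (rule DERIV_compose_FDERIV[OF DERIV_cos n1, THEN has_derivative_eq_rhs]) (simp add: mult_ac fun_eq_iff)
  have s2: "((\<lambda>z::real^2. sin (z $ 2)) has_derivative (\<lambda>h. cos (z $ 2) * h $ 2)) (at z)"
    by (rule DERIV_compose_FDERIV[OF DERIV_sin n1, THEN has_derivative_eq_rhs]) (simp add: mult_ac fun_eq_iff)
  have \<nu>': "(\<nu> has_derivative (\<lambda>h. h $ 2 *\<^sub>R \<tau> z)) (at z)"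
    unfolding \<nu>_def \<tau>_def
    by (rule has_derivative_pt[OF c2 s2, THEN has_derivative_eq_rhs]) (simp add: pt_arith mult_ac fun_eq_iff)
  have \<tau>': "(\<tau> has_derivative (\<lambda>h. - (h $ 2 *\<^sub>R \<nu> z))) (at z)"
    unfolding \<nu>_def \<tau>_def
    by (rule has_derivative_pt[OF has_derivative_minus[OF s2] c2, THEN has_derivative_eq_rhs])
      (simp add: vec_eq_iff forall_2 mult_ac fun_eq_iff)
  have P': "(P has_derivative (\<lambda>h. h $ 1 *\<^sub>R \<nu> z + h $ 2 *\<^sub>R (z $ 1 *\<^sub>R \<tau> z))) (at z)"
    unfolding P_def polar_pt \<nu>_def \<tau>_def
    by (rule has_derivative_add[OF has_derivative_const has_derivative_pt[OF
          has_derivative_mult[OF n1 c2] has_derivative_mult[OF n1 s2]], THEN has_derivative_eq_rhs])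
      (simp add: vec_eq_iff forall_2 algebra_simps fun_eq_iff)
  have lin: "linear D2u" using u2 by (rule has_derivative_linear)
  define Q where "Q = (\<lambda>h::real^2. h $ 1 *\<^sub>R \<nu> z + h $ 2 *\<^sub>R (z $ 1 *\<^sub>R \<tau> z))"
  have Q: "(P has_derivative Q) (at z)" using P' by (simp add: Q_def)
  have U: "((\<lambda>z. u (P z)) has_derivative (\<lambda>h. Du (P z) \<bullet> Q h)) (at z)"
    using has_derivative_compose[OF Q u1] by simp
  have DuP: "((\<lambda>z. Du (P z)) has_derivative (\<lambda>h. D2u (Q h))) (at z)"
    using has_derivative_compose[OF Q u2] by simp
  note V = has_derivative_inner[OF DuP \<nu>'] and W = has_derivative_inner[OF DuP \<tau>']
  have G': "((\<lambda>z. G (z $ 1)) has_derivative (\<lambda>h. (k / z $ 1 - \<mu> * z $ 1) * g (z $ 1) * h $ 1)) (at z)"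
    by (rule DERIV_compose_FDERIV[OF g(2) n1, THEN has_derivative_eq_rhs]) (simp add: mult_ac fun_eq_iff)
  have g': "((\<lambda>z. g (z $ 1)) has_derivative (\<lambda>h. G (z $ 1) / z $ 1 * h $ 1)) (at z)"
    by (rule DERIV_compose_FDERIV[OF g(1) n1, THEN has_derivative_eq_rhs]) (simp add: mult_ac fun_eq_iff)
  have e1: "((\<lambda>z. e (z $ 2)) has_derivative (\<lambda>h. e' (z $ 2) * h $ 2)) (at z)"
    by (rule DERIV_compose_FDERIV[OF e(1) n1, THEN has_derivative_eq_rhs]) (simp add: mult_ac fun_eq_iff)
  have e2: "((\<lambda>z. e' (z $ 2)) has_derivative (\<lambda>h. - (k * e (z $ 2)) * h $ 2)) (at z)"
    by (rule DERIV_compose_FDERIV[OF e(2) n1, THEN has_derivative_eq_rhs]) (simp add: mult_ac fun_eq_iff)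
  have r0: "z $ 1 \<noteq> 0" using r by simp
  note LA = has_derivative_mult[OF has_derivative_diff[OF has_derivative_mult[OF G' U]
        has_derivative_mult[OF n1[of 1] has_derivative_mult[OF g' V]]] e1]
  note LB = has_derivative_mult[OF g' has_derivative_diff[OF
        has_derivative_divide[OF has_derivative_mult[OF U e2] n1[of 1] r0] has_derivative_mult[OF W e1]]]
  have Q1: "Q (axis 1 1) = \<nu> z" and Q2: "Q (axis 2 1) = z $ 1 *\<^sub>R \<tau> z"
    by (simp_all add: Q_def axis_def)
  have tr: "D2u (\<nu> z) \<bullet> \<nu> z + D2u (\<tau> z) \<bullet> \<tau> z = - \<mu> * u (P z)"
    using trace_rotated[OF lin, of "z $ 2"] hz by (simp add: \<nu>_def \<tau>_def)
  define R where "R = z $ 1"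
  have R: "R \<noteq> 0" using r0 by (simp add: R_def)
  \<comment> \<open>Second derivatives of \<open>u\<close> enter only through \<open>x\<close> and
    \<open>y\<close>, the radial and tangential diagonal entries, whose sum is
    \<open>- \<mu> * p\<close>. Mixed entries do not occur, so no symmetry of \<open>D2u\<close> is
    presupposed.\<close>
  have alg: "(G' * p + a * V - (R * (gg * x + a / R * V) + gg * V)) * ee
      + gg * ((p * - (k * ee) + R * W * ee') / R - (W * ee' + (R * y - V) * ee)) = 0"
    if "G' = (k / R - \<mu> * R) * gg" "x = - \<mu> * p - y" for G' p a V W gg x ee ee' y
    using R unfolding that by (simp add: field_simps)
  have ax: "axis 1 (1::real) $ (1::2) = 1" "axis 1 (1::real) $ (2::2) = 0"
    "axis 2 (1::real) $ (1::2) = 0" "axis 2 (1::real) $ (2::2) = 1"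
    by (simp_all add: axis_def)
  have x: "D2u (\<nu> z) \<bullet> \<nu> z = - \<mu> * u (P z) - D2u (\<tau> z) \<bullet> \<tau> z" using tr by simp
  show thesis
    by (rule that[OF LA LB], unfold Q1 Q2 ax linear_scale[OF lin] R_def[symmetric])
      (use R alg[OF refl x, where a = "G R" and V = "Du (P z) \<bullet> \<nu> z" and gg = "g R" and ee = "e (z $ 2)"
          and W = "Du (P z) \<bullet> \<tau> z" and ee' = "e' (z $ 2)"]
        in \<open>simp add: algebra_simps\<close>)
qed

lemma continuous_on_polar [continuous_intros]:
  fixes f g :: "'a::t2_space \<Rightarrow> real"
  shows "continuous_on S f \<Longrightarrow> continuous_on S g \<Longrightarrow> continuous_on S (\<lambda>x. polar (f x) (g x))"
  unfolding polar_pt by (intro continuous_intros)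

lemma polar_periodic [simp]: "polar r (2 * pi) = polar r 0"
  by (simp add: polar_pt)

text \<open>The Wronskian of a Fourier coefficient of \<open>u\<close> and of a regular radial solution \<open>g\<close> is a flux through the
  circle of radius \<open>r\<close>, hence constant, hence zero.\<close>

theorem radial_coefficient:
  fixes u :: "real^2 \<Rightarrow> real" and Du :: "real^2 \<Rightarrow> real^2" and e e' g G :: "real \<Rightarrow> real"
    and x0 :: "real^2" and D2u :: "real^2 \<Rightarrow> real^2 \<Rightarrow> real^2"
  assumes u1: "\<And>x. x \<in> ball x0 \<rho> \<Longrightarrow> (u has_derivative (\<lambda>h. Du x \<bullet> h)) (at x)"
    and u2: "\<And>x. x \<in> ball x0 \<rho> \<Longrightarrow> (Du has_derivative D2u x) (at x)"
    and hz: "\<And>x. x \<in> ball x0 \<rho> \<Longrightarrow> D2u x (axis 1 1) $ 1 + D2u x (axis 2 1) $ 2 + \<mu> * u x = 0"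
    and e: "\<And>t. (e has_real_derivative e' t) (at t)" "\<And>t. (e' has_real_derivative - (k * e t)) (at t)"
      "e (2 * pi) = e 0" "e' (2 * pi) = e' 0"
    and g: "\<And>r. 0 < r \<Longrightarrow> r < \<rho> \<Longrightarrow> (g has_real_derivative G r / r) (at r)"
      "\<And>r. 0 < r \<Longrightarrow> r < \<rho> \<Longrightarrow> (G has_real_derivative (k / r - \<mu> * r) * g r) (at r)"
      "\<And>r. 0 < r \<Longrightarrow> r < \<rho> \<Longrightarrow> g r > 0"
    and lim: "(G \<longlongrightarrow> 0) (at_right 0)" "((\<lambda>r. r * g r) \<longlongrightarrow> 0) (at_right 0)"
    and "\<rho> > 0"
  shows "\<exists>K. \<forall>r. 0 < r \<longrightarrow> r < \<rho> \<longrightarrow> integral {0..2*pi} (\<lambda>t. u (x0 + polar r t) * e t) = K * g r"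
proof -
  define U where "U = (\<lambda>r t. u (x0 + polar r t))"
  define V where "V = (\<lambda>r t. Du (x0 + polar r t) \<bullet> pt (cos t) (sin t))"
  define \<Phi> where "\<Phi> = (\<lambda>r. integral {0..2*pi} (\<lambda>t. (G r * U r t - r * (g r * V r t)) * e t))"
  have cu: "continuous_on (ball x0 \<rho>) u" and cDu: "continuous_on (ball x0 \<rho>) Du"
    using u1 u2 by (meson has_derivative_at_withinI has_derivative_continuous_on)+
  have ce: "continuous_on S e" for S
    using e(1) by (meson DERIV_isCont continuous_at_imp_continuous_on)
  have inb: "x0 + polar r t \<in> ball x0 \<rho>" if "\<bar>r\<bar> < \<rho>" for r t
    using that by (simp add: dist_norm)
  have cU: "continuous_on S (\<lambda>t. U r t)" and cV: "continuous_on S (\<lambda>t. V r t)" if "\<bar>r\<bar> < \<rho>" for r S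
    unfolding U_def V_def using inb[OF that]
    by (auto intro!: continuous_intros continuous_on_compose2[OF cu] continuous_on_compose2[OF cDu])
  have \<Phi>_const: "\<Phi> r1 = \<Phi> r0" if r: "0 < r0" "r0 \<le> r1" "r1 < \<rho>" for r0 r1
  proof -
    let ?Q = "cbox (pt r0 0) (pt r1 (2 * pi))"
    let ?P = "\<lambda>z::real^2. x0 + polar (z $ 1) (z $ 2)"
    define A where "A = (\<lambda>z::real^2. (G (z $ 1) * u (?P z) - z $ 1 * (g (z $ 1) * (Du (?P z) \<bullet> pt (cos (z $ 2)) (sin (z $ 2))))) * e (z $ 2))"
    define B where "B = (\<lambda>z::real^2. g (z $ 1) * (u (?P z) * e' (z $ 2) / z $ 1 - (Du (?P z) \<bullet> pt (- sin (z $ 2)) (cos (z $ 2))) * e (z $ 2)))"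
    have "\<exists>LA LB. (A has_derivative LA) (at z) \<and> (B has_derivative LB) (at z) \<and> LA (axis 1 1) + LB (axis 2 1) = 0"
      if "z \<in> ?Q" for z
    proof -
      have z: "0 < z $ 1" "z $ 1 < \<rho>" using that r by (auto simp: cbox_2)
      then have zb: "?P z \<in> ball x0 \<rho>" by (intro inb) auto
      obtain LA LB where "(A has_derivative LA) (at z)" "(B has_derivative LB) (at z)" "LA (axis 1 1) + LB (axis 2 1) = 0"
        using radial_divergence_free[OF u1[OF zb] u2[OF zb] hz[OF zb] e(1,2) g(1,2)[OF z] z(1)]
        unfolding A_def B_def by blast
      then show ?thesis by blast
    qed
    then obtain LA LB where L: "\<And>z. z \<in> ?Q \<Longrightarrow> (A has_derivative LA z) (at z)"
      "\<And>z. z \<in> ?Q \<Longrightarrow> (B has_derivative LB z) (at z)"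
      "\<And>z. z \<in> ?Q \<Longrightarrow> LA z (axis 1 1) + LB z (axis 2 1) = 0"
      by metis
    have "defect A B (\<lambda>_. 0) r0 r1 0 (2 * pi) = 0"
      by (rule divergence_rectangle[where A' = LA and B' = LB])
        (use L r in \<open>auto intro: has_derivative_at_withinI\<close>)
    \<comment> \<open>The sides at angles 0 and 2 pi cancel by periodicity, so only the fluxes
      through the two circles remain.\<close>
    moreover have "B (pt x (2 * pi)) = B (pt x 0)" for x
      by (simp add: B_def e)
    ultimately have "integral {0..2*pi} (\<lambda>y. A (pt r1 y) - A (pt r0 y)) = 0"
      by (simp add: defect_def)
    moreover have i: "(\<lambda>y. A (pt r' y)) integrable_on {0..2*pi}" if "\<bar>r'\<bar> < \<rho>" for r'
    proof -
      have "A (pt r' y) = (G r' * U r' y - r' * (g r' * V r' y)) * e y" for y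
        by (simp add: A_def U_def V_def)
      then show ?thesis
        by (simp only:) (intro integrable_continuous_real continuous_intros ce cU cV that)
    qed
    ultimately have "integral {0..2*pi} (\<lambda>y. A (pt r1 y)) = integral {0..2*pi} (\<lambda>y. A (pt r0 y))"
      using r integral_diff[OF i[of r1] i[of r0]] by simp
    then show ?thesis by (simp add: \<Phi>_def A_def U_def V_def)
  qed
  \<comment> \<open>The bounds reach down to the centre because \<open>polar\<close> is continuous
    through \<open>r = 0\<close>. Together with the limits of \<open>G\<close> and
    \<open>r * g r\<close> they show that the constant \<Phi> tends to 0 at the centre.\<close>
  obtain M where M: "M > 0" "\<And>r t. \<bar>r\<bar> \<le> \<rho> / 2 \<Longrightarrow> t \<in> {0..2*pi} \<Longrightarrow> \<bar>U r t * e t\<bar> \<le> M"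
    "\<And>r t. \<bar>r\<bar> \<le> \<rho> / 2 \<Longrightarrow> t \<in> {0..2*pi} \<Longrightarrow> \<bar>V r t * e t\<bar> \<le> M"
  proof -
    have K: "compact ({- \<rho>/2..\<rho>/2} \<times> {0..2*pi})" by (intro compact_Times) auto
    have cuv: "continuous_on ({- \<rho>/2..\<rho>/2} \<times> {0..2*pi}) (\<lambda>(r, t). U r t * e t)"
      "continuous_on ({- \<rho>/2..\<rho>/2} \<times> {0..2*pi}) (\<lambda>(r, t). V r t * e t)"
      unfolding U_def V_def case_prod_unfold using \<open>\<rho> > 0\<close>
      by (auto intro!: continuous_intros continuous_on_compose2[OF cu] continuous_on_compose2[OF cDu]
          continuous_on_compose2[OF ce[of UNIV]] simp: dist_norm)
    have "bounded ((\<lambda>(r, t). U r t * e t) ` ({- \<rho>/2..\<rho>/2} \<times> {0..2*pi}))"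
      "bounded ((\<lambda>(r, t). V r t * e t) ` ({- \<rho>/2..\<rho>/2} \<times> {0..2*pi}))"
      by (intro compact_imp_bounded compact_continuous_image cuv K)+
    then obtain M1 M2 where M12: "M1 > 0" "M2 > 0"
      "\<forall>x\<in>(\<lambda>(r, t). U r t * e t) ` ({- \<rho>/2..\<rho>/2} \<times> {0..2*pi}). norm x \<le> M1"
      "\<forall>x\<in>(\<lambda>(r, t). V r t * e t) ` ({- \<rho>/2..\<rho>/2} \<times> {0..2*pi}). norm x \<le> M2"
      unfolding bounded_pos by blast
    have "\<bar>U r t * e t\<bar> \<le> M1 + M2" "\<bar>V r t * e t\<bar> \<le> M1 + M2"
      if "\<bar>r\<bar> \<le> \<rho> / 2" "t \<in> {0..2*pi}" for r t
    proof -
      have "(r, t) \<in> {- \<rho>/2..\<rho>/2} \<times> {0..2*pi}" using that by auto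
      then have "\<bar>U r t * e t\<bar> \<le> M1" "\<bar>V r t * e t\<bar> \<le> M2"
        using M12(3)[rule_format, OF imageI] M12(4)[rule_format, OF imageI] by fastforce+
      then show "\<bar>U r t * e t\<bar> \<le> M1 + M2" "\<bar>V r t * e t\<bar> \<le> M1 + M2"
        using M12(1,2) by linarith+
    qed
    with M12(1,2) show thesis by (intro that[of "M1 + M2"]) auto
  qed
  have \<Phi>_0: "\<Phi> r = 0" if r: "0 < r" "r < \<rho>" for r
  proof -
    have bound: "\<bar>\<Phi> s\<bar> \<le> (\<bar>G s\<bar> + \<bar>s * g s\<bar>) * M * (2 * pi - 0)" if s: "0 < s" "s \<le> \<rho> / 2" for s
      unfolding \<Phi>_def
    proof (rule integral_abs_bound_1)
      have "\<bar>s\<bar> < \<rho>" using s \<open>\<rho> > 0\<close> by simp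
      then show "continuous_on {0..2*pi} (\<lambda>t. (G s * U s t - s * (g s * V s t)) * e t)"
        by (intro continuous_intros cU cV ce)
      fix t :: real assume t: "0 \<le> t" "t \<le> 2 * pi"
      have "(G s * U s t - s * (g s * V s t)) * e t = G s * (U s t * e t) - (s * g s) * (V s t * e t)"
        by (simp add: algebra_simps)
      also have "\<bar>\<dots>\<bar> \<le> \<bar>G s\<bar> * \<bar>U s t * e t\<bar> + \<bar>s * g s\<bar> * \<bar>V s t * e t\<bar>"
        by (simp flip: abs_mult)
      also have "\<dots> \<le> \<bar>G s\<bar> * M + \<bar>s * g s\<bar> * M"
        using M(2,3)[of s t] s t by (intro add_mono mult_left_mono) auto
      finally show "\<bar>(G s * U s t - s * (g s * V s t)) * e t\<bar> \<le> (\<bar>G s\<bar> + \<bar>s * g s\<bar>) * M"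
        by (simp add: distrib_right)
    qed (use M(1) in auto)
    have "((\<lambda>s. (\<bar>G s\<bar> + \<bar>s * g s\<bar>) * M * (2 * pi - 0)) \<longlongrightarrow> (\<bar>0\<bar> + \<bar>0\<bar>) * M * (2 * pi - 0)) (at_right 0)"
      by (intro tendsto_intros lim)
    moreover have "eventually (\<lambda>s. \<bar>\<Phi> r\<bar> \<le> (\<bar>G s\<bar> + \<bar>s * g s\<bar>) * M * (2 * pi - 0)) (at_right 0)"
    proof -
      have "eventually (\<lambda>s. s \<in> {0<..<min r (\<rho> / 2)}) (at_right 0)"
        using r by (intro eventually_at_right_real) auto
      then show ?thesis
      proof eventually_elim
        case (elim s)
        then show ?case using bound[of s] \<Phi>_const[of s r] r by auto
      qed
    qed
    ultimately have "\<bar>\<Phi> r\<bar> \<le> (\<bar>0\<bar> + \<bar>0\<bar>) * M * (2 * pi - 0)"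
      by (intro tendsto_lowerbound) auto
    then show ?thesis by simp
  qed
  define c where "c = (\<lambda>r. integral {0..2*pi} (\<lambda>t. U r t * e t))"
  define c' where "c' = (\<lambda>r. integral {0..2*pi} (\<lambda>t. V r t * e t))"
  have c_deriv: "(c has_real_derivative c' r) (at r)" if r: "0 < r" "r < \<rho>" for r
  proof -
    have "(c has_real_derivative c' r) (at r within {0<..<\<rho>})"
      unfolding c_def c'_def cbox_interval[symmetric]
    proof (rule leibniz_rule_field_derivative)
      fix s t assume s: "s \<in> {0<..<\<rho>}"
      have "((\<lambda>s. polar s t) has_derivative (\<lambda>h. pt (h * cos t) (h * sin t))) (at s within {0<..<\<rho>})"
        unfolding polar_pt by (auto intro!: derivative_eq_intros)
      then have P: "((\<lambda>s. x0 + polar s t) has_derivative (\<lambda>h. pt (h * cos t) (h * sin t))) (at s within {0<..<\<rho>})"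
        using has_derivative_add[OF has_derivative_const] by fastforce
      have "((\<lambda>s. U s t) has_derivative (\<lambda>h. Du (x0 + polar s t) \<bullet> pt (h * cos t) (h * sin t))) (at s within {0<..<\<rho>})"
        unfolding U_def using s by (intro has_derivative_compose[OF P u1] inb) auto
      moreover have "Du (x0 + polar s t) \<bullet> pt (h * cos t) (h * sin t) = V s t * h" for h
        by (simp add: V_def inner_2 algebra_simps)
      ultimately have "((\<lambda>s. U s t) has_real_derivative V s t) (at s within {0<..<\<rho>})"
        by (simp add: has_field_derivative_def)
      then show "((\<lambda>s. U s t * e t) has_real_derivative V s t * e t) (at s within {0<..<\<rho>})"
        by (rule DERIV_cmult_right)
    next
      fix s assume "s \<in> {0<..<\<rho>}"
      then show "(\<lambda>t. U s t * e t) integrable_on cbox 0 (2 * pi)"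
        by (intro integrable_continuous continuous_intros cU ce) auto
    next
      show "continuous_on ({0<..<\<rho>} \<times> cbox 0 (2 * pi)) (\<lambda>(s, t). V s t * e t)"
        unfolding V_def case_prod_unfold
        by (auto intro!: continuous_intros continuous_on_compose2[OF cDu]
            continuous_on_compose2[OF ce[of UNIV]] simp: dist_norm)
    qed (use r in auto)
    moreover have "at r within {0<..<\<rho>} = at r" by (rule at_within_open) (use r in auto)
    ultimately show ?thesis by simp
  qed
  have wronskian: "G r * c r = r * g r * c' r" if r: "0 < r" "r < \<rho>" for r
  proof -
    have i: "(\<lambda>t. U r t * e t) integrable_on {0..2*pi}" "(\<lambda>t. V r t * e t) integrable_on {0..2*pi}"
      using r by (auto intro!: integrable_continuous_real continuous_on_mult cU cV ce)
    have "\<Phi> r = integral {0..2*pi} (\<lambda>t. G r * (U r t * e t) - (r * g r) * (V r t * e t))"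
      unfolding \<Phi>_def by (simp add: algebra_simps)
    also have "\<dots> = G r * c r - r * g r * c' r"
      unfolding c_def c'_def
      using integral_diff[OF integrable_on_mult_right[OF i(1), of "G r"] integrable_on_mult_right[OF i(2), of "r * g r"]]
      by simp
    finally show ?thesis using \<Phi>_0[OF r] by simp
  qed
  \<comment> \<open>Since \<open>G r / r\<close> is the derivative of \<open>g\<close>, the
    vanishing Wronskian says exactly that the quotient \<open>c / g\<close> has derivative
    0.\<close>
  have "\<exists>K. \<forall>r\<in>{0<..<\<rho>}. c r / g r = K"
  proof (rule has_field_derivative_zero_constant)
    fix r assume "r \<in> {0<..<\<rho>}"
    then have r: "0 < r" "r < \<rho>" by auto
    have "((\<lambda>r. c r / g r) has_real_derivative (c' r * g r - c r * (G r / r)) / (g r * g r)) (at r)"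
      using g(3)[OF r] by (intro DERIV_divide c_deriv g(1) r) auto
    moreover have "c' r * g r - c r * (G r / r) = 0"
      using wronskian[OF r] r(1) by (simp add: field_simps)
    ultimately show "((\<lambda>r. c r / g r) has_real_derivative 0) (at r within {0<..<\<rho>})"
      by (simp add: has_field_derivative_at_within)
  qed simp
  then obtain K where K: "\<And>r. r \<in> {0<..<\<rho>} \<Longrightarrow> c r / g r = K" by auto
  have "c r = K * g r" if "0 < r" "r < \<rho>" for r
    using K[of r] g(3)[OF that] that by (auto simp: divide_eq_eq)
  then show ?thesis by (auto simp: c_def U_def)
qed

text \<open>\<open>r ^ n * bessel \<mu> n (r\<^sup>2)\<close> is, up to normalization, the Bessel function \<open>J\<^sub>n (sqrt \<mu> * r)\<close>.\<close>

definition bcoeff :: "real \<Rightarrow> nat \<Rightarrow> nat \<Rightarrow> real" where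
  "bcoeff \<mu> n k = (- \<mu> / 4) ^ k * fact n / (fact k * fact (n + k))"

definition bessel :: "real \<Rightarrow> nat \<Rightarrow> real \<Rightarrow> real" where
  "bessel \<mu> n t = (\<Sum>k. bcoeff \<mu> n k * t ^ k)"

definition bessel1 :: "real \<Rightarrow> nat \<Rightarrow> real \<Rightarrow> real" where
  "bessel1 \<mu> n t = (\<Sum>k. diffs (bcoeff \<mu> n) k * t ^ k)"

definition bessel2 :: "real \<Rightarrow> nat \<Rightarrow> real \<Rightarrow> real" where
  "bessel2 \<mu> n t = (\<Sum>k. diffs (diffs (bcoeff \<mu> n)) k * t ^ k)"

lemma abs_bcoeff_le: "\<bar>bcoeff \<mu> n k\<bar> \<le> (\<bar>\<mu>\<bar> / 4) ^ k / fact k"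
proof -
  have "(fact n :: real) / fact (n + k) \<le> 1"
    by (simp add: fact_mono)
  then have "((\<bar>\<mu>\<bar> / 4) ^ k / fact k) * (fact n / fact (n + k)) \<le> ((\<bar>\<mu>\<bar> / 4) ^ k / fact k) * 1"
    by (intro mult_left_mono) auto
  then show ?thesis
    by (simp add: bcoeff_def abs_mult power_abs abs_divide)
qed

lemma bcoeff_term_le: "\<bar>bcoeff \<mu> n k * t ^ k\<bar> \<le> (\<bar>\<mu>\<bar> / 4 * \<bar>t\<bar>) ^ k / fact k"
proof -
  have "\<bar>bcoeff \<mu> n k\<bar> * \<bar>t\<bar> ^ k \<le> (\<bar>\<mu>\<bar> / 4) ^ k / fact k * \<bar>t\<bar> ^ k"
    by (intro mult_right_mono abs_bcoeff_le) auto
  also have "\<dots> = (\<bar>\<mu>\<bar> / 4) ^ k * \<bar>t\<bar> ^ k / fact k" by simp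
  also have "\<dots> = (\<bar>\<mu>\<bar> / 4 * \<bar>t\<bar>) ^ k / fact k" by (simp only: power_mult_distrib)
  finally show ?thesis by (simp only: abs_mult power_abs)
qed

lemma exp_sums_real: "(\<lambda>k. (x::real) ^ k / fact k) sums exp x"
  using exp_converges[of x] by (simp add: divide_inverse mult.commute)

lemma bcoeff_summable: "summable (\<lambda>k. bcoeff \<mu> n k * t ^ k)"
  by (rule summable_comparison_test'[OF sums_summable[OF exp_sums_real[of "\<bar>\<mu>\<bar> / 4 * \<bar>t\<bar>"]], of 0])
    (use bcoeff_term_le in simp)

lemma bessel_sums: "(\<lambda>k. bcoeff \<mu> n k * t ^ k) sums bessel \<mu> n t"
  unfolding bessel_def by (rule summable_sums[OF bcoeff_summable])

lemma bessel_deriv: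
  "(bessel \<mu> n has_real_derivative bessel1 \<mu> n t) (at t)"
  "(bessel1 \<mu> n has_real_derivative bessel2 \<mu> n t) (at t)"
proof -
  show "(bessel \<mu> n has_real_derivative bessel1 \<mu> n t) (at t)"
    unfolding bessel_def[abs_def] bessel1_def
    by (rule termdiffs_strong_converges_everywhere[OF bcoeff_summable])
  have s: "summable (\<lambda>k. diffs (bcoeff \<mu> n) k * y ^ k)" for y
    by (rule termdiff_converges_all[OF bcoeff_summable])
  show "(bessel1 \<mu> n has_real_derivative bessel2 \<mu> n t) (at t)"
    unfolding bessel1_def[abs_def] bessel2_def
    by (rule termdiffs_strong_converges_everywhere[OF s])
qed

lemma bcoeff_rec: "real (Suc k) * real (Suc (n + k)) * bcoeff \<mu> n (Suc k) = - \<mu> / 4 * bcoeff \<mu> n k"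
proof -
  have "fact (Suc k) = real (Suc k) * fact k" "fact (n + Suc k) = real (Suc (n + k)) * (fact (n + k) :: real)"
    by simp_all
  then show ?thesis
    unfolding bcoeff_def by (simp add: divide_simps del: of_nat_Suc fact_Suc)
qed

text \<open>Bessel's equation after splitting off \<open>r ^ n\<close> and substituting
  \<open>t = r\<^sup>2\<close>; coefficientwise it is the two-term recursion
  \<open>bcoeff_rec\<close>.\<close>

lemma bessel_ode: "t * bessel2 \<mu> n t + real (Suc n) * bessel1 \<mu> n t + \<mu> / 4 * bessel \<mu> n t = 0"
proof -
  let ?c = "bcoeff \<mu> n"
  have s1: "summable (\<lambda>k. diffs ?c k * y ^ k)" for y
    by (rule termdiff_converges_all[OF bcoeff_summable])
  have s2: "summable (\<lambda>k. diffs (diffs ?c) k * y ^ k)" for y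
    by (rule termdiff_converges_all[OF s1])
  have "(\<lambda>k. diffs (diffs ?c) k * t ^ k) sums bessel2 \<mu> n t"
    unfolding bessel2_def by (rule summable_sums[OF s2])
  then have "(\<lambda>k. t * (diffs (diffs ?c) k * t ^ k)) sums (t * bessel2 \<mu> n t)"
    by (rule sums_mult)
  then have "(\<lambda>k. real (Suc k) * diffs ?c (Suc k) * t ^ Suc k) sums (t * bessel2 \<mu> n t)"
    by (simp add: diffs_def mult_ac del: of_nat_Suc)
  \<comment> \<open>The index shift is free: the term for \<open>k = 0\<close> carries the factor
    0.\<close>
  then have 2: "(\<lambda>k. real k * diffs ?c k * t ^ k) sums (t * bessel2 \<mu> n t)"
    by (subst (asm) sums_Suc_iff) simp
  have 1: "(\<lambda>k. real (Suc n) * (diffs ?c k * t ^ k)) sums (real (Suc n) * bessel1 \<mu> n t)"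
    unfolding bessel1_def by (intro sums_mult summable_sums s1)
  have 0: "(\<lambda>k. \<mu> / 4 * (?c k * t ^ k)) sums (\<mu> / 4 * bessel \<mu> n t)"
    by (intro sums_mult bessel_sums)
  have "real k * diffs ?c k * t ^ k + real (Suc n) * (diffs ?c k * t ^ k) + \<mu> / 4 * (?c k * t ^ k) = 0" for k
  proof -
    have "real k * diffs ?c k + real (Suc n) * diffs ?c k + \<mu> / 4 * ?c k
      = real (Suc k) * real (Suc (n + k)) * ?c (Suc k) + \<mu> / 4 * ?c k"
      by (simp add: diffs_def algebra_simps)
    also have "\<dots> = 0" unfolding bcoeff_rec by simp
    finally have "(real k * diffs ?c k + real (Suc n) * diffs ?c k + \<mu> / 4 * ?c k) * t ^ k = 0" by simp
    then show ?thesis by (simp add: algebra_simps)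
  qed
  with sums_add[OF sums_add[OF 2 1] 0] have "(\<lambda>k. 0) sums (t * bessel2 \<mu> n t + real (Suc n) * bessel1 \<mu> n t + \<mu> / 4 * bessel \<mu> n t)"
    by simp
  then show ?thesis using sums_zero sums_unique2 by blast
qed

text \<open>The constant term is 1 and the others are dominated by the terms of
  \<open>exp x - 1\<close>, which is at most 1/2 for \<open>x\<close> up to
  \<open>ln (3 / 2)\<close>. The bounds are uniform in \<open>n\<close>; the coefficient estimates
  depend on this.\<close>

lemma bessel_near_1:
  assumes "\<bar>\<mu>\<bar> / 4 * \<bar>t\<bar> \<le> ln (3 / 2)"
  shows "1 / 2 \<le> bessel \<mu> n t" "bessel \<mu> n t \<le> 3 / 2"
proof -
  have 1: "(\<lambda>k. if k = 0 then 1 else 0 :: real) sums 1"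
    using sums_single[of 0 "\<lambda>_. 1 :: real"] by simp
  have "norm (bessel \<mu> n t - 1) \<le> exp (\<bar>\<mu>\<bar> / 4 * \<bar>t\<bar>) - 1"
  proof (rule norm_sums_le[OF sums_diff[OF bessel_sums 1] sums_diff[OF exp_sums_real 1]])
    show "norm (bcoeff \<mu> n k * t ^ k - (if k = 0 then 1 else 0)) \<le>
        (\<bar>\<mu>\<bar> / 4 * \<bar>t\<bar>) ^ k / fact k - (if k = 0 then 1 else 0)" for k
      using bcoeff_term_le[of \<mu> n k t] by (auto simp: bcoeff_def)
  qed
  also have "exp (\<bar>\<mu>\<bar> / 4 * \<bar>t\<bar>) \<le> exp (ln (3 / 2))"
    using assms by (simp only: exp_le_cancel_iff)
  finally have "\<bar>bessel \<mu> n t - 1\<bar> \<le> 1 / 2" by simp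
  then show "1 / 2 \<le> bessel \<mu> n t" "bessel \<mu> n t \<le> 3 / 2" unfolding abs_le_iff by linarith+
qed

text \<open>\<open>G\<close> is \<open>r\<close> times the derivative of \<open>g\<close>, and the
  separation constant is \<open>n\<^sup>2\<close>. Both limits hold because the expressions are
  continuous at 0; in \<open>G\<close> the factor \<open>real n\<close> takes care of
  \<open>n = 0\<close>.\<close>

lemma radial_bessel:
  fixes \<mu> :: real and n :: nat
  defines "g \<equiv> \<lambda>r. r ^ n * bessel \<mu> n (r\<^sup>2)"
    and "G \<equiv> \<lambda>r. real n * r ^ n * bessel \<mu> n (r\<^sup>2) + 2 * r ^ (n + 2) * bessel1 \<mu> n (r\<^sup>2)"
  shows "r > 0 \<Longrightarrow> (g has_real_derivative G r / r) (at r)"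
    and "r > 0 \<Longrightarrow> (G has_real_derivative ((real n)\<^sup>2 / r - \<mu> * r) * g r) (at r)"
    and "(G \<longlongrightarrow> 0) (at_right 0)" "((\<lambda>r. r * g r) \<longlongrightarrow> 0) (at_right 0)"
proof -
  have sq: "((\<lambda>r. r\<^sup>2) has_real_derivative 2 * r) (at r)" for r :: real
    by (auto intro!: derivative_eq_intros)
  note b0 = DERIV_chain2[OF bessel_deriv(1) sq] and b1 = DERIV_chain2[OF bessel_deriv(2) sq]
  have pw: "((\<lambda>r. r ^ m) has_real_derivative real m * r ^ m / r) (at r)" if "r > 0" for r m
  proof -
    have "real m * r ^ (m - Suc 0) = real m * r ^ m / r" using that by (cases m) auto
    with DERIV_pow[of m r] show ?thesis by simp
  qed
  {
    assume r: "r > 0"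
    show "(g has_real_derivative G r / r) (at r)"
      unfolding g_def using DERIV_mult[OF pw[OF r] b0]
      by (rule DERIV_cong) (use r in \<open>simp add: G_def field_simps power2_eq_square\<close>)
    have ode: "r\<^sup>2 * bessel2 \<mu> n (r\<^sup>2) = - (real (Suc n) * bessel1 \<mu> n (r\<^sup>2) + \<mu> / 4 * bessel \<mu> n (r\<^sup>2))"
      using bessel_ode[of "r\<^sup>2" \<mu> n] by linarith
    have alg: "(real n * (real n * p / r)) * b + b1 * (2 * r) * (real n * p)
       + ((2 * (real (n + 2) * (p * r\<^sup>2) / r)) * b1 + b2 * (2 * r) * (2 * (p * r\<^sup>2)))
       = ((real n)\<^sup>2 / r - \<mu> * r) * (p * b)"
      if b2: "r\<^sup>2 * b2 = - (real (Suc n) * b1 + \<mu> / 4 * b)" for p b b1 b2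
    proof -
      have "b2 * (2 * r) * (2 * (p * r\<^sup>2)) = 4 * p * r * (r\<^sup>2 * b2)" by simp
      also have "\<dots> = 4 * p * r * - (real (Suc n) * b1 + \<mu> / 4 * b)" by (simp only: b2)
      finally have X: "b2 * (2 * r) * (2 * (p * r\<^sup>2)) = 4 * p * r * - (real (Suc n) * b1 + \<mu> / 4 * b)" .
      show ?thesis
        unfolding X using r by (simp add: field_simps power2_eq_square)
    qed
    have D: "(G has_real_derivative
       (real n * (real n * r ^ n / r)) * bessel \<mu> n (r\<^sup>2) + bessel1 \<mu> n (r\<^sup>2) * (2 * r) * (real n * r ^ n)
       + ((2 * (real (n + 2) * r ^ (n + 2) / r)) * bessel1 \<mu> n (r\<^sup>2) + bessel2 \<mu> n (r\<^sup>2) * (2 * r) * (2 * r ^ (n + 2)))) (at r)"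
      unfolding G_def
      by (intro DERIV_add DERIV_mult DERIV_cmult pw[OF r] b0 b1)
    show "(G has_real_derivative ((real n)\<^sup>2 / r - \<mu> * r) * g r) (at r)"
      using D by (rule DERIV_cong) (simp only: g_def power_add alg[OF ode])
  }
  have c0: "isCont (\<lambda>r. bessel \<mu> n (r\<^sup>2)) 0" "isCont (\<lambda>r. bessel1 \<mu> n (r\<^sup>2)) 0"
    using b0[of \<mu> n 0] b1[of \<mu> n 0] DERIV_isCont by blast+
  have "isCont G 0" "isCont (\<lambda>r. r * g r) 0"
    unfolding G_def g_def by (intro continuous_intros c0)+
  then have "(G \<longlongrightarrow> G 0) (at_right 0)" "((\<lambda>r. r * g r) \<longlongrightarrow> 0 * g 0) (at_right 0)"
    by (auto simp: isCont_def intro: tendsto_within_subset)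
  moreover have "G 0 = 0" by (cases n) (auto simp: G_def)
  ultimately show "(G \<longlongrightarrow> 0) (at_right 0)" "((\<lambda>r. r * g r) \<longlongrightarrow> 0) (at_right 0)" by auto
qed

text \<open>The squared radius has weighted norm at most \<open>2 * R\<^sup>2\<close>, and the
  coefficients are dominated by those of the exponential, so the norm bound is independent of
  \<open>n\<close>.\<close>

lemma series_bessel:
  assumes "R > 0"
  shows "\<exists>c. series R (exp (\<bar>\<mu>\<bar> / 4 * (2 * R\<^sup>2))) c (\<lambda>h. bessel \<mu> n ((h $ 1)\<^sup>2 + (h $ 2)\<^sup>2))"
proof (rule series_sums[OF assms _ exp_sums_real])
  fix k
  obtain c1 c2 where "series R (R ^ 2) c1 (\<lambda>h. (h $ 1) ^ 2)" "series R (R ^ 2) c2 (\<lambda>h. (h $ 2) ^ 2)"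
    using series_power[OF assms] series_nth1[OF assms] series_nth2[OF assms] by metis
  then obtain c3 where "series R (R\<^sup>2 + R\<^sup>2) c3 (\<lambda>h. (h $ 1)\<^sup>2 + (h $ 2)\<^sup>2)"
    using series_add[OF assms] by blast
  then obtain c4 where "series R ((R\<^sup>2 + R\<^sup>2) ^ k) c4 (\<lambda>h. ((h $ 1)\<^sup>2 + (h $ 2)\<^sup>2) ^ k)"
    using series_power[OF assms] by blast
  then obtain c5 where c5: "series R (\<bar>bcoeff \<mu> n k\<bar> * (R\<^sup>2 + R\<^sup>2) ^ k) c5 (\<lambda>h. bcoeff \<mu> n k * ((h $ 1)\<^sup>2 + (h $ 2)\<^sup>2) ^ k)"
    using series_cmult[OF assms] by blast
  have "\<bar>bcoeff \<mu> n k\<bar> * (R\<^sup>2 + R\<^sup>2) ^ k \<le> (\<bar>\<mu>\<bar> / 4 * (2 * R\<^sup>2)) ^ k / fact k"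
    using bcoeff_term_le[of \<mu> n k "2 * R\<^sup>2"] by (simp add: abs_mult)
  then show "\<exists>c. series R ((\<bar>\<mu>\<bar> / 4 * (2 * R\<^sup>2)) ^ k / fact k) c (\<lambda>h. bcoeff \<mu> n k * ((h $ 1)\<^sup>2 + (h $ 2)\<^sup>2) ^ k)"
    using series_bound_mono[OF c5] by blast
qed (rule bessel_sums)

text \<open>Each multiplication by the complex variable adds two products of norm \<open>R\<close>
  times the previous bound, whence the base \<open>2 * R\<close>.\<close>

lemma series_Re_Im_power:
  assumes "R > 0"
  shows "(\<exists>c. series R ((2 * R) ^ n) c (\<lambda>h. Re (Complex (h $ 1) (h $ 2) ^ n))) \<and>
    (\<exists>c. series R ((2 * R) ^ n) c (\<lambda>h. Im (Complex (h $ 1) (h $ 2) ^ n)))"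
proof (induction n)
  case 0
  show ?case using series_const[OF assms, of 1] series_bound_mono[of R 0 _ "\<lambda>_. 0" 1] series_const[OF assms, of 0] by auto
next
  case (Suc n)
  then obtain c d where c: "series R ((2 * R) ^ n) c (\<lambda>h. Re (Complex (h $ 1) (h $ 2) ^ n))"
    and d: "series R ((2 * R) ^ n) d (\<lambda>h. Im (Complex (h $ 1) (h $ 2) ^ n))" by blast
  obtain x y where x: "series R R x (\<lambda>h. h $ 1)" and y: "series R R y (\<lambda>h. h $ 2)"
    using series_nth1[OF assms] series_nth2[OF assms] by blast
  have eq: "R * (2 * R) ^ n + R * (2 * R) ^ n = (2 * R) ^ Suc n" by simp
  have my: "\<exists>e. series R (R * (2 * R) ^ n) e (\<lambda>h. - (h $ 2 * f h))" if df: "series R ((2 * R) ^ n) d f" for d f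
  proof -
    obtain e where "series R (R * (2 * R) ^ n) e (\<lambda>h. h $ 2 * f h)"
      using series_mult[OF assms y df] by blast
    from series_cmult[OF assms this, of "-1"] show ?thesis by simp
  qed
  obtain e1 e2 where "series R (R * (2 * R) ^ n) e1 (\<lambda>h. h $ 1 * Re (Complex (h $ 1) (h $ 2) ^ n))"
    "series R (R * (2 * R) ^ n) e2 (\<lambda>h. - (h $ 2 * Im (Complex (h $ 1) (h $ 2) ^ n)))"
    using series_mult[OF assms x c] my[OF d] by blast
  from series_add[OF assms this]
  have re: "\<exists>c. series R ((2 * R) ^ Suc n) c (\<lambda>h. Re (Complex (h $ 1) (h $ 2) ^ Suc n))"
    unfolding eq by simp
  obtain e1 e2 where "series R (R * (2 * R) ^ n) e1 (\<lambda>h. h $ 1 * Im (Complex (h $ 1) (h $ 2) ^ n))"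
    "series R (R * (2 * R) ^ n) e2 (\<lambda>h. h $ 2 * Re (Complex (h $ 1) (h $ 2) ^ n))"
    using series_mult[OF assms x d] series_mult[OF assms y c] by blast
  from series_add[OF assms this]
  have im: "\<exists>c. series R ((2 * R) ^ Suc n) c (\<lambda>h. Im (Complex (h $ 1) (h $ 2) ^ Suc n))"
    unfolding eq by simp
  from re im show ?case by blast
qed

text \<open>Provides a radius below which \<open>bessel_near_1\<close> applies for all
  \<open>n\<close>, so the radial solutions are positive and can be divided by.\<close>

lemma small_radius:
  fixes \<rho>0 \<mu> :: real
  assumes "\<rho>0 > 0"
  obtains \<rho> where "0 < \<rho>" "\<rho> < \<rho>0" "\<And>r. \<bar>r\<bar> \<le> \<rho> \<Longrightarrow> \<bar>\<mu>\<bar> / 4 * \<bar>r\<^sup>2\<bar> \<le> ln (3 / 2)"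
proof -
  have l: "ln (3 / 2 :: real) > 0" by simp
  define \<rho> where "\<rho> = min (\<rho>0 / 2) (min 1 (ln (3 / 2) / (\<bar>\<mu>\<bar> + 1)))"
  have \<rho>: "0 < \<rho>" "\<rho> < \<rho>0" "\<rho> \<le> 1" "\<rho> \<le> ln (3 / 2) / (\<bar>\<mu>\<bar> + 1)"
    using assms l by (auto simp: \<rho>_def)
  have "\<bar>\<mu>\<bar> / 4 * \<bar>r\<^sup>2\<bar> \<le> ln (3 / 2)" if "\<bar>r\<bar> \<le> \<rho>" for r
  proof -
    have "\<bar>r\<bar> * \<bar>r\<bar> \<le> \<rho> * 1" using that \<rho> by (intro mult_mono) auto
    then have "r\<^sup>2 \<le> \<rho>" by (simp add: power2_eq_square flip: abs_mult)
    then have "\<bar>\<mu>\<bar> / 4 * r\<^sup>2 \<le> (\<bar>\<mu>\<bar> + 1) * \<rho>" using \<rho> by (intro mult_mono) auto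
    also have "\<dots> \<le> ln (3 / 2)" using \<rho>(4) by (simp add: pos_le_divide_eq mult.commute)
    finally show ?thesis by simp
  qed
  with \<rho> show thesis by (intro that) auto
qed

lemma Complex_polar: "Complex (polar r t $ 1) (polar r t $ 2) ^ n = of_real (r ^ n) * cis (real n * t)"
proof -
  have "Complex (polar r t $ 1) (polar r t $ 2) = of_real r * cis t"
    by (simp add: polar_pt complex_eq_iff)
  then show ?thesis by (simp add: power_mult_distrib Complex.DeMoivre)
qed

text \<open>Expanding \<open>u\<close> in a Fourier series on each circle around \<open>x0\<close> gives
  \<open>u = \<Sum>n. Re (A\<^sub>n * z ^ n) * bessel \<mu> n (\<bar>z\<bar>\<^sup>2)\<close> with \<open>A\<^sub>n = O(\<rho> ^ (- n))\<close>.\<close>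

theorem helmholtz_analytic:
  fixes u :: "real^2 \<Rightarrow> real" and Du :: "real^2 \<Rightarrow> real^2" and D2u :: "real^2 \<Rightarrow> real^2 \<Rightarrow> real^2"
  assumes u1: "\<And>x. x \<in> ball x0 \<rho>0 \<Longrightarrow> (u has_derivative (\<lambda>h. Du x \<bullet> h)) (at x)"
    and u2: "\<And>x. x \<in> ball x0 \<rho>0 \<Longrightarrow> (Du has_derivative D2u x) (at x)"
    and hz: "\<And>x. x \<in> ball x0 \<rho>0 \<Longrightarrow> D2u x (axis 1 1) $ 1 + D2u x (axis 2 1) $ 2 + \<mu> * u x = 0"
    and "\<rho>0 > 0"
  shows "\<exists>R>0. R \<le> \<rho>0 \<and> (\<exists>N c. series R N c (\<lambda>h. u (x0 + h)))"
proof -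
  obtain \<rho>1 where \<rho>1: "0 < \<rho>1" "\<rho>1 < \<rho>0" "\<And>r. \<bar>r\<bar> \<le> \<rho>1 \<Longrightarrow> \<bar>\<mu>\<bar> / 4 * \<bar>r\<^sup>2\<bar> \<le> ln (3 / 2)"
    using small_radius[OF \<open>\<rho>0 > 0\<close>] by metis
  define g where "g = (\<lambda>n r. r ^ n * bessel \<mu> n (r\<^sup>2))"
  have bes: "1 / 2 \<le> bessel \<mu> n (r\<^sup>2)" "bessel \<mu> n (r\<^sup>2) \<le> 3 / 2" if "\<bar>r\<bar> \<le> \<rho>1" for r n
    using bessel_near_1[of \<mu> "r\<^sup>2" n] \<rho>1(3)[OF that] by auto
  have gpos: "g n r > 0" if "0 < r" "r \<le> \<rho>1" for n r
  proof -
    have "bessel \<mu> n (r\<^sup>2) > 0" using bes(1)[of r n] that by linarith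
    then show ?thesis using that by (simp add: g_def)
  qed
  have sub: "x \<in> ball x0 \<rho>0" if "x \<in> ball x0 \<rho>1" for x
    using that \<rho>1(2) by auto
  have rad: "\<exists>K. \<forall>r. 0 < r \<longrightarrow> r < \<rho>1 \<longrightarrow> integral {0..2*pi} (\<lambda>t. u (x0 + polar r t) * e t) = K * g n r"
    if e: "\<And>t. (e has_real_derivative e' t) (at t)" "\<And>t. (e' has_real_derivative - ((real n)\<^sup>2 * e t)) (at t)"
      "e (2 * pi) = e 0" "e' (2 * pi) = e' 0" for n e e'
  proof (rule radial_coefficient[where \<rho> = \<rho>1 and Du = Du and D2u = D2u and \<mu> = \<mu>, OF _ _ _ e])
    show "g n r > 0" if "0 < r" "r < \<rho>1" for r using gpos that by simp
  qed (use sub u1 u2 hz \<rho>1(1) radial_bessel(1,2)[of _ n \<mu>] radial_bessel(3,4)[of n \<mu>] in \<open>auto simp: g_def\<close>)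
  have per: "cos (real n * (2 * pi)) = 1" "sin (real n * (2 * pi)) = 0" for n
    using cos_2npi[of n] sin_2npi[of n] by (simp_all add: mult_ac)
  have "\<exists>K. \<forall>r. 0 < r \<longrightarrow> r < \<rho>1 \<longrightarrow> integral {0..2*pi} (\<lambda>t. u (x0 + polar r t) * cos (real n * t)) = K * g n r" for n
  proof (rule rad[where e' = "\<lambda>t. - real n * sin (real n * t)"])
    show "cos (real n * (2 * pi)) = cos (real n * 0)"
      "- real n * sin (real n * (2 * pi)) = - real n * sin (real n * 0)"
      by (simp_all add: per)
  qed (auto intro!: derivative_eq_intros simp: power2_eq_square mult_ac)
  then obtain Ka where Ka: "\<And>n r. 0 < r \<Longrightarrow> r < \<rho>1 \<Longrightarrow>
      integral {0..2*pi} (\<lambda>t. u (x0 + polar r t) * cos (real n * t)) = Ka n * g n r" by metis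
  have "\<exists>K. \<forall>r. 0 < r \<longrightarrow> r < \<rho>1 \<longrightarrow> integral {0..2*pi} (\<lambda>t. u (x0 + polar r t) * sin (real n * t)) = K * g n r" for n
  proof (rule rad[where e' = "\<lambda>t. real n * cos (real n * t)"])
    show "sin (real n * (2 * pi)) = sin (real n * 0)"
      "real n * cos (real n * (2 * pi)) = real n * cos (real n * 0)"
      by (simp_all add: per)
  qed (auto intro!: derivative_eq_intros simp: power2_eq_square mult_ac)
  then obtain Kb where Kb: "\<And>n r. 0 < r \<Longrightarrow> r < \<rho>1 \<Longrightarrow>
      integral {0..2*pi} (\<lambda>t. u (x0 + polar r t) * sin (real n * t)) = Kb n * g n r" by metis
  have cu: "continuous_on (ball x0 \<rho>0) u"
    using u1 by (meson has_derivative_at_withinI has_derivative_continuous_on)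
  \<comment> \<open>The circle of radius \<rho> has to lie strictly inside the range where the
    coefficient formulas hold, since the constants are estimated on it.\<close>
  define \<rho> where "\<rho> = \<rho>1 / 2"
  have \<rho>: "0 < \<rho>" "\<rho> < \<rho>1" "\<rho> < \<rho>0" using \<rho>1 by (auto simp: \<rho>_def)
  have cuP: "continuous_on S (\<lambda>t. u (x0 + polar r t))" if "0 \<le> r" "r \<le> \<rho>" for S r
    by (rule continuous_on_compose2[OF cu]) (use that \<rho> in \<open>auto intro!: continuous_intros simp: dist_norm\<close>)
  have "compact (cball x0 \<rho>)" "continuous_on (cball x0 \<rho>) u"
    using \<rho> by (auto intro: continuous_on_subset[OF cu])
  then have "bounded (u ` cball x0 \<rho>)"
    by (intro compact_imp_bounded compact_continuous_image)
  then obtain M where M: "M > 0" "\<And>x. x \<in> cball x0 \<rho> \<Longrightarrow> \<bar>u x\<bar> \<le> M"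
    unfolding bounded_pos by auto
  \<comment> \<open>The integral over the circle is at most \<open>M * 2 * pi\<close>; the extra 2
    comes from dividing by a Bessel factor that is at least 1/2.\<close>
  define C where "C = M * (2 * pi - 0) * 2"
  have "C > 0" using M(1) by (simp add: C_def)
  have K_le: "\<bar>K\<bar> \<le> C / \<rho> ^ n"
    if K: "integral {0..2*pi} (\<lambda>t. u (x0 + polar \<rho> t) * e t) = K * g n \<rho>"
      and e: "\<And>t. \<bar>e t\<bar> \<le> 1" "continuous_on {0..2*pi} e" for K n e
  proof -
    have "\<bar>integral {0..2*pi} (\<lambda>t. u (x0 + polar \<rho> t) * e t)\<bar> \<le> M * (2 * pi - 0)"
    proof (rule integral_abs_bound_1)
      show "continuous_on {0..2*pi} (\<lambda>t. u (x0 + polar \<rho> t) * e t)"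
        using \<rho> by (intro continuous_intros cuP e) auto
      fix t
      have "\<bar>u (x0 + polar \<rho> t)\<bar> * \<bar>e t\<bar> \<le> M * 1"
        using M e(1)[of t] \<rho> by (intro mult_mono) (auto simp: dist_norm)
      then show "\<bar>u (x0 + polar \<rho> t) * e t\<bar> \<le> M" by (simp add: abs_mult)
    qed (use M in auto)
    then have 1: "\<bar>K\<bar> * g n \<rho> \<le> M * (2 * pi - 0)"
      using gpos[of \<rho> n] \<rho> unfolding K by (simp add: abs_mult)
    have "\<rho> ^ n * (1 / 2) \<le> g n \<rho>"
      unfolding g_def using bes(1)[of \<rho> n] \<rho> by (intro mult_left_mono) auto
    then have "\<bar>K\<bar> * (\<rho> ^ n * (1 / 2)) \<le> \<bar>K\<bar> * g n \<rho>" by (intro mult_left_mono) auto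
    with 1 have "\<bar>K\<bar> * \<rho> ^ n \<le> C" by (simp add: C_def)
    then show ?thesis using \<rho> by (simp add: pos_le_divide_eq)
  qed
  have Ka_le: "\<bar>Ka n\<bar> \<le> C / \<rho> ^ n" for n
    by (rule K_le[OF Ka]) (use \<rho> in \<open>auto intro!: continuous_intros\<close>)
  have Kb_le: "\<bar>Kb n\<bar> \<le> C / \<rho> ^ n" for n
    by (rule K_le[OF Kb]) (use \<rho> in \<open>auto intro!: continuous_intros\<close>)
  define f where "f = (\<lambda>n (h::real^2). fweight n * (bessel \<mu> n ((h $ 1)\<^sup>2 + (h $ 2)\<^sup>2) *
      (Ka n * Re (Complex (h $ 1) (h $ 2) ^ n) + Kb n * Im (Complex (h $ 1) (h $ 2) ^ n))))"
  have polar_sums: "(\<lambda>n. f n (polar r t)) sums u (x0 + polar r t)" if r: "0 < r" "r < \<rho>" for r t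
  proof -
    define F where "F = (\<lambda>z::complex. u (x0 + pt (r * Re z) (r * Im z)))"
    have Fcis: "F (cis t) = u (x0 + polar r t)" for t by (simp add: F_def polar_pt)
    have r1: "r < \<rho>1" using r \<rho> by simp
    have cF: "continuous_on (sphere 0 1) F"
      unfolding F_def
    proof (rule continuous_on_compose2[OF cu])
      show "continuous_on (sphere 0 1) (\<lambda>z. x0 + pt (r * Re z) (r * Im z))" by (intro continuous_intros)
      have "norm (pt (r * Re z) (r * Im z)) = r * norm z" for z
      proof -
        have "(r * Re z)\<^sup>2 + (r * Im z)\<^sup>2 = r\<^sup>2 * ((Re z)\<^sup>2 + (Im z)\<^sup>2)" by (simp add: power_mult_distrib distrib_left)
        then show ?thesis using r by (simp add: norm_2 cmod_def real_sqrt_mult)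
      qed
      then show "(\<lambda>z. x0 + pt (r * Re z) (r * Im z)) ` sphere 0 1 \<subseteq> ball x0 \<rho>0"
        using r \<rho> by (auto simp: dist_norm)
    qed
    \<comment> \<open>The coefficient bound \<open>C / \<rho> ^ n\<close> against
      \<open>r ^ n\<close> leaves a geometric series for \<open>r < \<rho>\<close>; the 2 dominates
      the upper Bessel bound 3/2.\<close>
    have geo: "summable (\<lambda>n. C * 2 * (r / \<rho>) ^ n)"
      using r \<rho> by (intro summable_mult summable_geometric) auto
    have term_le: "\<bar>\<bar>K n * g n r\<bar>\<bar> \<le> C * 2 * (r / \<rho>) ^ n" if K: "\<And>n. \<bar>K n\<bar> \<le> C / \<rho> ^ n" for K n
    proof -
      have "\<bar>g n r\<bar> \<le> r ^ n * 2"
        unfolding g_def abs_mult using bes[of r n] r r1 by (intro mult_mono) auto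
      then have "\<bar>K n\<bar> * \<bar>g n r\<bar> \<le> (C / \<rho> ^ n) * (r ^ n * 2)"
        using K[of n] \<open>C > 0\<close> \<rho> by (intro mult_mono) auto
      then show ?thesis by (simp add: abs_mult power_divide mult_ac)
    qed
    have "(\<lambda>n. fweight n * (Ka n * g n r * Re (cis t ^ n) + Kb n * g n r * Im (cis t ^ n))) sums F (cis t)"
    proof (rule fourier_series[OF cF])
      show "integral {0..2*pi} (\<lambda>t. F (cis t) * cos (real n * t)) = Ka n * g n r" for n
        unfolding Fcis by (rule Ka[OF r(1) r1])
      show "integral {0..2*pi} (\<lambda>t. F (cis t) * sin (real n * t)) = Kb n * g n r" for n
        unfolding Fcis by (rule Kb[OF r(1) r1])
      show "summable (\<lambda>n. \<bar>Ka n * g n r\<bar>)"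
        by (rule summable_comparison_test'[OF geo, of 0]) (use term_le[of Ka, OF Ka_le] in simp)
      show "summable (\<lambda>n. \<bar>Kb n * g n r\<bar>)"
        by (rule summable_comparison_test'[OF geo, of 0]) (use term_le[of Kb, OF Kb_le] in simp)
    qed simp
    moreover have "fweight n * (Ka n * g n r * Re (cis t ^ n) + Kb n * g n r * Im (cis t ^ n)) = f n (polar r t)" for n
    proof -
      have "(polar r t $ 1)\<^sup>2 + (polar r t $ 2)\<^sup>2 = r\<^sup>2"
        by (simp add: polar_pt power_mult_distrib flip: distrib_left)
      then show ?thesis
        unfolding f_def Complex_polar by (simp add: g_def Complex.DeMoivre algebra_simps)
    qed
    ultimately show ?thesis by (simp add: Fcis)
  qed
  have sums: "(\<lambda>n. f n h) sums u (x0 + h)" if h: "h \<noteq> 0" "norm h < \<rho>" for h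
  proof -
    have "h = polar (norm h) (Arg (Complex (h $ 1) (h $ 2)))"
    proof -
      define z where "z = Complex (h $ 1) (h $ 2)"
      have nz: "norm z = norm h" by (simp add: z_def cmod_def norm_2)
      have "z = of_real (norm z) * cis (Arg z)"
        using rcis_cmod_Arg[of z] by (simp add: rcis_def)
      then have "Re z = norm h * cos (Arg z)" "Im z = norm h * sin (Arg z)"
        unfolding nz by (metis Re_rcis rcis_def, metis Im_rcis rcis_def)
      then show ?thesis by (simp add: polar_pt vec_eq_iff forall_2 z_def)
    qed
    with polar_sums[of "norm h"] h show ?thesis by (metis zero_less_norm_iff)
  qed
  \<comment> \<open>A quarter, so that the norm bound \<open>(2 * R) ^ n\<close> of the powers meets
    \<open>C / \<rho> ^ n\<close> with ratio 1/2.\<close>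
  define R where "R = \<rho> / 4"
  have R: "R > 0" "2 * R = \<rho> / 2" "R \<le> \<rho>0" using \<rho> by (auto simp: R_def)
  define E where "E = exp (\<bar>\<mu>\<bar> / 4 * (2 * R\<^sup>2))"
  \<comment> \<open>The expansion on circles says nothing about the centre, so the sum is first
    recorded with its own value there. Continuity identifies that value with \<open>u x0\<close> at
    the end.\<close>
  define F where "F = (\<lambda>h. if h = 0 then f 0 0 else u (x0 + h))"
  have "\<exists>c. series R (E * (C + C) * (\<Sum>n. (1 / 2) ^ n)) c F"
  proof (rule series_sums[OF R(1)])
    show "(\<lambda>n. E * (C + C) * (1 / 2) ^ n) sums (E * (C + C) * (\<Sum>n. (1 / 2) ^ n))"
      by (intro sums_mult summable_sums summable_geometric) simp
    fix n
    obtain c d where c: "series R ((2 * R) ^ n) c (\<lambda>h. Re (Complex (h $ 1) (h $ 2) ^ n))"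
      and d: "series R ((2 * R) ^ n) d (\<lambda>h. Im (Complex (h $ 1) (h $ 2) ^ n))"
      using series_Re_Im_power[OF R(1)] by blast
    have cm: "\<exists>c. series R (C * (1 / 2) ^ n) c (\<lambda>h. K * f h)" if K: "\<bar>K\<bar> \<le> C / \<rho> ^ n" and s: "series R ((2 * R) ^ n) c f" for K c f
    proof -
      obtain e where e: "series R (\<bar>K\<bar> * (2 * R) ^ n) e (\<lambda>h. K * f h)" using series_cmult[OF R(1) s] by blast
      have "\<bar>K\<bar> * (2 * R) ^ n \<le> C / \<rho> ^ n * (2 * R) ^ n" using K R by (intro mult_right_mono) auto
      also have "\<dots> = C * (1 / 2) ^ n" using \<rho> unfolding R(2) by (simp add: power_divide)
      finally show ?thesis using series_bound_mono[OF e] by blast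
    qed
    obtain e1 e2 where "series R (C * (1 / 2) ^ n) e1 (\<lambda>h. Ka n * Re (Complex (h $ 1) (h $ 2) ^ n))"
      "series R (C * (1 / 2) ^ n) e2 (\<lambda>h. Kb n * Im (Complex (h $ 1) (h $ 2) ^ n))"
      using cm[OF Ka_le c] cm[OF Kb_le d] by blast
    from series_add[OF R(1) this] obtain e3 where e3: "series R (C * (1 / 2) ^ n + C * (1 / 2) ^ n) e3
      (\<lambda>h. Ka n * Re (Complex (h $ 1) (h $ 2) ^ n) + Kb n * Im (Complex (h $ 1) (h $ 2) ^ n))" by blast
    obtain e4 where e4: "series R E e4 (\<lambda>h. bessel \<mu> n ((h $ 1)\<^sup>2 + (h $ 2)\<^sup>2))"
      unfolding E_def using series_bessel[OF R(1)] by blast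
    obtain e5 where "series R (E * (C * (1 / 2) ^ n + C * (1 / 2) ^ n)) e5 (\<lambda>h. bessel \<mu> n ((h $ 1)\<^sup>2 + (h $ 2)\<^sup>2) *
      (Ka n * Re (Complex (h $ 1) (h $ 2) ^ n) + Kb n * Im (Complex (h $ 1) (h $ 2) ^ n)))"
      using series_mult[OF R(1) e4 e3] by blast
    from series_cmult[OF R(1) this, of "fweight n"]
    obtain e6 where e6: "series R (\<bar>fweight n\<bar> * (E * (C * (1 / 2) ^ n + C * (1 / 2) ^ n))) e6 (f n)"
      unfolding f_def by blast
    have "\<bar>fweight n\<bar> \<le> 1" using pi_gt3 by (auto simp: fweight_def)
    then have "\<bar>fweight n\<bar> * (E * (C * (1 / 2) ^ n + C * (1 / 2) ^ n)) \<le> 1 * (E * (C * (1 / 2) ^ n + C * (1 / 2) ^ n))"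
      using \<open>C > 0\<close> by (intro mult_right_mono) (auto simp: E_def intro!: mult_nonneg_nonneg)
    also have "\<dots> = E * (C + C) * (1 / 2) ^ n" by (simp add: algebra_simps)
    finally show "\<exists>c. series R (E * (C + C) * (1 / 2) ^ n) c (f n)" using series_bound_mono[OF e6] by blast
  next
    fix h :: "real^2" assume h: "\<bar>h $ 1\<bar> \<le> R" "\<bar>h $ 2\<bar> \<le> R"
    show "(\<lambda>n. f n h) sums F h"
    proof (cases "h = 0")
      case True
      have "Complex 0 0 = 0" by (simp add: complex_eq_iff)
      then have "f n h = 0" if "n \<noteq> 0" for n
        using True that by (simp add: f_def)
      then show ?thesis
        using sums_finite[of "{0}" "\<lambda>n. f n h"] True by (simp add: F_def)
    next
      case False
      have "norm h < \<rho>" using norm_le_2[of h] h \<rho> by (simp add: R_def)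
      with False show ?thesis using sums[of h] by (simp add: F_def)
    qed
  qed
  then obtain N c where s: "series R N c F" by blast
  \<comment> \<open>Differentiability of the power series is used here only to obtain continuity of
    \<open>F\<close> at 0 along the first axis, which suffices to compare values at the
    centre.\<close>
  have "0 < R / 2" "R / 2 < R" using R(1) by auto
  from series_has_derivative_1[OF s this]
  obtain N' g' where "series (R / 2) N' (dcoeff c) g'" and
    D: "\<And>x y. \<bar>x\<bar> < R / 2 \<Longrightarrow> \<bar>y\<bar> < R / 2 \<Longrightarrow> ((\<lambda>x. F (pt x y)) has_real_derivative g' (pt x y)) (at x)"
    by blast
  from D[of 0 0] R(1) have "isCont (\<lambda>x. F (pt x 0)) 0"
    by (auto intro: DERIV_isCont)
  then have 1: "(\<lambda>x. F (pt x 0)) \<midarrow>0\<rightarrow> F 0"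
    by (simp add: isCont_def pt_arith)
  have "continuous (at (x0 + 0)) u"
    using u1[of x0] \<open>\<rho>0 > 0\<close> by (auto intro: has_derivative_continuous)
  moreover have "((\<lambda>x. x0 + pt x 0) \<longlongrightarrow> x0 + pt 0 0) (at 0)"
    unfolding pt_axis by (intro tendsto_intros)
  ultimately have "((\<lambda>x. u (x0 + pt x 0)) \<longlongrightarrow> u (x0 + pt 0 0)) (at 0)"
    by (intro isCont_tendsto_compose[of _ u]) (auto simp: pt_arith)
  moreover have "eventually (\<lambda>x. u (x0 + pt x 0) = F (pt x 0)) (at 0)"
    by (rule eventually_mono[OF eventually_neq_at_within[of 0]]) (auto simp: F_def vec_eq_iff forall_2)
  ultimately have 2: "(\<lambda>x. F (pt x 0)) \<midarrow>0\<rightarrow> u x0"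
    by (simp add: pt_arith tendsto_cong)
  have "F 0 = u x0" using 1 2 by (rule LIM_unique)
  then have "F = (\<lambda>h. u (x0 + h))" by (auto simp: F_def fun_eq_iff)
  with s R show ?thesis by blast
qed

section \<open>Annular domains in polar coordinates\<close>

definition angle :: "real^2 \<Rightarrow> real" where
  "angle x = Arg2pi (Complex (x $ 1) (x $ 2))"

lemma angle_range: "angle x \<in> {0..2*pi}"
  using Arg2pi[of "Complex (x $ 1) (x $ 2)"] by (auto simp: angle_def)

lemma polar_angle [simp]: "polar (norm x) (angle x) = x"
  using cos_Arg2pi[of "Complex (x $ 1) (x $ 2)"] sin_Arg2pi[of "Complex (x $ 1) (x $ 2)"]
  by (simp add: polar_pt angle_def vec_eq_iff forall_2 norm_2 cmod_def)

lemma polar_0 [simp]: "polar 0 t = 0"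
  by (simp add: polar_pt pt_arith)

lemma periodic_int:
  fixes f :: "real \<Rightarrow> real"
  assumes "\<And>t. f (t + 2 * pi) = f t"
  shows "f (t + 2 * pi * of_int n) = f t"
proof -
  have nat: "f (t + 2 * pi * real m) = f t" for m t
  proof (induction m)
    case (Suc m)
    then show ?case using assms[of "t + 2 * pi * real m"] by (simp add: algebra_simps)
  qed simp
  show ?thesis
  proof (cases "n \<ge> 0")
    case True
    then show ?thesis using nat[of t "nat n"] by simp
  next
    case False
    then show ?thesis using nat[of "t + 2 * pi * of_int n" "nat (- n)"] by simp
  qed
qed

text \<open>\<open>angle\<close> recovers \<open>t\<close> up to multiples of 2 pi only, which a
  periodic \<open>f\<close> does not see.\<close>

lemma angle_polar:
  fixes f :: "real \<Rightarrow> real"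
  assumes "\<And>t. f (t + 2 * pi) = f t" "r > 0"
  shows "f (angle (polar r t)) = f t"
proof -
  have "polar r (angle (polar r t)) = polar r t"
    using polar_angle[of "polar r t"] assms(2) by simp
  then have "cos (angle (polar r t)) = cos t" "sin (angle (polar r t)) = sin t"
    using assms(2) by (auto simp: polar_pt vec_eq_iff forall_2)
  then obtain n :: int where "angle (polar r t) = t + 2 * pi * n"
    using sin_cos_eq_iff by metis
  then show ?thesis using periodic_int[of f t n] assms(1) by simp
qed

lemma norm_polar_diff: "norm (polar r t - polar r' t') \<le> \<bar>r - r'\<bar> + 2 * \<bar>r'\<bar> * \<bar>t - t'\<bar>"
proof -
  have s: "\<bar>sin t - sin t'\<bar> \<le> \<bar>t - t'\<bar>" and c: "\<bar>cos t - cos t'\<bar> \<le> \<bar>t - t'\<bar>"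
    using field_differentiable_bound[of UNIV sin cos 1 t' t] field_differentiable_bound[of UNIV cos "\<lambda>x. - sin x" 1 t' t]
    by (auto simp: DERIV_sin DERIV_cos abs_cos_le_one abs_sin_le_one abs_minus_commute)
  have "polar r t - polar r' t' = polar (r - r') t + r' *\<^sub>R pt (cos t - cos t') (sin t - sin t')"
    by (simp add: polar_pt vec_eq_iff forall_2 algebra_simps)
  then have "norm (polar r t - polar r' t') \<le> \<bar>r - r'\<bar> + \<bar>r'\<bar> * norm (pt (cos t - cos t') (sin t - sin t'))"
    using norm_triangle_ineq[of "polar (r - r') t" "r' *\<^sub>R pt (cos t - cos t') (sin t - sin t')"] by simp
  also have "\<bar>r'\<bar> * norm (pt (cos t - cos t') (sin t - sin t')) \<le> \<bar>r'\<bar> * (2 * \<bar>t - t'\<bar>)"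
    using norm_le_2[of "pt (cos t - cos t') (sin t - sin t')"] s c by (intro mult_left_mono) auto
  finally show ?thesis by simp
qed

definition sublevel :: "(real \<Rightarrow> real) \<Rightarrow> (real^2) set" where
  "sublevel f = {x. norm x \<le> f (angle x)}"

definition suplevel :: "(real \<Rightarrow> real) \<Rightarrow> (real^2) set" where
  "suplevel f = {x. f (angle x) \<le> norm x}"

text \<open>As \<open>angle\<close> jumps across the positive axis, closedness of the regions is not
  obtained from preimages. They are presented as images of compact parameter rectangles
  instead.\<close>

lemma compact_polar_image:
  assumes "continuous_on UNIV f" "continuous_on UNIV g"
  shows "compact ((\<lambda>(t, \<theta>). polar ((1 - t) * f \<theta> + t * g \<theta>) \<theta>) ` ({0..1} \<times> {0..2*pi}))"
  unfolding case_prod_unfold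
  by (intro compact_continuous_image compact_Times compact_Icc continuous_intros
      continuous_on_compose2[OF assms(1)] continuous_on_compose2[OF assms(2)]) auto

context
  fixes f :: "real \<Rightarrow> real"
  assumes per: "\<And>t. f (t + 2 * pi) = f t" and cont: "continuous_on UNIV f" and pos: "\<And>t. 0 < f t"
begin

lemma sublevel_eq: "sublevel f = (\<lambda>(t, \<theta>). polar ((1 - t) * 0 + t * f \<theta>) \<theta>) ` ({0..1} \<times> {0..2*pi})"
proof (intro set_eqI iffI)
  fix x assume x: "x \<in> sublevel f"
  have "x = polar ((1 - norm x / f (angle x)) * 0 + norm x / f (angle x) * f (angle x)) (angle x)"
    using pos[of "angle x"] by simp
  moreover have "(norm x / f (angle x), angle x) \<in> {0..1} \<times> {0..2*pi}"
    using x pos[of "angle x"] angle_range[of x] by (auto simp: sublevel_def)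
  ultimately show "x \<in> (\<lambda>(t, \<theta>). polar ((1 - t) * 0 + t * f \<theta>) \<theta>) ` ({0..1} \<times> {0..2*pi})"
    by (intro rev_image_eqI[of "(norm x / f (angle x), angle x)"]) auto
next
  fix x assume "x \<in> (\<lambda>(t, \<theta>). polar ((1 - t) * 0 + t * f \<theta>) \<theta>) ` ({0..1} \<times> {0..2*pi})"
  then obtain t \<theta> where t: "0 \<le> t" "t \<le> 1" "x = polar (t * f \<theta>) \<theta>" by auto
  show "x \<in> sublevel f"
  proof (cases "t = 0")
    case True
    then show ?thesis using t pos less_imp_le by (auto simp: sublevel_def)
  next
    case False
    then have "t * f \<theta> > 0" using t pos[of \<theta>] by simp
    moreover have "t * f \<theta> \<le> f \<theta>" using t pos[of \<theta>] by (simp add: mult_left_le_one_le)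
    ultimately show ?thesis using angle_polar[of f, OF per] t(3) by (simp add: sublevel_def)
  qed
qed

lemma compact_sublevel: "compact (sublevel f)"
  unfolding sublevel_eq by (rule compact_polar_image[OF continuous_on_const cont])

text \<open>The region is unbounded, so it is split into a compact collar reaching out to radius
  \<open>M + 1\<close>, beyond the maximum of \<open>f\<close>, and the closed exterior of a
  disc.\<close>

lemma closed_suplevel: "closed (suplevel f)"
proof -
  have "bounded (f ` {0..2*pi})"
    by (intro compact_imp_bounded compact_continuous_image continuous_on_subset[OF cont]) auto
  then obtain M where M: "M > 0" "\<And>t. t \<in> {0..2*pi} \<Longrightarrow> \<bar>f t\<bar> \<le> M" unfolding bounded_pos by auto
  let ?I = "(\<lambda>(t, \<theta>). polar ((1 - t) * f \<theta> + t * (M + 1)) \<theta>) ` ({0..1} \<times> {0..2*pi})"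
  have fM: "f t < M + 1" if "t \<in> {0..2*pi}" for t using M(2)[OF that] by auto
  have "suplevel f = ?I \<union> {x. M + 1 \<le> norm x}"
  proof (intro set_eqI iffI)
    fix x assume x: "x \<in> suplevel f"
    show "x \<in> ?I \<union> {x. M + 1 \<le> norm x}"
    proof (cases "M + 1 \<le> norm x")
      case False
      define d where "d = M + 1 - f (angle x)"
      have d: "d > 0" using fM[OF angle_range[of x]] by (simp add: d_def)
      define t where "t = (norm x - f (angle x)) / d"
      have "t * d = norm x - f (angle x)" using d by (simp add: t_def)
      then have "(1 - t) * f (angle x) + t * (M + 1) = norm x" by (simp add: d_def algebra_simps)
      then have "x = polar ((1 - t) * f (angle x) + t * (M + 1)) (angle x)" by simp
      moreover have "t \<in> {0..1}" using x False d by (auto simp: t_def suplevel_def d_def)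
      ultimately have "x \<in> ?I" using angle_range[of x] by (intro rev_image_eqI[of "(t, angle x)"]) auto
      then show ?thesis by simp
    qed simp
  next
    fix x assume "x \<in> ?I \<union> {x. M + 1 \<le> norm x}"
    then consider (a) t \<theta> where "t \<in> {0..1}" "\<theta> \<in> {0..2*pi}" "x = polar ((1 - t) * f \<theta> + t * (M + 1)) \<theta>"
      | (b) "M + 1 \<le> norm x" by auto
    then show "x \<in> suplevel f"
    proof cases
      case a
      have "t * f \<theta> \<le> t * (M + 1)" using a fM[of \<theta>] by (intro mult_left_mono) auto
      then have ge: "f \<theta> \<le> (1 - t) * f \<theta> + t * (M + 1)" by (simp add: algebra_simps)
      then have "(1 - t) * f \<theta> + t * (M + 1) > 0" using pos[of \<theta>] by linarith
      with ge show ?thesis using angle_polar[of f, OF per] a(3) by (simp add: suplevel_def)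
    next
      case b
      then show ?thesis using fM[OF angle_range[of x]] by (simp add: suplevel_def)
    qed
  qed
  moreover have "closed ?I" by (intro compact_imp_closed compact_polar_image cont continuous_on_const)
  moreover have "closed {x::real^2. M + 1 \<le> norm x}" by (intro closed_Collect_le continuous_intros)
  ultimately show ?thesis by (simp add: closed_Un)
qed

lemma level_set_eq: "sublevel f \<inter> suplevel f = (\<lambda>t. polar (f t) t) ` {0..2*pi}"
proof (intro set_eqI iffI)
  fix x assume "x \<in> sublevel f \<inter> suplevel f"
  then have "norm x = f (angle x)" by (simp add: sublevel_def suplevel_def)
  then have "x = polar (f (angle x)) (angle x)" by (metis polar_angle)
  then show "x \<in> (\<lambda>t. polar (f t) t) ` {0..2*pi}" using angle_range by blast
next
  fix x assume "x \<in> (\<lambda>t. polar (f t) t) ` {0..2*pi}"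
  then obtain t where "x = polar (f t) t" by auto
  then show "x \<in> sublevel f \<inter> suplevel f"
    using angle_polar[of f, OF per pos[of t]] pos[of t] by (simp add: sublevel_def suplevel_def)
qed

lemma thin_level_set:
  assumes f': "\<And>t. (f has_real_derivative f' t) (at t)" and cf': "continuous_on UNIV f'"
  shows "thin (sublevel f \<inter> suplevel f)"
proof -
  have "bounded (f ` {0..2*pi})" "bounded (f' ` {0..2*pi})"
    by (intro compact_imp_bounded compact_continuous_image continuous_on_subset[OF cont]
        continuous_on_subset[OF cf']; simp)+
  then obtain M N where M: "M > 0" "\<And>t. t \<in> {0..2*pi} \<Longrightarrow> \<bar>f t\<bar> \<le> M"
    and N: "N > 0" "\<And>t. t \<in> {0..2*pi} \<Longrightarrow> \<bar>f' t\<bar> \<le> N" unfolding bounded_pos by auto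
  have "dist (polar (f s) s) (polar (f t) t) \<le> (N + 2 * M) * \<bar>s - t\<bar>"
    if st: "s \<in> {0..2*pi}" "t \<in> {0..2*pi}" for s t
  proof -
    have "norm (f s - f t) \<le> N * norm (s - t)"
      by (rule field_differentiable_bound[of "{0..2*pi}" f f'])
        (use st f' N in \<open>auto intro: has_field_derivative_at_within\<close>)
    moreover have "2 * \<bar>f t\<bar> * \<bar>s - t\<bar> \<le> 2 * M * \<bar>s - t\<bar>" using M(2)[OF st(2)] by (intro mult_right_mono) auto
    ultimately show ?thesis
      using norm_polar_diff[of "f s" s "f t" t] by (simp add: dist_norm algebra_simps)
  qed
  then show ?thesis
    unfolding level_set_eq using M(1) N(1) by (intro thin_lipschitz_curve[where L = "N + 2 * M"]) auto
qed

end

lemma annulus_facts: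
  fixes f g :: "real \<Rightarrow> real"
  assumes f: "\<And>t. f (t + 2 * pi) = f t" "continuous_on UNIV f" "\<And>t. 0 < f t"
    and g: "\<And>t. g (t + 2 * pi) = g t" "continuous_on UNIV g" and fg: "\<And>t. f t < g t"
  shows "polar_annulus f g = - (sublevel f \<union> suplevel g)"
    and "open (polar_annulus f g)"
    and "connected (polar_annulus f g)"
    and "closure (polar_annulus f g) = suplevel f \<inter> sublevel g"
    and "frontier (polar_annulus f g) = (sublevel f \<inter> suplevel f) \<union> (sublevel g \<inter> suplevel g)"
proof -
  have g0: "0 < g t" for t using f(3)[of t] fg[of t] by linarith
  show eq: "polar_annulus f g = - (sublevel f \<union> suplevel g)"
  proof (intro set_eqI iffI)
    fix x assume "x \<in> polar_annulus f g"
    then obtain r t where x: "r > 0" "x = polar r t" "f t < r" "r < g t" by (auto simp: polar_annulus_def)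
    then show "x \<in> - (sublevel f \<union> suplevel g)"
      using angle_polar[of f, OF f(1) x(1)] angle_polar[of g, OF g(1) x(1)] by (simp add: sublevel_def suplevel_def)
  next
    fix x assume "x \<in> - (sublevel f \<union> suplevel g)"
    then have x: "f (angle x) < norm x" "norm x < g (angle x)" by (auto simp: sublevel_def suplevel_def)
    moreover have "norm x > 0" using x(1) f(3)[of "angle x"] by linarith
    ultimately show "x \<in> polar_annulus f g"
      unfolding polar_annulus_def by (intro CollectI exI[of _ "norm x"] exI[of _ "angle x"]) auto
  qed
  have cl: "closed (sublevel f)" "closed (suplevel g)" "closed (suplevel f)" "closed (sublevel g)"
    using compact_imp_closed compact_sublevel[of f] closed_suplevel[of g] closed_suplevel[of f] compact_sublevel[of g] f g g0
    by blast+
  show op: "open (polar_annulus f g)" unfolding eq by (intro open_Compl closed_Un cl)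
  show "connected (polar_annulus f g)"
  proof -
    have "polar_annulus f g = (\<lambda>(t, \<theta>). polar ((1 - t) * f \<theta> + t * g \<theta>) \<theta>) ` ({0<..<1} \<times> UNIV)"
    proof (intro set_eqI iffI)
      fix x assume "x \<in> polar_annulus f g"
      then obtain r \<theta> where x: "x = polar r \<theta>" "f \<theta> < r" "r < g \<theta>" by (auto simp: polar_annulus_def)
      define d where "d = g \<theta> - f \<theta>"
      have d: "d > 0" using x by (simp add: d_def)
      define t where "t = (r - f \<theta>) / d"
      have "t * d = r - f \<theta>" using d by (simp add: t_def)
      then have "(1 - t) * f \<theta> + t * g \<theta> = r" by (simp add: d_def algebra_simps)
      moreover have "t \<in> {0<..<1}" using x d by (auto simp: t_def d_def)
      ultimately show "x \<in> (\<lambda>(t, \<theta>). polar ((1 - t) * f \<theta> + t * g \<theta>) \<theta>) ` ({0<..<1} \<times> UNIV)"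
        using x(1) by (intro rev_image_eqI[of "(t, \<theta>)"]) auto
    next
      fix x assume "x \<in> (\<lambda>(t, \<theta>). polar ((1 - t) * f \<theta> + t * g \<theta>) \<theta>) ` ({0<..<1} \<times> UNIV)"
      then obtain t \<theta> where t: "0 < t" "t < 1" "x = polar ((1 - t) * f \<theta> + t * g \<theta>) \<theta>" by auto
      have "t * f \<theta> < t * g \<theta>" "(1 - t) * f \<theta> < (1 - t) * g \<theta>"
        using t fg[of \<theta>] by (auto intro: mult_strict_left_mono)
      then have "f \<theta> < (1 - t) * f \<theta> + t * g \<theta>" "(1 - t) * f \<theta> + t * g \<theta> < g \<theta>"
        by (auto simp: algebra_simps)
      moreover from this(1) have "(1 - t) * f \<theta> + t * g \<theta> > 0" using f(3)[of \<theta>] by linarith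
      ultimately show "x \<in> polar_annulus f g" unfolding polar_annulus_def using t(3) by blast
    qed
    moreover have "connected ((\<lambda>(t, \<theta>). polar ((1 - t) * f \<theta> + t * g \<theta>) \<theta>) ` ({0<..<1::real} \<times> UNIV))"
      unfolding case_prod_unfold
      by (intro connected_continuous_image connected_Times convex_connected continuous_intros
          continuous_on_compose2[OF f(2)] continuous_on_compose2[OF g(2)]) auto
    ultimately show ?thesis by simp
  qed
  show clos: "closure (polar_annulus f g) = suplevel f \<inter> sublevel g"
  proof
    show "closure (polar_annulus f g) \<subseteq> suplevel f \<inter> sublevel g"
      by (rule closure_minimal) (use cl in \<open>auto simp: eq sublevel_def suplevel_def\<close>)
    show "suplevel f \<inter> sublevel g \<subseteq> closure (polar_annulus f g)"
    proof
      fix x assume x: "x \<in> suplevel f \<inter> sublevel g"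
      define r \<theta> where "r = norm x" and "\<theta> = angle x"
      have r: "f \<theta> \<le> r" "r \<le> g \<theta>" "x = polar r \<theta>" using x by (auto simp: r_def \<theta>_def sublevel_def suplevel_def)
      show "x \<in> closure (polar_annulus f g)"
        unfolding closure_approachable
      proof (intro allI impI)
        fix e :: real assume "e > 0"
        define d where "d = min e (g \<theta> - f \<theta>) / 3"
        have d: "0 < d" "d < e" "3 * d \<le> g \<theta> - f \<theta>" using \<open>e > 0\<close> fg[of \<theta>] by (auto simp: d_def)
        \<comment> \<open>A third of the width guarantees that stepping outwards, or else inwards,
          ends strictly between the two curves.\<close>
        define r' where "r' = (if r + d < g \<theta> then r + d else r - d)"
        have r': "f \<theta> < r'" "r' < g \<theta>" "\<bar>r' - r\<bar> < e" using r d fg[of \<theta>] by (auto simp: r'_def)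
        then have "r' > 0" using f(3)[of \<theta>] by linarith
        then have "polar r' \<theta> \<in> polar_annulus f g" using r' unfolding polar_annulus_def by blast
        moreover have "dist (polar r' \<theta>) x < e"
          using norm_polar_diff[of r' \<theta> r \<theta>] r' r(3) by (simp add: dist_norm)
        ultimately show "\<exists>y\<in>polar_annulus f g. dist y x < e" by blast
      qed
    qed
  qed
  have lt: "sublevel f \<subseteq> sublevel g" "suplevel g \<subseteq> suplevel f"
    using fg by (auto simp: sublevel_def suplevel_def intro: order_trans less_imp_le)
  have "frontier (polar_annulus f g) = (suplevel f \<inter> sublevel g) - - (sublevel f \<union> suplevel g)"
    unfolding frontier_def interior_open[OF op] clos by (simp only: eq)
  also have "\<dots> = (sublevel f \<inter> suplevel f) \<union> (sublevel g \<inter> suplevel g)"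
    using lt by blast
  finally show "frontier (polar_annulus f g) = (sublevel f \<inter> suplevel f) \<union> (sublevel g \<inter> suplevel g)" .
qed

text \<open>Supplies the continuous derivative that makes the boundary curves Lipschitz and permits
  the chain rule along them.\<close>

lemma analytic_on_torus_C1:
  assumes "analytic_on_torus f"
  shows "\<exists>f'. (\<forall>t. (f has_real_derivative f' t) (at t)) \<and> continuous_on UNIV f'"
proof -
  have loc: "\<exists>r>0. \<exists>F. (\<forall>y. \<bar>y - x\<bar> < r \<longrightarrow> (f has_real_derivative F y) (at y)) \<and> isCont F x" for x
  proof -
    obtain r c where r: "r > 0" "\<And>y. \<bar>y - x\<bar> < r \<Longrightarrow> (\<lambda>n. c n * (y - x) ^ n) sums f y"
      using assms unfolding analytic_on_torus_def by blast
    have s: "summable (\<lambda>n. c n * z ^ n)" if "norm z < r" for z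
      using r(2)[of "x + z"] that by (auto simp: sums_iff)
    define F where "F = (\<lambda>y. \<Sum>n. diffs c n * (y - x) ^ n)"
    have D: "(f has_real_derivative F y) (at y)" if y: "\<bar>y - x\<bar> < r" for y
    proof -
      have "((\<lambda>z. \<Sum>n. c n * z ^ n) has_real_derivative (\<Sum>n. diffs c n * (y - x) ^ n)) (at (y - x))"
        by (rule termdiffs_strong'[OF s]) (use y in auto)
      moreover have "((\<lambda>y. y - x) has_real_derivative 1) (at y)"
        by (auto intro!: derivative_eq_intros)
      ultimately have "((\<lambda>y. \<Sum>n. c n * (y - x) ^ n) has_real_derivative F y * 1) (at y)"
        unfolding F_def by (rule DERIV_chain2[where g = "\<lambda>y. y - x"])
      moreover have "eventually (\<lambda>y. y \<in> ball x r) (nhds y)"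
        using y by (intro eventually_nhds_in_open) (auto simp: dist_real_def abs_minus_commute)
      then have "eventually (\<lambda>y. (\<Sum>n. c n * (y - x) ^ n) = f y) (nhds y)"
        by eventually_elim (use r(2) in \<open>auto simp: sums_iff dist_real_def abs_minus_commute\<close>)
      ultimately show ?thesis by (simp add: DERIV_cong_ev)
    qed
    \<comment> \<open>A second termwise differentiation, at the centre only, yields continuity of
      the derivative there; every point serves as a centre.\<close>
    have "((\<lambda>z. \<Sum>n. diffs c n * z ^ n) has_real_derivative (\<Sum>n. diffs (diffs c) n * 0 ^ n)) (at 0)"
    proof (rule termdiffs_strong'[where K = r])
      show "summable (\<lambda>n. diffs c n * z ^ n)" if "norm z < r" for z
        using termdiff_converges[of z r c] s that by auto
    qed (use r in auto)
    then have "isCont (\<lambda>z. \<Sum>n. diffs c n * z ^ n) 0" by (rule DERIV_isCont)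
    then have "isCont F x"
      unfolding F_def by (intro isCont_o2[where f = "\<lambda>y. y - x" and g = "\<lambda>z. \<Sum>n. diffs c n * z ^ n"]) auto
    with D r(1) show ?thesis by blast
  qed
  have "(f has_real_derivative deriv f x) (at x)" for x
  proof -
    obtain r F where "r > 0" "\<And>y. \<bar>y - x\<bar> < r \<Longrightarrow> (f has_real_derivative F y) (at y)" using loc[of x] by blast
    from this(2)[of x] this(1) show ?thesis by (simp add: DERIV_imp_deriv)
  qed
  moreover have "isCont (deriv f) x" for x
  proof -
    obtain r F where r: "r > 0" "\<And>y. \<bar>y - x\<bar> < r \<Longrightarrow> (f has_real_derivative F y) (at y)" and c: "isCont F x"
      using loc[of x] by blast
    have "eventually (\<lambda>y. y \<in> ball x r) (nhds x)"
      using r by (intro eventually_nhds_in_open) auto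
    then have "eventually (\<lambda>y. F y = deriv f y) (nhds x)"
      by eventually_elim (use r(2)[THEN DERIV_imp_deriv] in \<open>auto simp: dist_real_def abs_minus_commute\<close>)
    then show ?thesis using c isCont_cong by blast
  qed
  ultimately show ?thesis
    by (intro exI[of _ "deriv f"]) (auto intro: continuous_at_imp_continuous_on)
qed

section \<open>Analyticity of the gradient\<close>

definition analytic_at :: "(real^2 \<Rightarrow> real) \<Rightarrow> real^2 \<Rightarrow> bool" where
  "analytic_at f x \<longleftrightarrow> (\<exists>R>0. \<exists>N c. series R N c (\<lambda>h. f (x + h)))"

lemma series_cong:
  "(\<And>h. \<bar>h $ 1\<bar> \<le> R \<Longrightarrow> \<bar>h $ 2\<bar> \<le> R \<Longrightarrow> f h = g h) \<Longrightarrow> series R N c f \<longleftrightarrow> series R N c g"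
  unfolding series_def by simp

lemma analytic_at_const: "analytic_at (\<lambda>_. a) x"
  unfolding analytic_at_def using series_const[of 1 a] by (intro exI[of _ 1]) auto

lemma analytic_at_common_radius:
  assumes "analytic_at f x" "analytic_at g x"
  obtains R N c N' d where "R > 0" "series R N c (\<lambda>h. f (x + h))" "series R N' d (\<lambda>h. g (x + h))"
proof -
  obtain R1 N c where 1: "R1 > 0" "series R1 N c (\<lambda>h. f (x + h))" using assms unfolding analytic_at_def by blast
  obtain R2 N' d where 2: "R2 > 0" "series R2 N' d (\<lambda>h. g (x + h))" using assms unfolding analytic_at_def by blast
  show thesis
    using that[OF _ series_radius_mono[OF 1(2)] series_radius_mono[OF 2(2)], of "min R1 R2"] 1 2 by auto
qed

lemma analytic_at_add: "analytic_at f x \<Longrightarrow> analytic_at g x \<Longrightarrow> analytic_at (\<lambda>x. f x + g x) x"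
  by (erule (1) analytic_at_common_radius) (use series_add in \<open>unfold analytic_at_def, blast\<close>)

lemma analytic_at_mult: "analytic_at f x \<Longrightarrow> analytic_at g x \<Longrightarrow> analytic_at (\<lambda>x. f x * g x) x"
  by (erule (1) analytic_at_common_radius) (use series_mult in \<open>unfold analytic_at_def, blast\<close>)

lemma analytic_at_minus: "analytic_at f x \<Longrightarrow> analytic_at (\<lambda>x. - f x) x"
  using analytic_at_mult[OF analytic_at_const[of "-1"], of f x] by simp

lemma analytic_at_transform:
  assumes "analytic_at f x" "open S" "x \<in> S" "\<And>y. y \<in> S \<Longrightarrow> f y = g y"
  shows "analytic_at g x"
proof -
  obtain R N c where s: "R > 0" "series R N c (\<lambda>h. f (x + h))" using assms unfolding analytic_at_def by blast
  obtain e where e: "e > 0" "ball x e \<subseteq> S" using assms(2,3) open_contains_ball by blast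
  define r where "r = min R (e / 3)"
  have r: "0 < r" "r \<le> R" "2 * r < e" using s(1) e(1) by (auto simp: r_def)
  have "series r N c (\<lambda>h. f (x + h))" using series_radius_mono[OF s(2)] r by blast
  moreover have "f (x + h) = g (x + h)" if "\<bar>h $ 1\<bar> \<le> r" "\<bar>h $ 2\<bar> \<le> r" for h
  proof (rule assms(4))
    have "norm h < e" using norm_le_2[of h] that r by linarith
    then show "x + h \<in> S" using e(2) by (auto simp: subset_iff dist_norm)
  qed
  ultimately have "series r N c (\<lambda>h. g (x + h))" using series_cong[of r "\<lambda>h. f (x + h)" "\<lambda>h. g (x + h)"] by blast
  with r show ?thesis unfolding analytic_at_def by blast
qed

lemma real_analytic_onI:
  assumes "\<And>x. x \<in> U \<Longrightarrow> analytic_at f x"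
  shows "real_analytic_on f U"
  unfolding real_analytic_on_def
proof
  fix x assume "x \<in> U"
  then obtain R N c where s: "R > 0" "series R N c (\<lambda>h. f (x + h))" using assms unfolding analytic_at_def by blast
  have "((\<lambda>(i, j). c (i, j) * (y $ 1 - x $ 1) ^ i * (y $ 2 - x $ 2) ^ j) has_sum f y) UNIV" if "y \<in> ball x R" for y
  proof -
    have "\<bar>(y - x) $ i\<bar> \<le> R" for i
      using component_le_norm_cart[of "y - x" i] that by (simp add: dist_norm norm_minus_commute)
    then have "((\<lambda>k. c k * mon (y - x) k) has_sum f (x + (y - x))) UNIV"
      using s(2) unfolding series_def by blast
    then show ?thesis by (simp add: mon_def case_prod_unfold mult.assoc)
  qed
  then show "\<exists>r>0. \<exists>c. \<forall>y\<in>ball x r.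
      ((\<lambda>(i, j). c i j * (y $ 1 - x $ 1) ^ i * (y $ 2 - x $ 2) ^ j) has_sum f y) UNIV"
    using s(1) by (intro exI[of _ R] conjI exI[of _ "\<lambda>i j. c (i, j)"]) auto
qed

lemma partial_derivatives:
  fixes f :: "real^2 \<Rightarrow> real"
  assumes "(f has_derivative f') (at (x + pt a b))"
  shows "((\<lambda>a. f (x + pt a b)) has_real_derivative f' (axis 1 1)) (at a)"
    and "((\<lambda>b. f (x + pt a b)) has_real_derivative f' (axis 2 1)) (at b)"
proof -
  note lin = has_derivative_linear[OF assms]
  have 1: "((\<lambda>a. x + pt a b) has_derivative (\<lambda>h. h *\<^sub>R axis 1 1)) (at a)"
    unfolding pt_axis by (auto intro!: derivative_eq_intros)
  have "((\<lambda>a. f (x + pt a b)) has_derivative (\<lambda>h. f' (h *\<^sub>R axis 1 1))) (at a)"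
    by (rule has_derivative_compose[OF 1 assms])
  then show "((\<lambda>a. f (x + pt a b)) has_real_derivative f' (axis 1 1)) (at a)"
    by (simp add: has_field_derivative_def linear_scale[OF lin] mult_commute_abs)
  have 2: "((\<lambda>b. x + pt a b) has_derivative (\<lambda>h. h *\<^sub>R axis 2 1)) (at b)"
    unfolding pt_axis by (auto intro!: derivative_eq_intros)
  have "((\<lambda>b. f (x + pt a b)) has_derivative (\<lambda>h. f' (h *\<^sub>R axis 2 1))) (at b)"
    by (rule has_derivative_compose[OF 2 assms])
  then show "((\<lambda>b. f (x + pt a b)) has_real_derivative f' (axis 2 1)) (at b)"
    by (simp add: has_field_derivative_def linear_scale[OF lin] mult_commute_abs)
qed

text \<open>The derivative is identified with the formal series on an open box, while
  \<open>series\<close> speaks of a closed one, hence the smaller radius. The coefficients are kept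
  explicit so that mixed derivatives can be compared.\<close>

lemma series_partials:
  fixes f :: "real^2 \<Rightarrow> real"
  assumes s: "series R N c (\<lambda>h. f (x + h))" and r: "0 < r" "r < R"
    and f': "\<And>h. \<bar>h $ 1\<bar> \<le> r \<Longrightarrow> \<bar>h $ 2\<bar> \<le> r \<Longrightarrow> (f has_derivative f' (x + h)) (at (x + h))"
  shows "\<exists>N'. series (r / 2) N' (dcoeff c) (\<lambda>h. f' (x + h) (axis 1 1))"
    and "\<exists>N'. series (r / 2) N' (dcoeff (c \<circ> prod.swap) \<circ> prod.swap) (\<lambda>h. f' (x + h) (axis 2 1))"
proof -
  obtain N1 g1 where g1: "series r N1 (dcoeff c) g1"
    "\<And>a b. \<bar>a\<bar> < r \<Longrightarrow> \<bar>b\<bar> < r \<Longrightarrow> ((\<lambda>a. f (x + pt a b)) has_real_derivative g1 (pt a b)) (at a)"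
    using series_has_derivative_1[OF s r] by blast
  obtain N2 g2 where g2: "series r N2 (dcoeff (c \<circ> prod.swap)) g2"
    "\<And>a b. \<bar>a\<bar> < r \<Longrightarrow> \<bar>b\<bar> < r \<Longrightarrow> ((\<lambda>a. ((\<lambda>h. f (x + h)) \<circ> flip) (pt a b)) has_real_derivative g2 (pt a b)) (at a)"
    using series_has_derivative_1[OF series_flip[OF s] r] by blast
  have eq: "f' (x + h) (axis 1 1) = g1 h" "f' (x + h) (axis 2 1) = g2 (flip h)"
    if h: "\<bar>h $ 1\<bar> \<le> r / 2" "\<bar>h $ 2\<bar> \<le> r / 2" for h
  proof -
    have lt: "\<bar>h $ 1\<bar> < r" "\<bar>h $ 2\<bar> < r" using h r by auto
    have "(f has_derivative f' (x + h)) (at (x + pt (h $ 1) (h $ 2)))" using f'[of h] lt by simp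
    note p = partial_derivatives[OF this]
    show "f' (x + h) (axis 1 1) = g1 h"
      using DERIV_unique[OF p(1) g1(2)[OF lt]] by simp
    have "((\<lambda>b. f (x + pt (h $ 1) b)) has_real_derivative g2 (pt (h $ 2) (h $ 1))) (at (h $ 2))"
      using g2(2)[OF lt(2,1)] by simp
    from DERIV_unique[OF p(2) this] show "f' (x + h) (axis 2 1) = g2 (flip h)" by (simp add: flip_def)
  qed
  have "series (r / 2) N1 (dcoeff c) g1" by (rule series_radius_mono[OF g1(1)]) (use r in auto)
  then show "\<exists>N'. series (r / 2) N' (dcoeff c) (\<lambda>h. f' (x + h) (axis 1 1))"
    using series_cong[of "r / 2" "\<lambda>h. f' (x + h) (axis 1 1)" g1] eq(1) by blast
  have "series (r / 2) N2 (dcoeff (c \<circ> prod.swap) \<circ> prod.swap) (g2 \<circ> flip)"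
    by (rule series_radius_mono[OF series_flip[OF g2(1)]]) (use r in auto)
  then show "\<exists>N'. series (r / 2) N' (dcoeff (c \<circ> prod.swap) \<circ> prod.swap) (\<lambda>h. f' (x + h) (axis 2 1))"
    using series_cong[of "r / 2" "\<lambda>h. f' (x + h) (axis 2 1)" "g2 \<circ> flip"] eq(2) by simp blast
qed

text \<open>Symmetry of \<open>D2u\<close> is read off the power series of \<open>u\<close>:
  differentiating in either order, the value at the centre is the coefficient
  \<open>c (1, 1)\<close>.\<close>

theorem helmholtz_gradient_analytic:
  fixes u :: "real^2 \<Rightarrow> real" and Du :: "real^2 \<Rightarrow> real^2" and D2u :: "real^2 \<Rightarrow> real^2 \<Rightarrow> real^2"
  assumes \<Omega>: "open \<Omega>" "x \<in> \<Omega>"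
    and u1: "\<And>x. x \<in> \<Omega> \<Longrightarrow> (u has_derivative (\<lambda>h. Du x \<bullet> h)) (at x)"
    and u2: "\<And>x. x \<in> \<Omega> \<Longrightarrow> (Du has_derivative D2u x) (at x)"
    and hz: "\<And>x. x \<in> \<Omega> \<Longrightarrow> D2u x (axis 1 1) $ 1 + D2u x (axis 2 1) $ 2 + \<mu> * u x = 0"
  shows "analytic_at u x" "analytic_at (\<lambda>x. Du x $ i) x" "D2u x (axis 1 1) $ 2 = D2u x (axis 2 1) $ 1"
proof -
  obtain \<rho> where \<rho>: "\<rho> > 0" "ball x \<rho> \<subseteq> \<Omega>" using \<Omega> open_contains_ball by blast
  obtain R N c where R: "R > 0" "R \<le> \<rho>" "series R N c (\<lambda>h. u (x + h))"
    using helmholtz_analytic[of x \<rho> u Du D2u \<mu>] u1 u2 hz \<rho> by blast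
  then show "analytic_at u x" unfolding analytic_at_def by blast
  define r where "r = R / 3"
  have r: "0 < r" "r < R" using R(1) by (auto simp: r_def)
  have in\<Omega>: "x + h \<in> \<Omega>" if "\<bar>h $ 1\<bar> \<le> r" "\<bar>h $ 2\<bar> \<le> r" for h
  proof -
    have "norm h < \<rho>" using norm_le_2[of h] that R r by (simp add: r_def)
    then show ?thesis using \<rho>(2) by (auto simp: subset_iff dist_norm)
  qed
  obtain N1 N2 where s1: "series (r / 2) N1 (dcoeff c) (\<lambda>h. Du (x + h) \<bullet> axis 1 1)"
    and s2: "series (r / 2) N2 (dcoeff (c \<circ> prod.swap) \<circ> prod.swap) (\<lambda>h. Du (x + h) \<bullet> axis 2 1)"
    using series_partials[OF R(3) r, of "\<lambda>y h. Du y \<bullet> h"] u1 in\<Omega> by blast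
  have s1: "series (r / 2) N1 (dcoeff c) (\<lambda>h. Du (x + h) $ 1)"
    and s2: "series (r / 2) N2 (dcoeff (c \<circ> prod.swap) \<circ> prod.swap) (\<lambda>h. Du (x + h) $ 2)"
    using s1 s2 by (simp_all add: inner_axis)
  show "analytic_at (\<lambda>x. Du x $ i) x"
    using exhaust_2[of i] s1 s2 r unfolding analytic_at_def by (metis half_gt_zero)
  have q: "0 < r / 4" "r / 4 < r / 2" using r by auto
  have D: "((\<lambda>x. Du x $ i) has_derivative (\<lambda>k. D2u (x + h) k $ i)) (at (x + h))"
    if "\<bar>h $ 1\<bar> \<le> r / 4" "\<bar>h $ 2\<bar> \<le> r / 4" for h i
    by (rule bounded_linear.has_derivative[OF bounded_linear_vec_nth u2[OF in\<Omega>]]) (use that r in auto)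
  obtain M1 where t1: "series (r / 4 / 2) M1 (dcoeff (dcoeff c \<circ> prod.swap) \<circ> prod.swap) (\<lambda>h. D2u (x + h) (axis 2 1) $ 1)"
    using series_partials(2)[OF s1 q, of "\<lambda>y k. D2u y k $ 1"] D by blast
  obtain M2 where t2: "series (r / 4 / 2) M2 (dcoeff (dcoeff (c \<circ> prod.swap) \<circ> prod.swap)) (\<lambda>h. D2u (x + h) (axis 1 1) $ 2)"
    using series_partials(1)[OF s2 q, of "\<lambda>y k. D2u y k $ 2"] D by blast
  show "D2u x (axis 1 1) $ 2 = D2u x (axis 2 1) $ 1"
    using series_at_0[OF t1] series_at_0[OF t2] r by (simp add: dcoeff_def)
qed

text \<open>The set where \<open>f\<close> vanishes identically nearby is open and closed.\<close>

lemma analytic_identity: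
  assumes \<Omega>: "open \<Omega>" "connected \<Omega>" and f: "\<And>x. x \<in> \<Omega> \<Longrightarrow> analytic_at f x"
    and W: "open W" "W \<noteq> {}" "W \<subseteq> \<Omega>" "\<And>x. x \<in> W \<Longrightarrow> f x = 0" and x: "x \<in> \<Omega>"
  shows "f x = 0"
proof -
  define Z where "Z = interior {x \<in> \<Omega>. f x = 0}"
  have "open Z" by (simp add: Z_def)
  have WZ: "W \<subseteq> Z" unfolding Z_def using W by (intro interior_maximal) auto
  have Z\<Omega>: "Z \<subseteq> \<Omega>" unfolding Z_def using interior_subset by blast
  have "y \<in> Z" if y: "y \<in> \<Omega>" "y \<in> closure Z" for y
  proof -
    obtain R N c where s: "R > 0" "series R N c (\<lambda>h. f (y + h))" using f[OF y(1)] unfolding analytic_at_def by blast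
    obtain z where z: "z \<in> Z" "dist z y < R" using y(2) s(1) unfolding closure_approachable by blast
    obtain e where e: "e > 0" "ball z e \<subseteq> Z" using \<open>open Z\<close> z(1) open_contains_ball by blast
    have zero: "f (y + h) = 0" if h: "\<bar>h $ 1\<bar> < R" "\<bar>h $ 2\<bar> < R" for h
    proof (rule series_identity[OF s(2), where p = "z - y" and \<epsilon> = "e / 2"])
      show "\<bar>(z - y) $ 1\<bar> < R" "\<bar>(z - y) $ 2\<bar> < R"
        using component_le_norm_cart[of "z - y"] z(2) by (auto simp: dist_norm intro: le_less_trans)
      fix k :: "real^2" assume k: "\<bar>k $ 1 - (z - y) $ 1\<bar> < e / 2" "\<bar>k $ 2 - (z - y) $ 2\<bar> < e / 2"
      have "norm (y + k - z) < e"
        using norm_le_2[of "y + k - z"] k by (simp add: algebra_simps)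
      then have "y + k \<in> Z" using e(2) by (auto simp: subset_iff dist_norm norm_minus_commute)
      then show "f (y + k) = 0" unfolding Z_def using interior_subset by blast
    qed (use e h in auto)
    have "ball y R \<inter> \<Omega> \<subseteq> {x \<in> \<Omega>. f x = 0}"
    proof
      fix w assume w: "w \<in> ball y R \<inter> \<Omega>"
      then have "\<bar>(w - y) $ i\<bar> < R" for i
        using component_le_norm_cart[of "w - y" i] by (auto simp: dist_norm norm_minus_commute)
      then have "f (y + (w - y)) = 0" by (intro zero)
      with w show "w \<in> {x \<in> \<Omega>. f x = 0}" by simp
    qed
    then have "ball y R \<inter> \<Omega> \<subseteq> Z" unfolding Z_def using \<Omega> by (intro interior_maximal) auto
    then show ?thesis using y(1) s(1) by auto
  qed
  then have "\<Omega> \<inter> closure Z = Z" using Z\<Omega> closure_subset by blast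
  then have "closedin (top_of_set \<Omega>) Z"
    by (metis closed_closure closedin_closed_Int)
  moreover have "openin (top_of_set \<Omega>) Z" using \<open>open Z\<close> Z\<Omega> by (simp add: open_subset)
  ultimately have "Z = {} \<or> Z = \<Omega>" using \<Omega>(2) connected_clopen by blast
  then have "Z = \<Omega>" using WZ W(2) by blast
  then show ?thesis using x interior_subset unfolding Z_def by blast
qed

section \<open>The stationary Euler flow\<close>

lemma L2_loc_continuous:
  assumes "continuous_on UNIV v"
  shows "L2_loc v"
  unfolding L2_loc_def
proof (intro conjI allI impI)
  show "v \<in> borel_measurable lborel"
    using borel_measurable_continuous_onI[OF assms] by simp
  fix K :: "(real^2) set" assume K: "compact K"
  have "continuous_on K (\<lambda>x. norm (v x) ^ 2)"
    using continuous_on_subset[OF assms, of K] by (intro continuous_intros) auto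
  then show "set_integrable lborel K (\<lambda>x. norm (v x) ^ 2)"
    unfolding set_integrable_def by (rule borel_integrable_compact[OF K])
qed

lemma L1_loc_continuous:
  assumes "continuous_on UNIV p"
  shows "L1_loc p"
  unfolding L1_loc_def
proof (intro conjI allI impI)
  show "p \<in> borel_measurable lborel"
    using borel_measurable_continuous_onI[OF assms] by simp
  fix K :: "(real^2) set" assume K: "compact K"
  show "set_integrable lborel K p"
    unfolding set_integrable_def
    by (rule borel_integrable_compact[OF K continuous_on_subset[OF assms subset_UNIV]])
qed

text \<open>The divergence of the \<open>j\<close>-th row of the momentum tensor is the
  \<open>j\<close>-th momentum expression plus \<open>v x $ j\<close> times the divergence of
  \<open>v\<close>. Testing row \<open>j\<close> with component \<open>j\<close> of \<open>w\<close>
  and adding the two integrals gives the weak equation.\<close>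

lemma stationary_weak_eulerI:
  assumes v: "continuous_on UNIV v" and p: "continuous_on UNIV p" and \<Gamma>: "thin \<Gamma>"
    and v': "\<And>x. x \<notin> \<Gamma> \<Longrightarrow> (v has_derivative v' x) (at x)"
    and p': "\<And>x. x \<notin> \<Gamma> \<Longrightarrow> (p has_derivative p' x) (at x)"
    and mass: "\<And>x. x \<notin> \<Gamma> \<Longrightarrow> v' x (axis 1 1) $ 1 + v' x (axis 2 1) $ 2 = 0"
    and momentum: "\<And>x j. x \<notin> \<Gamma> \<Longrightarrow>
      v x $ 1 * v' x (axis 1 1) $ j + v x $ 2 * v' x (axis 2 1) $ j + p' x (axis j 1) = 0"
  shows "stationary_weak_euler v p"
  unfolding stationary_weak_euler_def
proof (intro conjI allI impI)
  show "L2_loc v" by (rule L2_loc_continuous[OF v])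
  show "L1_loc p" by (rule L1_loc_continuous[OF p])
  fix \<phi> assume "test_fun \<phi>"
  then show "(\<integral>x. v x \<bullet> grad \<phi> x \<partial>lborel) = 0"
    by (rule weakly_divergence_free(2)[OF v \<Gamma> _ v' mass])
next
  fix w assume w: "test_field w"
  define F where "F = (\<lambda>j x. v x $ j *\<^sub>R v x + p x *\<^sub>R axis j 1)"
  have cF: "continuous_on UNIV (F j)" for j
    unfolding F_def using v p by (intro continuous_intros) auto
  have F': "(F j has_derivative (\<lambda>h. v x $ j *\<^sub>R v' x h + v' x h $ j *\<^sub>R v x + p' x h *\<^sub>R axis j 1)) (at x)"
    if "x \<notin> \<Gamma>" for j x
    unfolding F_def
    by (intro has_derivative_add has_derivative_scaleR has_derivative_scaleR_left p'[OF that] v'[OF that]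
        bounded_linear.has_derivative[OF bounded_linear_vec_nth])
  have div: "(v x $ j *\<^sub>R v' x (axis 1 1) + v' x (axis 1 1) $ j *\<^sub>R v x + p' x (axis 1 1) *\<^sub>R axis j 1) $ 1 +
      (v x $ j *\<^sub>R v' x (axis 2 1) + v' x (axis 2 1) $ j *\<^sub>R v x + p' x (axis 2 1) *\<^sub>R axis j 1) $ 2 = 0"
    if "x \<notin> \<Gamma>" for j x
  proof -
    have "v x $ j * (v' x (axis 1 1) $ 1 + v' x (axis 2 1) $ 2) = 0" using mass[OF that] by simp
    moreover have "p' x (axis 1 1) * axis j 1 $ 1 + p' x (axis 2 1) * axis j 1 $ 2 = p' x (axis j 1)"
      using exhaust_2[of j] by (auto simp: axis_def)
    ultimately show ?thesis using momentum[OF that, of j] by (simp add: algebra_simps)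
  qed
  have tw: "test_fun (\<lambda>y. w y $ j)" for j using w by (simp add: test_field_def)
  have W: "integrable lborel (\<lambda>x. F j x \<bullet> grad (\<lambda>y. w y $ j) x)"
    "(\<integral>x. F j x \<bullet> grad (\<lambda>y. w y $ j) x \<partial>lborel) = 0" for j
    using weakly_divergence_free[OF cF[of j] \<Gamma> tw[of j] F' div] by auto
  have "(\<Sum>i\<in>UNIV. \<Sum>j\<in>UNIV. v x $ i * v x $ j * pd i (\<lambda>y. w y $ j) x) + p x * (\<Sum>i\<in>UNIV. pd i (\<lambda>y. w y $ i) x)
      = F 1 x \<bullet> grad (\<lambda>y. w y $ 1) x + F 2 x \<bullet> grad (\<lambda>y. w y $ 2) x" for x
    by (simp add: sum_2 F_def inner_2 grad_def axis_def algebra_simps)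
  then show "(\<integral>x. (\<Sum>i\<in>UNIV. \<Sum>j\<in>UNIV. v x $ i * v x $ j * pd i (\<lambda>y. w y $ j) x)
             + p x * (\<Sum>i\<in>UNIV. pd i (\<lambda>y. w y $ i) x) \<partial>lborel) = 0"
    using W by simp
qed

text \<open>The derivative of \<open>u\<close> is only one-sided, relative to \<open>K\<close>. The
  curve stays in \<open>K\<close>, so the chain rule holds along it, and the gradient vanishes
  there.\<close>

lemma constant_on_boundary_curve:
  fixes u :: "real^2 \<Rightarrow> real"
  assumes u: "\<And>x. x \<in> K \<Longrightarrow> (u has_derivative (\<lambda>h. Du x \<bullet> h)) (at x within K)"
    and \<gamma>: "\<And>t. polar (f t) t \<in> K" "\<And>t. Du (polar (f t) t) = 0"
    and f: "\<And>t. (f has_real_derivative f' t) (at t)"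
  shows "u (polar (f t) t) = u (polar (f 0) 0)"
proof -
  have fd: "(f has_derivative (\<lambda>h. h * f' t)) (at t)" for t
    using f[of t] unfolding has_field_derivative_def by (simp add: mult_commute_abs)
  have "\<exists>\<gamma>'. ((\<lambda>t. polar (f t) t) has_derivative \<gamma>') (at t)" for t
    unfolding polar_pt
    by (rule exI, rule has_derivative_pt)
      (rule has_derivative_mult[OF fd DERIV_cos[unfolded has_field_derivative_def]],
       rule has_derivative_mult[OF fd DERIV_sin[unfolded has_field_derivative_def]])
  then obtain \<gamma>' where \<gamma>': "\<And>t. ((\<lambda>t. polar (f t) t) has_derivative \<gamma>' t) (at t)" by metis
  have "((\<lambda>t. u (polar (f t) t)) has_derivative (\<lambda>h. Du (polar (f t) t) \<bullet> \<gamma>' t h)) (at t)" for t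
  proof (rule has_derivative_in_compose[where g = u, OF \<gamma>'])
    show "(u has_derivative (\<lambda>h. Du (polar (f t) t) \<bullet> h)) (at (polar (f t) t) within range (\<lambda>t. polar (f t) t))"
      using \<gamma>(1) by (intro has_derivative_subset[OF u]) auto
  qed
  then have "((\<lambda>t. u (polar (f t) t)) has_real_derivative 0) (at t)" for t
    by (simp add: \<gamma>(2) has_field_derivative_def lambda_zero)
  then show ?thesis by (intro DERIV_isconst_all) auto
qed

text \<open>Separates the flow construction from the special form of the domains: the geometry
  enters through two periodic C1 radii only.\<close>

theorem euler_from_overdetermined:
  fixes u :: "real^2 \<Rightarrow> real" and Du :: "real^2 \<Rightarrow> real^2" and D2u :: "real^2 \<Rightarrow> real^2 \<Rightarrow> real^2"
    and f g f' g' :: "real \<Rightarrow> real"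
  defines "\<Omega> \<equiv> polar_annulus f g"
  assumes f: "\<And>t. f (t + 2 * pi) = f t" "\<And>t. (f has_real_derivative f' t) (at t)" "continuous_on UNIV f'" "\<And>t. 0 < f t"
    and g: "\<And>t. g (t + 2 * pi) = g t" "\<And>t. (g has_real_derivative g' t) (at t)" "continuous_on UNIV g'"
    and fg: "\<And>t. f t < g t"
    and u1: "\<And>x. x \<in> closure \<Omega> \<Longrightarrow> (u has_derivative (\<lambda>h. Du x \<bullet> h)) (at x within closure \<Omega>)"
    and Du: "continuous_on (closure \<Omega>) Du"
    and u2: "\<And>x. x \<in> \<Omega> \<Longrightarrow> (Du has_derivative D2u x) (at x)"
    and hz: "\<And>x. x \<in> \<Omega> \<Longrightarrow> D2u x (axis 1 1) $ 1 + D2u x (axis 2 1) $ 2 + \<mu> * u x = 0"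
    and bd: "\<And>x. x \<in> frontier \<Omega> \<Longrightarrow> Du x = 0"
    and nonconst: "\<And>c. \<exists>x\<in>\<Omega>. u x \<noteq> c"
  shows "\<exists>v p. continuous_on UNIV v \<and> continuous_on UNIV p \<and>
           compact (closure {x. v x \<noteq> 0}) \<and> compact (closure {x. p x \<noteq> 0}) \<and>
           stationary_weak_euler v p \<and>
           closure {x. v x \<noteq> 0} = closure \<Omega> \<and>
           (\<forall>i. real_analytic_on (\<lambda>x. v x $ i) \<Omega>) \<and> real_analytic_on p \<Omega>"
proof -
  have cf: "continuous_on UNIV f" and cg: "continuous_on UNIV g"
    using f(2) g(2) by (meson DERIV_isCont continuous_at_imp_continuous_on)+
  have g0: "0 < g t" for t using f(4)[of t] fg[of t] by linarith
  note facts = annulus_facts[of f g, OF f(1) cf f(4) g(1) cg fg, folded \<Omega>_def]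
  have cl: "closed (sublevel f)" "closed (suplevel f)" "closed (sublevel g)" "closed (suplevel g)"
    using compact_sublevel[of f, OF f(1) cf f(4)] compact_sublevel[of g, OF g(1) cg g0]
      closed_suplevel[of f, OF f(1) cf f(4)] closed_suplevel[of g, OF g(1) cg g0] compact_imp_closed by blast+
  have thin: "thin (frontier \<Omega>)"
    unfolding facts(5)
    by (intro thin_Un thin_level_set[of f, OF f(1) cf f(4) f(2,3)] thin_level_set[of g, OF g(1) cg g0 g(2,3)])
  have disj: "sublevel f \<inter> suplevel g = {}"
  proof -
    have False if "norm x \<le> f (angle x)" "g (angle x) \<le> norm x" for x
      using that fg[of "angle x"] by linarith
    then show ?thesis by (auto simp: sublevel_def suplevel_def)
  qed
  have sub_closure: "\<Omega> \<subseteq> closure \<Omega>" by (rule closure_subset)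
  have u1': "(u has_derivative (\<lambda>h. Du x \<bullet> h)) (at x)" if "x \<in> \<Omega>" for x
  proof -
    have "(u has_derivative (\<lambda>h. Du x \<bullet> h)) (at x within \<Omega>)"
      using u1[of x] that sub_closure by (intro has_derivative_subset[OF u1]) auto
    then show ?thesis using at_within_open[OF that facts(2)] by simp
  qed
  define cin cout where "cin = u (polar (f 0) 0)" and "cout = u (polar (g 0) 0)"
  have front: "polar (f t) t \<in> frontier \<Omega>" "polar (g t) t \<in> frontier \<Omega>" for t
  proof -
    have "polar (f t) t \<in> sublevel f \<inter> suplevel f"
      using angle_polar[of f, OF f(1) f(4)[of t]] f(4)[of t] by (simp add: sublevel_def suplevel_def)
    then show "polar (f t) t \<in> frontier \<Omega>" unfolding facts(5) by blast
    have "polar (g t) t \<in> sublevel g \<inter> suplevel g"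
      using angle_polar[of g, OF g(1) g0[of t]] g0[of t] by (simp add: sublevel_def suplevel_def)
    then show "polar (g t) t \<in> frontier \<Omega>" unfolding facts(5) by blast
  qed
  have front': "frontier \<Omega> \<subseteq> closure \<Omega>" by (simp add: frontier_def Diff_subset)
  have u_in: "u x = cin" if x: "x \<in> sublevel f \<inter> suplevel f" for x
  proof -
    obtain t where "x = polar (f t) t" using x unfolding level_set_eq[of f, OF f(1) cf f(4)] by blast
    then show ?thesis
      unfolding cin_def using constant_on_boundary_curve[OF u1 _ _ f(2), of t] front bd front' by blast
  qed
  have u_out: "u x = cout" if x: "x \<in> sublevel g \<inter> suplevel g" for x
  proof -
    obtain t where "x = polar (g t) t" using x unfolding level_set_eq[of g, OF g(1) cg g0] by blast
    then show ?thesis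
      unfolding cout_def using constant_on_boundary_curve[OF u1 _ _ g(2), of t] front bd front' by blast
  qed
  define V where "V = (\<lambda>x. pt (- Du x $ 2) (Du x $ 1))"
  \<comment> \<open>The constant \<open>\<mu> * cout\<^sup>2 / 2\<close> normalizes the pressure to
    0 on the outer curve, where \<open>Du = 0\<close> and \<open>u = cout\<close>.\<close>
  define P where "P = (\<lambda>x. \<mu> * cout\<^sup>2 / 2 + - (1 / 2) * (Du x $ 1 * Du x $ 1 + Du x $ 2 * Du x $ 2 + \<mu> * (u x * u x)))"
  \<comment> \<open>The value in the hole is what \<open>P\<close> takes on the inner curve, where
    \<open>u = cin\<close>.\<close>
  define q where "q = (\<lambda>x. if x \<in> sublevel f then \<mu> * (cout\<^sup>2 - cin\<^sup>2) / 2 else 0)"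
  define v where "v = (\<lambda>x. if x \<in> closure \<Omega> then V x else 0)"
  define p where "p = (\<lambda>x. if x \<in> closure \<Omega> then P x else q x)"
  have cu: "continuous_on (closure \<Omega>) u" using u1 by (rule has_derivative_continuous_on)
  have cV: "continuous_on (closure \<Omega>) V" unfolding V_def by (intro continuous_intros Du)
  have cP: "continuous_on (closure \<Omega>) P" unfolding P_def by (intro continuous_intros Du cu)
  have closed_compl: "closed (- \<Omega>)" using facts(2) by (rule closed_Compl)
  \<comment> \<open>Two closed sets whose intersection is the frontier; continuity follows by
    pasting once the two definitions agree there.\<close>
  have UN: "UNIV = closure \<Omega> \<union> - \<Omega>" using sub_closure by blast
  have V0: "V x = 0" if "x \<in> frontier \<Omega>" for x using bd[OF that] by (simp add: V_def pt_arith)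
  have front_iff: "x \<in> closure \<Omega> \<and> x \<in> - \<Omega> \<longleftrightarrow> x \<in> frontier \<Omega>" for x
    unfolding frontier_def interior_open[OF facts(2)] by blast
  have cv: "continuous_on UNIV v"
    unfolding v_def UN
  proof (rule continuous_on_cases[OF closed_closure closed_compl cV continuous_on_const])
    show "\<forall>x. x \<in> closure \<Omega> \<and> x \<notin> closure \<Omega> \<or> x \<in> - \<Omega> \<and> x \<in> closure \<Omega> \<longrightarrow> V x = 0"
      using V0 front_iff by blast
  qed
  have cq: "continuous_on (- \<Omega>) q"
  proof -
    have "- \<Omega> = sublevel f \<union> suplevel g" using facts(1) by blast
    then show ?thesis
      unfolding q_def
      using continuous_on_cases[OF cl(1,4) continuous_on_const continuous_on_const, of "\<lambda>x. x \<in> sublevel f"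
          "\<mu> * (cout\<^sup>2 - cin\<^sup>2) / 2" 0] disj by auto
  qed
  have Pq: "P x = q x" if "x \<in> frontier \<Omega>" for x
  proof -
    have P: "P x = \<mu> * cout\<^sup>2 / 2 - \<mu> * (u x)\<^sup>2 / 2" using bd[OF that] by (simp add: P_def power2_eq_square)
    from that consider "x \<in> sublevel f \<inter> suplevel f" | "x \<in> sublevel g \<inter> suplevel g" unfolding facts(5) by blast
    then show ?thesis
    proof cases
      case 1
      then show ?thesis using u_in[OF 1] by (simp add: P q_def algebra_simps diff_divide_distrib)
    next
      case 2
      then have "x \<notin> sublevel f" using disj by blast
      then show ?thesis using u_out[OF 2] by (simp add: P q_def)
    qed
  qed
  have cp: "continuous_on UNIV p"
    unfolding p_def UN
  proof (rule continuous_on_cases[OF closed_closure closed_compl cP cq])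
    show "\<forall>x. x \<in> closure \<Omega> \<and> x \<notin> closure \<Omega> \<or> x \<in> - \<Omega> \<and> x \<in> closure \<Omega> \<longrightarrow> P x = q x"
      using Pq front_iff by blast
  qed
  have grad_an: "analytic_at u x" "analytic_at (\<lambda>x. Du x $ i) x"
    and sym: "D2u x (axis 1 1) $ 2 = D2u x (axis 2 1) $ 1" if "x \<in> \<Omega>" for x i
    using helmholtz_gradient_analytic[OF facts(2) that u1' u2 hz] by blast+
  have v_eq: "V y = v y" and p_eq: "P y = p y" if "y \<in> \<Omega>" for y
    using that sub_closure by (auto simp: v_def p_def)
  have an_v: "real_analytic_on (\<lambda>x. v x $ i) \<Omega>" for i
  proof (rule real_analytic_onI)
    fix x assume x: "x \<in> \<Omega>"
    have "analytic_at (\<lambda>x. V x $ i) x"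
      using exhaust_2[of i] grad_an(2)[OF x] analytic_at_minus by (auto simp: V_def)
    then show "analytic_at (\<lambda>x. v x $ i) x"
      by (rule analytic_at_transform[OF _ facts(2) x]) (simp add: v_eq)
  qed
  have an_p: "real_analytic_on p \<Omega>"
  proof (rule real_analytic_onI)
    fix x assume x: "x \<in> \<Omega>"
    have "analytic_at P x"
      unfolding P_def by (intro analytic_at_add analytic_at_mult analytic_at_const grad_an[OF x])
    then show "analytic_at p x"
      by (rule analytic_at_transform[OF _ facts(2) x]) (simp add: p_eq)
  qed
  have supp: "closure {x. v x \<noteq> 0} = closure \<Omega>"
  proof
    have "{x. v x \<noteq> 0} \<subseteq> \<Omega>"
      using V0 front_iff by (auto simp: v_def split: if_splits)
    then show "closure {x. v x \<noteq> 0} \<subseteq> closure \<Omega>" by (rule closure_mono)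
    show "closure \<Omega> \<subseteq> closure {x. v x \<noteq> 0}"
    proof (rule closure_minimal)
      show "\<Omega> \<subseteq> closure {x. v x \<noteq> 0}"
      proof (rule ccontr)
        assume neg: "\<not> \<Omega> \<subseteq> closure {x. v x \<noteq> 0}"
        define W where "W = \<Omega> - closure {x. v x \<noteq> 0}"
        have W: "open W" "W \<noteq> {}" "W \<subseteq> \<Omega>"
          using neg facts(2) by (auto simp: W_def open_Diff)
        have "v x = 0" if "x \<in> W" for x using that closure_subset[of "{x. v x \<noteq> 0}"] by (auto simp: W_def)
        then have "V x = 0" if "x \<in> W" for x using that v_eq W(3) by auto
        then have "Du x $ i = 0" if "x \<in> W" for x i
          using that exhaust_2[of i] by (auto simp: V_def vec_eq_iff forall_2)
        then have "Du x $ i = 0" if "x \<in> \<Omega>" for x i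
          by (intro analytic_identity[OF facts(2,3) grad_an(2) W _ that]) auto
        then have "Du x = 0" if "x \<in> \<Omega>" for x using that by (simp add: vec_eq_iff)
        then have d0: "(u has_derivative (\<lambda>h. 0)) (at x within \<Omega>)" if "x \<in> \<Omega>" for x
          using u1'[OF that] that by (simp add: has_derivative_at_withinI)
        have "u constant_on \<Omega>"
          by (rule has_derivative_zero_connected_constant_on[OF facts(3,2), of "{}"])
            (use d0 in \<open>auto intro: continuous_on_subset[OF cu sub_closure]\<close>)
        then have "\<exists>c. \<forall>x\<in>\<Omega>. u x = c" by (simp add: constant_on_def)
        then show False using nonconst by blast
      qed
    qed simp
  qed
  have bounded\<Omega>: "bounded (closure \<Omega>)"
    using bounded_subset[OF compact_imp_bounded[OF compact_sublevel[of g, OF g(1) cg g0]]] facts(4) by blast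
  have "{x. p x \<noteq> 0} \<subseteq> sublevel f \<union> closure \<Omega>" by (auto simp: p_def q_def split: if_splits)
  then have "closure {x. p x \<noteq> 0} \<subseteq> sublevel f \<union> closure \<Omega>"
    by (rule closure_minimal) (intro closed_Un cl closed_closure)
  moreover have bU: "bounded (sublevel f \<union> closure \<Omega>)"
    using bounded\<Omega> compact_imp_bounded[OF compact_sublevel[of f, OF f(1) cf f(4)]] by simp
  ultimately have comp_p: "compact (closure {x. p x \<noteq> 0})"
    unfolding compact_eq_bounded_closed using bounded_subset[OF bU] closed_closure by blast
  have comp_v: "compact (closure {x. v x \<noteq> 0})"
    unfolding supp using bounded\<Omega> by (simp add: compact_eq_bounded_closed)
  define v' where "v' = (\<lambda>x h. if x \<in> \<Omega> then pt (- D2u x h $ 2) (D2u x h $ 1) else 0)"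
  define p' where "p' = (\<lambda>x h. if x \<in> \<Omega> then - (Du x \<bullet> D2u x h + \<mu> * (u x * (Du x \<bullet> h))) else 0)"
  have weak: "stationary_weak_euler v p"
  proof (rule stationary_weak_eulerI[OF cv cp thin])
    fix x assume nf: "x \<notin> frontier \<Omega>"
    have Dui: "((\<lambda>x. Du x $ i) has_derivative (\<lambda>h. D2u x h $ i)) (at x)" if "x \<in> \<Omega>" for i
      by (rule bounded_linear.has_derivative[OF bounded_linear_vec_nth u2[OF that]])
    have out: "x \<in> - closure \<Omega>" "open (- closure \<Omega>)" if "x \<notin> \<Omega>"
      using nf that front_iff by auto
    show "(v has_derivative v' x) (at x)"
    proof (cases "x \<in> \<Omega>")
      case True
      have "(V has_derivative (\<lambda>h. pt (- D2u x h $ 2) (D2u x h $ 1))) (at x)"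
        unfolding V_def by (intro has_derivative_pt has_derivative_minus Dui True)
      then have "(v has_derivative (\<lambda>h. pt (- D2u x h $ 2) (D2u x h $ 1))) (at x)"
        by (rule has_derivative_transform_within_open[OF _ facts(2) True]) (rule v_eq)
      then show ?thesis using True by (simp add: v'_def)
    next
      case False
      have "((\<lambda>_. 0) has_derivative (\<lambda>_. 0)) (at x)" by simp
      then have "(v has_derivative (\<lambda>_. 0)) (at x)"
        by (rule has_derivative_transform_within_open[OF _ out(2,1)[OF False]]) (simp add: v_def)
      then show ?thesis using False by (simp add: v'_def)
    qed
    show "(p has_derivative p' x) (at x)"
    proof (cases "x \<in> \<Omega>")
      case True
      have "(P has_derivative (\<lambda>h. 0 + - (1 / 2) * ((Du x $ 1 * D2u x h $ 1 + D2u x h $ 1 * Du x $ 1) +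
          (Du x $ 2 * D2u x h $ 2 + D2u x h $ 2 * Du x $ 2) + \<mu> * (u x * (Du x \<bullet> h) + (Du x \<bullet> h) * u x)))) (at x)"
        unfolding P_def
        by (intro has_derivative_add has_derivative_const has_derivative_mult_right has_derivative_mult Dui True u1')
      moreover have "(\<lambda>h. 0 + - (1 / 2) * ((Du x $ 1 * D2u x h $ 1 + D2u x h $ 1 * Du x $ 1) +
          (Du x $ 2 * D2u x h $ 2 + D2u x h $ 2 * Du x $ 2) + \<mu> * (u x * (Du x \<bullet> h) + (Du x \<bullet> h) * u x))) = p' x"
        using True by (simp add: p'_def inner_2 fun_eq_iff algebra_simps)
      ultimately have "(P has_derivative p' x) (at x)" by simp
      then show ?thesis
        by (rule has_derivative_transform_within_open[OF _ facts(2) True]) (rule p_eq)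
    next
      case False
      \<comment> \<open>Off the closure a point lies in the open hole or in the open exterior, and
        the pressure is constant on each of them.\<close>
      have split: "- closure \<Omega> = - suplevel f \<union> - sublevel g" using facts(4) by blast
      have hole: "y \<in> sublevel f" if "y \<in> - suplevel f" for y using that by (auto simp: sublevel_def suplevel_def)
      have ext: "y \<notin> sublevel f" if "y \<in> - sublevel g" for y
        using that fg[of "angle y"] by (auto simp: sublevel_def)
      consider "x \<in> - suplevel f" | "x \<in> - sublevel g" using out(1)[OF False] split by blast
      then have "(p has_derivative (\<lambda>_. 0)) (at x)"
      proof cases
        case 1
        have "((\<lambda>_. \<mu> * (cout\<^sup>2 - cin\<^sup>2) / 2) has_derivative (\<lambda>_. 0)) (at x)" by simp
        then show ?thesis
          by (rule has_derivative_transform_within_open[OF _ open_Compl[OF cl(2)] 1])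
            (use facts(4) hole in \<open>auto simp: p_def q_def\<close>)
      next
        case 2
        have "((\<lambda>_. 0) has_derivative (\<lambda>_. 0)) (at x)" by simp
        then show ?thesis
          by (rule has_derivative_transform_within_open[OF _ open_Compl[OF cl(3)] 2])
            (use facts(4) ext in \<open>auto simp: p_def q_def\<close>)
      qed
      then show ?thesis using False by (simp add: p'_def)
    qed
    \<comment> \<open>The divergence of the rotated gradient is the difference of the two mixed
      second derivatives.\<close>
    show "v' x (axis 1 1) $ 1 + v' x (axis 2 1) $ 2 = 0"
      using sym by (simp add: v'_def)
    fix j :: 2
    show "v x $ 1 * v' x (axis 1 1) $ j + v x $ 2 * v' x (axis 2 1) $ j + p' x (axis j 1) = 0"
    proof (cases "x \<in> \<Omega>")
      case True
      have vx: "v x $ 1 = - Du x $ 2" "v x $ 2 = Du x $ 1" using v_eq[OF True, symmetric] by (simp_all add: V_def)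
      \<comment> \<open>In \<open>\<Omega>\<close> the convective term is the gradient of half of
        \<open>\<bar>Du\<bar>\<^sup>2\<close> minus the Laplacian times \<open>Du\<close>.
        Eliminating one diagonal entry by the Helmholtz equation turns the latter into the gradient
        of \<open>\<mu> * u\<^sup>2 / 2\<close>, and the sum is cancelled by
        \<open>p'\<close>.\<close>
      have h: "D2u x (axis 2 1) $ 2 = - \<mu> * u x - D2u x (axis 1 1) $ 1" using hz[OF True] by simp
      have ax: "axis 1 (1::real) $ (1::2) = 1" "axis 1 (1::real) $ (2::2) = 0"
        "axis 2 (1::real) $ (1::2) = 0" "axis 2 (1::real) $ (2::2) = 1"
        by (simp_all add: axis_def)
      show ?thesis
        using exhaust_2[of j] True sym[OF True]
        by (auto simp: vx v'_def p'_def inner_2 ax h algebra_simps)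
    qed (simp add: v'_def p'_def)
  qed
  show ?thesis
    using cv cp comp_v comp_p weak supp an_v an_p by blast
qed

theorem theorem1p3:
  fixes l :: nat and a s \<alpha> \<beta> \<mu> :: real
    and b B :: "real \<Rightarrow> real \<Rightarrow> real"
    and \<Omega> :: "(real^2) set"
    and u :: "real^2 \<Rightarrow> real" and Du :: "real^2 \<Rightarrow> real^2"
    and D2u :: "real^2 \<Rightarrow> real^2 \<Rightarrow> real^2"
  assumes a: "0 < a" "a < 1"
    and ab: "\<alpha> \<noteq> 0" "\<beta> \<noteq> 0"
    and an: "\<forall>\<^sub>F s' in nhds 0. analytic_on_torus (b s') \<and> analytic_on_torus (B s')"
    and an_s: "analytic_on_torus (b s) \<and> analytic_on_torus (B s)"
    and form_b: "\<forall>\<epsilon>>0. \<forall>\<^sub>F s' in at 0. \<forall>\<theta>. \<bar>b s' \<theta> - \<alpha> * cos (real l * \<theta>)\<bar> < \<epsilon>"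
    and form_B: "\<forall>\<epsilon>>0. \<forall>\<^sub>F s' in at 0. \<forall>\<theta>. \<bar>B s' \<theta> - \<beta> * cos (real l * \<theta>)\<bar> < \<epsilon>"
    and pos: "\<forall>\<theta>. 0 < a + s * b s \<theta> \<and> a + s * b s \<theta> < 1 + s * B s \<theta>"
    and Om: "\<Omega> = polar_annulus (\<lambda>\<theta>. a + s * b s \<theta>) (\<lambda>\<theta>. 1 + s * B s \<theta>)"
    and u_C1: "\<forall>x\<in>closure \<Omega>. (u has_derivative (\<lambda>h. Du x \<bullet> h)) (at x within closure \<Omega>)"
    and Du_cont: "continuous_on (closure \<Omega>) Du"
    and u_C2: "\<forall>x\<in>\<Omega>. (Du has_derivative D2u x) (at x)"
    and helmholtz: "\<forall>x\<in>\<Omega>. D2u x (axis 1 1) $ 1 + D2u x (axis 2 1) $ 2 + \<mu> * u x = 0"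
    and bdry: "\<forall>x\<in>frontier \<Omega>. Du x = 0"
    and nonradial: "\<not> (\<exists>f. \<forall>x\<in>\<Omega>. u x = f (norm x))"
  shows "\<exists>v p. continuous_on UNIV v \<and> continuous_on UNIV p \<and>
           compact (closure {x. v x \<noteq> 0}) \<and> compact (closure {x. p x \<noteq> 0}) \<and>
           stationary_weak_euler v p \<and>
           closure {x. v x \<noteq> 0} = closure \<Omega> \<and>
           (\<forall>i. real_analytic_on (\<lambda>x. v x $ i) \<Omega>) \<and> real_analytic_on p \<Omega>"
proof -
  obtain b' where b': "\<And>t. (b s has_real_derivative b' t) (at t)" "continuous_on UNIV b'"
    using analytic_on_torus_C1 an_s by blast
  obtain B' where B': "\<And>t. (B s has_real_derivative B' t) (at t)" "continuous_on UNIV B'"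
    using analytic_on_torus_C1 an_s by blast
  have per: "b s (t + 2 * pi) = b s t" "B s (t + 2 * pi) = B s t" for t
    using an_s by (auto simp: analytic_on_torus_def)
  show ?thesis
    unfolding Om
  proof (rule euler_from_overdetermined[where f' = "\<lambda>t. s * b' t" and g' = "\<lambda>t. s * B' t" and u = u and Du = Du
        and D2u = D2u and \<mu> = \<mu>])
    show "((\<lambda>t. a + s * b s t) has_real_derivative s * b' t) (at t)" for t
      using DERIV_add[OF DERIV_const DERIV_cmult[OF b'(1)]] by simp
    show "((\<lambda>t. 1 + s * B s t) has_real_derivative s * B' t) (at t)" for t
      using DERIV_add[OF DERIV_const DERIV_cmult[OF B'(1)]] by simp
    show "continuous_on UNIV (\<lambda>t. s * b' t)" "continuous_on UNIV (\<lambda>t. s * B' t)"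
      by (intro continuous_intros b'(2) B'(2))+
    show "\<exists>x\<in>polar_annulus (\<lambda>\<theta>. a + s * b s \<theta>) (\<lambda>\<theta>. 1 + s * B s \<theta>). u x \<noteq> c" for c
    proof (rule ccontr)
      assume "\<not> (\<exists>x\<in>polar_annulus (\<lambda>\<theta>. a + s * b s \<theta>) (\<lambda>\<theta>. 1 + s * B s \<theta>). u x \<noteq> c)"
      then have "\<forall>x\<in>\<Omega>. u x = c" unfolding Om by blast
      then have "\<exists>f. \<forall>x\<in>\<Omega>. u x = f (norm x)" by (intro exI[of _ "\<lambda>_. c"])
      with nonradial show False by (rule notE)
    qed
    show "a + s * b s (t + 2 * pi) = a + s * b s t" "1 + s * B s (t + 2 * pi) = 1 + s * B s t" for t
      by (simp_all only: per)
    show "0 < a + s * b s t" "a + s * b s t < 1 + s * B s t" for t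
      using pos by blast+
  qed (use u_C1 Du_cont u_C2 helmholtz bdry in \<open>unfold Om, blast+\<close>)
qed

end
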